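(* Value eliminations by conditioned neighbourhood substitution can be applied until convergence in $O(ed^3)$ time and $O(ed^2)$ space. That is, there is an algorithm which, given an arc-consistent binary CSP instance with $e$ non-trivial binary constraints and maximum domain size $d$, applies value eliminations by conditioned neighbourhood substitution until no further value elimination by conditioned neighbourhood substitution is possible, using $O(ed^3)$ time and $O(ed^2)$ space.
   Context: A binary CSP instance $I=(X,\mathcal{D},R)$ consists of a set $X$ of $n$ variables $x_1,\ldots,x_n$, a finite domain $\mathcal{D}(x_i)$ for each variable $x_i$, and a binary constraint relation $R_{ij} \subseteq \mathcal{D}(x_i)\times\mathcal{D}(x_j)$ (viewed as a boolean matrix) for each pair of distinct variables $x_i,x_j$, where $R_{ji}$ is always the transpose of $R_{ij}$. Two variables $x_i,x_j$ constrain each other if there is a non-trivial constraint between them, i.e. $R_{ij}\neq\mathcal{D}(x_i)\times\mathcal{D}(x_j)$. Let $E$ be the set of pairs $\{i,j\}$ such that $x_i,x_j$ constrain each other, let $e=|E|$, and let $d$ be the maximum size of the domains $\mathcal{D}(x_i)$. Basic operations on arrays (lookup, update) take $O(1)$ time. Indices such as $j,k$ range over $\{1,\ldots,n\}$. The instance is arc consistent if for all distinct $i,j$, each $v_i\in\mathcal{D}(x_i)$ has a support at $x_j$, i.e. there is $v_j\in\mathcal{D}(x_j)$ with $(v_i,v_j)\in R_{ij}$. Arc consistency is assumed to have been established before looking for eliminations. For $a,b\in\mathcal{D}(x_i)$ and $j\neq i$, write $b \xrightarrow{ij} a$ if for all $c\in\mathcal{D}(x_j)$, $(b,c)\in R_{ij}$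 implies $(a,c)\in R_{ij}$. A value $b\in\mathcal{D}(x_i)$ is conditioned neighbourhood-substitutable (CNS) if for some $j\neq i$, for all $c\in\mathcal{D}(x_j)$ with $(b,c)\in R_{ij}$, there exists $a\in\mathcal{D}(x_i)\setminus\{b\}$ such that $(a,c)\in R_{ij}$ and, for all $k\notin\{i,j\}$, $b\xrightarrow{ik}a$. A value elimination by conditioned neighbourhood substitution consists in deleting from some current domain $\mathcal{D}(x_i)$ a value $b$ which is CNS (with respect to the current domains, with relations restricted to the current domains). Applying such eliminations until convergence means performing them successively until, in the current instance, no value is CNS.
   Formalization: With u variables in no non-trivial constraint, the bounds proved are O(ed^3 + u(d+1)) time and O(ed^2 + u(d+1)) space; the stated bounds are the case u = 0 and fail otherwise, e.g. for e = 0 and n ≥ 2 variables with two values each, where n eliminations are needed. *)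

theory Defs
  imports Main
begin

section \<open>Binary CSP instances and conditioned neighbourhood substitution\<close>

text \<open>The variables are \<open>0, \<dots>, nvars I - 1\<close>. All fields are only meaningful
  at indices below \<open>nvars I\<close>, and \<open>crel I i j\<close> only for \<open>i \<noteq> j\<close>.\<close>

record 'v csp =
  nvars :: nat
  vdom :: "nat \<Rightarrow> 'v set"
  crel :: "nat \<Rightarrow> nat \<Rightarrow> ('v \<times> 'v) set"

definition binary_csp :: "'v csp \<Rightarrow> bool" where
  "binary_csp I \<longleftrightarrow>
     (\<forall>i<nvars I. finite (vdom I i)) \<and>
     (\<forall>i<nvars I. \<forall>j<nvars I. i \<noteq> j \<longrightarrow>
        crel I i j \<subseteq> vdom I i \<times> vdom I j \<and> crel I j i = (crel I i j)\<inverse>)"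

definition arc_consistent :: "'v csp \<Rightarrow> bool" where
  "arc_consistent I \<longleftrightarrow>
     (\<forall>i<nvars I. \<forall>j<nvars I. i \<noteq> j \<longrightarrow>
        (\<forall>v\<in>vdom I i. \<exists>w\<in>vdom I j. (v, w) \<in> crel I i j))"

definition constrain :: "'v csp \<Rightarrow> nat \<Rightarrow> nat \<Rightarrow> bool" where
  "constrain I i j \<longleftrightarrow>
     i < nvars I \<and> j < nvars I \<and> i \<noteq> j \<and> crel I i j \<noteq> vdom I i \<times> vdom I j"

definition constraint_edges :: "'v csp \<Rightarrow> nat set set" where
  "constraint_edges I = {{i, j} | i j. constrain I i j}"

definition num_constraints :: "'v csp \<Rightarrow> nat" where
  "num_constraints I = card (constraint_edges I)"

definition max_dom_size :: "'v csp \<Rightarrow> nat" where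
  "max_dom_size I = Max ((\<lambda>i. card (vdom I i)) ` {..<nvars I})"

text \<open>Variables that lie in no non-trivial constraint. Their number is not bounded by any
  function of the number of constraints, while each of them with \<open>m \<ge> 2\<close> values
  requires \<open>m - 1\<close> eliminations (if there are at least two variables).\<close>

definition num_unconstrained :: "'v csp \<Rightarrow> nat" where
  "num_unconstrained I = card {i. i < nvars I \<and> (\<forall>j. \<not> constrain I i j)}"

text \<open>\<open>arrow I i j b a\<close> is the relation written \<open>b \<rightarrow> a\<close> with superscript \<open>ij\<close>.\<close>

definition arrow :: "'v csp \<Rightarrow> nat \<Rightarrow> nat \<Rightarrow> 'v \<Rightarrow> 'v \<Rightarrow> bool" where
  "arrow I i j b a \<longleftrightarrow>
     (\<forall>c\<in>vdom I j. (b, c) \<in> crel I i j \<longrightarrow> (a, c) \<in> crel I i j)"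

definition cns :: "'v csp \<Rightarrow> nat \<Rightarrow> 'v \<Rightarrow> bool" where
  "cns I i b \<longleftrightarrow> i < nvars I \<and> b \<in> vdom I i \<and>
     (\<exists>j<nvars I. j \<noteq> i \<and>
        (\<forall>c\<in>vdom I j. (b, c) \<in> crel I i j \<longrightarrow>
           (\<exists>a\<in>vdom I i - {b}. (a, c) \<in> crel I i j \<and>
              (\<forall>k<nvars I. k \<notin> {i, j} \<longrightarrow> arrow I i k b a))))"

definition remove_value :: "'v csp \<Rightarrow> nat \<Rightarrow> 'v \<Rightarrow> 'v csp" where
  "remove_value I i b =
     (let D = (vdom I)(i := vdom I i - {b})
      in I\<lparr>vdom := D, crel := (\<lambda>j k. crel I j k \<inter> D j \<times> D k)\<rparr>)"

definition cns_elim :: "'v csp \<Rightarrow> 'v csp \<Rightarrow> bool" where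
  "cns_elim I I' \<longleftrightarrow> (\<exists>i b. cns I i b \<and> I' = remove_value I i b)"

definition cns_converged :: "'v csp \<Rightarrow> bool" where
  "cns_converged I \<longleftrightarrow> (\<nexists>i b. cns I i b)"


section \<open>A word RAM with arrays\<close>

text \<open>Programs of a first-order imperative language are run on a store consisting of registers
  and arrays of natural numbers. Every operator, register access and array access takes unit
  time; allocation of an array (initialised with zeros) takes time proportional to its length.
  Execution is stuck, i.e. there is no derivation, on an array access out of bounds, and when
  a number exceeding the word bound \<open>w\<close> is to be stored. Intermediate results inside one
  expression are not checked: as expressions are part of the fixed program, these are at most
  polynomial in \<open>w\<close> and the constants of the program.\<close>

datatype binop = Add | Sub | Mul | Less | Eq

datatype expr =
    Const nat
  | Reg string
  | Read string expr
  | Op binop expr expr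

datatype com =
    Assign string expr
  | Write string expr expr
  | New string expr
  | Seq com com
  | Cond expr com com
  | While expr com

record store =
  reg :: "string \<Rightarrow> nat"
  arr :: "string \<Rightarrow> nat list"

fun apply_op :: "binop \<Rightarrow> nat \<Rightarrow> nat \<Rightarrow> nat" where
  "apply_op Add x y = x + y"
| "apply_op Sub x y = x - y"
| "apply_op Mul x y = x * y"
| "apply_op Less x y = of_bool (x < y)"
| "apply_op Eq x y = of_bool (x = y)"

fun eval :: "store \<Rightarrow> expr \<Rightarrow> nat option" where
  "eval s (Const k) = Some k"
| "eval s (Reg x) = Some (reg s x)"
| "eval s (Read a f) =
     (case eval s f of
        None \<Rightarrow> None
      | Some k \<Rightarrow> if k < length (arr s a) then Some (arr s a ! k) else None)"
| "eval s (Op b f g) =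
     (case (eval s f, eval s g) of
        (Some x, Some y) \<Rightarrow> Some (apply_op b x y)
      | _ \<Rightarrow> None)"

fun cost :: "expr \<Rightarrow> nat" where
  "cost (Const k) = 1"
| "cost (Reg x) = 1"
| "cost (Read a f) = 1 + cost f"
| "cost (Op b f g) = 1 + cost f + cost g"

definition set_reg :: "string \<Rightarrow> nat \<Rightarrow> store \<Rightarrow> store" where
  "set_reg x v s = s\<lparr>reg := (reg s)(x := v)\<rparr>"

definition set_arr :: "string \<Rightarrow> nat list \<Rightarrow> store \<Rightarrow> store" where
  "set_arr a vs s = s\<lparr>arr := (arr s)(a := vs)\<rparr>"

text \<open>Only finitely many arrays of a store are ever non-empty in a run from a store with this
  property. The registers are not counted, since a program uses a constant number of them.\<close>

definition store_size :: "store \<Rightarrow> nat" where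
  "store_size s = (\<Sum>a | arr s a \<noteq> []. length (arr s a))"

text \<open>\<open>exec w P s t m s'\<close>: with word bound \<open>w\<close>, the program \<open>P\<close> started in
  \<open>s\<close> terminates in \<open>s'\<close> after time \<open>t\<close>, and \<open>m\<close> is the maximal size of
  the stores passed through, including \<open>s\<close> and \<open>s'\<close>.\<close>

inductive exec :: "nat \<Rightarrow> com \<Rightarrow> store \<Rightarrow> nat \<Rightarrow> nat \<Rightarrow> store \<Rightarrow> bool" for w where
  Assign: "eval s f = Some v \<Longrightarrow> v \<le> w \<Longrightarrow>
    exec w (Assign x f) s (1 + cost f) (store_size s) (set_reg x v s)"
| Write: "eval s f = Some k \<Longrightarrow> k < length (arr s a) \<Longrightarrow> eval s g = Some v \<Longrightarrow> v \<le> w \<Longrightarrow>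
    exec w (Write a f g) s (1 + cost f + cost g) (store_size s)
      (set_arr a ((arr s a)[k := v]) s)"
| New: "eval s f = Some k \<Longrightarrow> s' = set_arr a (replicate k 0) s \<Longrightarrow>
    exec w (New a f) s (1 + cost f + k) (max (store_size s) (store_size s')) s'"
| Seq: "exec w c1 s t1 m1 s1 \<Longrightarrow> exec w c2 s1 t2 m2 s2 \<Longrightarrow>
    exec w (Seq c1 c2) s (t1 + t2) (max m1 m2) s2"
| CondTrue: "eval s f = Some v \<Longrightarrow> v \<noteq> 0 \<Longrightarrow> exec w c1 s t m s' \<Longrightarrow>
    exec w (Cond f c1 c2) s (1 + cost f + t) m s'"
| CondFalse: "eval s f = Some 0 \<Longrightarrow> exec w c2 s t m s' \<Longrightarrow>
    exec w (Cond f c1 c2) s (1 + cost f + t) m s'"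
| WhileFalse: "eval s f = Some 0 \<Longrightarrow>
    exec w (While f c) s (1 + cost f) (store_size s) s"
| WhileTrue: "eval s f = Some v \<Longrightarrow> v \<noteq> 0 \<Longrightarrow> exec w c s t1 m1 s1 \<Longrightarrow>
    exec w (While f c) s1 t2 m2 s2 \<Longrightarrow>
    exec w (While f c) s (1 + cost f + t1 + t2) (max m1 m2) s2"

lemma exec_deterministic:
  "exec w P s t m s' \<Longrightarrow> exec w P s t1 m1 s1 \<Longrightarrow> t1 = t \<and> m1 = m \<and> s1 = s'"
proof (induction arbitrary: t1 m1 s1 rule: exec.induct)
  case (Assign s f v x)
  from Assign.prems Assign.hyps show ?case by cases simp
next
  case (Write s f k a g v)
  from Write.prems Write.hyps show ?case by cases simp
next
  case (New s f k s' a)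
  from New.prems New.hyps show ?case by cases simp
next
  case (Seq c1 s ta ma sa c2 tb mb sb)
  from Seq.prems show ?case by cases (use Seq.IH in blast)
next
  case (CondTrue s f v c1 t m s' c2)
  from CondTrue.prems show ?case
    by cases (use CondTrue.IH in blast, use CondTrue.hyps in simp)
next
  case (CondFalse s f c2 t m s' c1)
  from CondFalse.prems show ?case
    by cases (use CondFalse.hyps in simp, use CondFalse.IH in blast)
next
  case (WhileFalse s f c)
  from WhileFalse.prems WhileFalse.hyps show ?case by cases simp_all
next
  case (WhileTrue s f v c ta ma sa tb mb sb)
  from WhileTrue.prems show ?case
    by cases (use WhileTrue.hyps in simp, use WhileTrue.IH in blast)
qed


section \<open>Input and output\<close>

text \<open>The program only sees the positions of values in an arbitrary enumeration
  \<open>val i 0, val i 1, \<dots>\<close> of each domain, and an arbitrary list \<open>es\<close> of the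
  constraint edges, each occurring once and in an arbitrary orientation. Trivial constraints are
  not part of the input. With \<open>d\<close> the maximal domain size, row \<open>i\<close> of the array
  \<open>alive\<close> (of row length \<open>d\<close>) flags the positions of the values in the domain of
  \<open>i\<close>, and block \<open>q\<close> of the array \<open>rel\<close> is the \<open>d\<close> by \<open>d\<close> boolean matrix
  of the \<open>q\<close>-th constraint in \<open>es\<close>, padded with zeros.\<close>

definition presentation ::
    "'v csp \<Rightarrow> (nat \<Rightarrow> nat \<Rightarrow> 'v) \<Rightarrow> (nat \<times> nat) list \<Rightarrow> bool" where
  "presentation I val es \<longleftrightarrow>
     (\<forall>i<nvars I. bij_betw (val i) {..<card (vdom I i)} (vdom I i)) \<and>
     distinct (map (\<lambda>(i, j). {i, j}) es) \<and>
     set (map (\<lambda>(i, j). {i, j}) es) = constraint_edges I"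

definition input_alive :: "'v csp \<Rightarrow> nat list" where
  "input_alive I =
     concat (map (\<lambda>i. map (\<lambda>p. of_bool (p < card (vdom I i))) [0..<max_dom_size I])
       [0..<nvars I])"

definition input_matrix :: "'v csp \<Rightarrow> (nat \<Rightarrow> nat \<Rightarrow> 'v) \<Rightarrow> nat \<Rightarrow> nat \<Rightarrow> nat list" where
  "input_matrix I val i j =
     concat (map (\<lambda>p. map (\<lambda>q.
         of_bool (p < card (vdom I i) \<and> q < card (vdom I j) \<and> (val i p, val j q) \<in> crel I i j))
       [0..<max_dom_size I]) [0..<max_dom_size I])"

definition input_store ::
    "'v csp \<Rightarrow> (nat \<Rightarrow> nat \<Rightarrow> 'v) \<Rightarrow> (nat \<times> nat) list \<Rightarrow> store" where
  "input_store I val es =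
     \<lparr>reg = (\<lambda>_. 0)(''n'' := nvars I, ''d'' := max_dom_size I, ''e'' := length es),
      arr = (\<lambda>_. [])(''alive'' := input_alive I,
        ''fst'' := map fst es,
        ''snd'' := map snd es,
        ''rel'' := concat (map (\<lambda>(i, j). input_matrix I val i j) es))\<rparr>"

text \<open>The output is the final content of the array \<open>alive\<close>.\<close>

definition output_dom :: "'v csp \<Rightarrow> (nat \<Rightarrow> nat \<Rightarrow> 'v) \<Rightarrow> store \<Rightarrow> nat \<Rightarrow> 'v set" where
  "output_dom I val s i =
     {val i p | p. p < card (vdom I i) \<and>
        i * max_dom_size I + p < length (arr s ''alive'') \<and>
        arr s ''alive'' ! (i * max_dom_size I + p) \<noteq> 0}"

end

(* Every edge {i, j} is replaced by two arcs q from src q to dst q. The program maintains counters: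
   W q b a for the alive c at dst q with (b, c) allowed and (a, c) forbidden, so b -> a along q iff
   W q b a = 0; N i b a for the arcs q out of i with W q b a > 0; S q b c for the alive a that may
   replace b opposite to c, i.e. a and c are compatible and W p b a = 0 for all arcs p other than q
   out of src q. Whether a counts in S q b c is decided in constant time from N and W, and b is CNS
   through q iff S q b c > 0 for all alive c compatible with b, which is checked in time O(d) for
   the pairs (q, b) on a worklist. As alive sets shrink, N i b a can drop to 1 or 0 only once each,
   and only then a becomes a possible replacement of b; this pays for the updates of S. A deletion at
   i costs O(d^2) per arc out of i. Trivial constraints need not be tested: a value that is CNS
   through one of them is CNS through every arc out of its variable. A variable without arcs is
   reduced to a single value. *)

theory Submission
  imports Defs
begin

section \<open>Weakest preconditions with time\<close>

text \<open>The obstacle is that a rejected pair may become eliminable later. Rejection of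
  \<open>(q, b)\<close> is therefore backed by a certificate: an alive \<open>c\<close> compatible
  with \<open>b\<close> whose counter \<open>S q b c\<close> is zero (predicate
  \<open>pend\<close>). Only two events destroy it: \<open>c\<close> is deleted, or the counter
  leaves zero. Both put the pair back on the worklist, while a decrease of \<open>S\<close> is
  harmless. A drop of \<open>N i b a\<close> to 1 already matters, not only one to 0, because the
  replacement of \<open>b\<close> by \<open>a\<close> through \<open>q\<close> ignores
  \<open>W q b a\<close> itself: with one obstructing arc left exactly that arc profits, with none
  left every arc out of \<open>i\<close> does. Each of these two drops scans the arcs out of
  \<open>i\<close> at cost O(d) per arc, and summing over \<open>i\<close>, \<open>b\<close>,
  \<open>a\<close> gives O(e d^3). Arc consistency enters the correctness argument only:
  eliminations preserve it, nonempty domains stay nonempty, and so a trivial constraint always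
  offers some \<open>c\<close> to which the CNS condition can be applied. Time is bounded by a
  potential that also proves termination; space is read off from the allocations, which all precede
  the computation.\<close>

fun ev :: "store \<Rightarrow> expr \<Rightarrow> nat" where
  "ev s (Const k) = k"
| "ev s (Reg x) = reg s x"
| "ev s (Read a f) = arr s a ! ev s f"
| "ev s (Op b f g) = apply_op b (ev s f) (ev s g)"

text \<open>\<open>eval\<close> is split into a total value and a definedness condition so that the
  simplifier can execute expressions symbolically. Where \<open>safe\<close> fails, the value of
  \<open>ev\<close> has no meaning.\<close>

fun safe :: "store \<Rightarrow> expr \<Rightarrow> bool" where
  "safe s (Const k) = True"
| "safe s (Reg x) = True"
| "safe s (Read a f) = (safe s f \<and> ev s f < length (arr s a))"
| "safe s (Op b f g) = (safe s f \<and> safe s g)"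

lemma eval_eq: "eval s f = (if safe s f then Some (ev s f) else None)"
  by (induction f) auto

text \<open>Total correctness with the exact running time handed to the postcondition; by
  determinism of \<open>exec\<close> the existential describes the only run. The space component is
  dropped, as it is constant for programs that do not allocate.\<close>

definition run :: "nat \<Rightarrow> com \<Rightarrow> store \<Rightarrow> (nat \<Rightarrow> store \<Rightarrow> bool) \<Rightarrow> bool" where
  "run w c s Q \<longleftrightarrow> (\<exists>t m s'. exec w c s t m s' \<and> Q t s')"

lemma run_mono:
  assumes "run w c s Q" "\<And>t s'. Q t s' \<Longrightarrow> Q' t s'"
  shows "run w c s Q'"
  using assms unfolding run_def by blast

inductive_cases exec_AssignE: "exec w (Assign x f) s t m s'"
inductive_cases exec_WriteE: "exec w (Write a f g) s t m s'"
inductive_cases exec_SeqE: "exec w (Seq c1 c2) s t m s'"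
inductive_cases exec_CondE: "exec w (Cond f c1 c2) s t m s'"
inductive_cases exec_WhileE: "exec w (While f c) s t m s'"

text \<open>Equivalences instead of implications, here and for the other loop-free commands, let
  straight-line code and branches be executed by rewriting. Only loops need rules with
  invariants.\<close>

lemma run_Assign [simp]:
  "run w (Assign x f) s Q \<longleftrightarrow> safe s f \<and> ev s f \<le> w \<and> Q (1 + cost f) (set_reg x (ev s f) s)"
  unfolding run_def by (auto simp: eval_eq elim!: exec_AssignE split: if_splits intro!: exI exec.Assign)

lemma run_Write [simp]:
  "run w (Write a f g) s Q \<longleftrightarrow> safe s f \<and> safe s g \<and> ev s f < length (arr s a) \<and> ev s g \<le> w \<and>
     Q (1 + cost f + cost g) (set_arr a ((arr s a)[ev s f := ev s g]) s)"
  unfolding run_def by (auto simp: eval_eq elim!: exec_WriteE split: if_splits intro!: exI exec.Write)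

lemma run_Seq [simp]:
  "run w (Seq c1 c2) s Q \<longleftrightarrow> run w c1 s (\<lambda>t1 s1. run w c2 s1 (\<lambda>t2 s2. Q (t1 + t2) s2))"
  unfolding run_def by (blast elim: exec_SeqE intro: exec.Seq)

lemma run_Cond [simp]:
  "run w (Cond f c1 c2) s Q \<longleftrightarrow> safe s f \<and>
     (if ev s f \<noteq> 0 then run w c1 s (\<lambda>t. Q (1 + cost f + t)) else run w c2 s (\<lambda>t. Q (1 + cost f + t)))"
proof -
  have 1: "ev s f \<noteq> 0 \<Longrightarrow> safe s f \<Longrightarrow> exec w c1 s t m s' \<Longrightarrow>
      exec w (Cond f c1 c2) s (1 + cost f + t) m s'" for t m s'
    by (rule exec.CondTrue) (auto simp: eval_eq)
  have 2: "ev s f = 0 \<Longrightarrow> safe s f \<Longrightarrow> exec w c2 s t m s' \<Longrightarrow>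
      exec w (Cond f c1 c2) s (1 + cost f + t) m s'" for t m s'
    by (rule exec.CondFalse) (auto simp: eval_eq)
  have 3: "exec w (Cond f c1 c2) s t m s' \<Longrightarrow> safe s f \<and>
      (\<exists>t'. t = 1 + cost f + t' \<and> (if ev s f \<noteq> 0 then exec w c1 s t' m s' else exec w c2 s t' m s'))"
    for t m s'
    by (erule exec_CondE) (auto simp: eval_eq split: if_splits)
  show ?thesis
    unfolding run_def using 1 2 3 by (smt (verit, ccfv_threshold))
qed

lemma run_WhileFalse:
  assumes "safe s f" "ev s f = 0" "Q (1 + cost f) s"
  shows "run w (While f c) s Q"
  using assms unfolding run_def by (auto simp: eval_eq intro!: exI exec.WhileFalse)

lemma run_WhileTrue:
  assumes "safe s f" "ev s f \<noteq> 0"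
    and "run w c s (\<lambda>t1 s1. run w (While f c) s1 (\<lambda>t2. Q (1 + cost f + t1 + t2)))"
  shows "run w (While f c) s Q"
proof -
  obtain t1 m1 s1 t2 m2 s2 where *: "exec w c s t1 m1 s1" "exec w (While f c) s1 t2 m2 s2"
    "Q (1 + cost f + t1 + t2) s2"
    using assms(3) unfolding run_def by blast
  have "exec w (While f c) s (1 + cost f + t1 + t2) (max m1 m2) s2"
    by (rule exec.WhileTrue[OF _ assms(2) *(1,2)]) (use assms in \<open>simp add: eval_eq\<close>)
  with *(3) show ?thesis unfolding run_def by blast
qed

lemma reg_set_reg [simp]: "reg (set_reg x v s) = (reg s)(x := v)"
  and reg_set_arr [simp]: "reg (set_arr a l s) = reg s"
  and arr_set_reg [simp]: "arr (set_reg x v s) = arr s"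
  and arr_set_arr [simp]: "arr (set_arr a l s) = (arr s)(a := l)"
  by (simp_all add: set_reg_def set_arr_def)

section \<open>Frame properties: assigned registers and array lengths\<close>

fun wregs :: "com \<Rightarrow> string set" where
  "wregs (Assign x f) = {x}"
| "wregs (Write a f g) = {}"
| "wregs (New a f) = {}"
| "wregs (Seq c1 c2) = wregs c1 \<union> wregs c2"
| "wregs (Cond f c1 c2) = wregs c1 \<union> wregs c2"
| "wregs (While f c) = wregs c"

fun alloc_free :: "com \<Rightarrow> bool" where
  "alloc_free (Assign x f) = True"
| "alloc_free (Write a f g) = True"
| "alloc_free (New a f) = False"
| "alloc_free (Seq c1 c2) = (alloc_free c1 \<and> alloc_free c2)"
| "alloc_free (Cond f c1 c2) = (alloc_free c1 \<and> alloc_free c2)"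
| "alloc_free (While f c) = alloc_free c"

lemma exec_wregs: "exec w c s t m s' \<Longrightarrow> x \<notin> wregs c \<Longrightarrow> reg s' x = reg s x"
  by (induction rule: exec.induct) auto

abbreviation agree :: "string set \<Rightarrow> store \<Rightarrow> store \<Rightarrow> bool" where
  "agree X s s' \<equiv> \<forall>z. z \<notin> X \<longrightarrow> reg s' z = reg s z"

lemma run_frame:
  assumes "run w c s Q"
  shows "run w c s (\<lambda>t s'. Q t s' \<and> agree (wregs c) s s')"
  using assms exec_wregs unfolding run_def by blast

lemma store_size_cong:
  assumes "\<And>a. length (arr s' a) = length (arr s a)"
  shows "store_size s' = store_size s"
proof -
  have "{a. arr s' a \<noteq> []} = {a. arr s a \<noteq> []}"
    using assms by (metis length_0_conv)
  with assms show ?thesis unfolding store_size_def by simp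
qed

text \<open>Writes keep array lengths, so without \<open>New\<close> the store size never changes
  and its maximum over the run is the initial size. This removes space from all later reasoning
  about loops.\<close>

lemma exec_alloc_free:
  "exec w c s t m s' \<Longrightarrow> alloc_free c \<Longrightarrow>
     m = store_size s \<and> (\<forall>a. length (arr s' a) = length (arr s a))"
proof (induction rule: exec.induct)
  case (Seq c1 s t1 m1 s1 c2 t2 m2 s2)
  then show ?case using store_size_cong[of s1 s] by auto
next
  case (WhileTrue s f v c t1 m1 s1 t2 m2 s2)
  then show ?case using store_size_cong[of s1 s] by auto
qed auto

text \<open>The language has no empty command; a dummy assignment to the scratch register
  \<open>_\<close>, of cost 2, stands for it.\<close>

definition skip :: com where "skip = Assign ''_'' (Const 0)"

section \<open>Counting loops\<close>

abbreviation for_loop :: "string \<Rightarrow> string \<Rightarrow> com \<Rightarrow> com" where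
  "for_loop x y c \<equiv> While (Op Less (Reg x) (Reg y)) (Seq c (Assign x (Op Add (Reg x) (Const 1))))"

definition For :: "string \<Rightarrow> string \<Rightarrow> com \<Rightarrow> com" where
  "For x y c = Seq (Assign x (Const 0)) (for_loop x y c)"

lemma wregs_skip [simp]: "wregs skip = {''_''}"
  and wregs_For [simp]: "wregs (For x y c) = insert x (wregs c)"
  and alloc_free_skip [simp]: "alloc_free skip"
  and alloc_free_For [simp]: "alloc_free (For x y c) = alloc_free c"
  by (auto simp: skip_def For_def)

text \<open>The invariant \<open>J\<close> counts only the time of the bodies: each round adds 4 for
  the test and 4 for the increment, and the failing last test adds 4. The body has to establish
  \<open>J\<close> for the store in which the loop register is already advanced.\<close>

lemma run_For_aux:
  assumes "x \<notin> wregs c" "y \<notin> wregs c" "x \<noteq> y" "reg s0 y = K" "K \<le> w"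
    and step: "\<And>k t s. k < K \<Longrightarrow> agree (insert x (wregs c)) s0 s \<Longrightarrow> reg s x = k \<Longrightarrow>
       J k t s \<Longrightarrow> run w c s (\<lambda>t' s'. J (Suc k) (t + t') (set_reg x (Suc k) s'))"
    and "agree (insert x (wregs c)) s0 s" "reg s x = k" "k \<le> K" "J k t s"
  shows "run w (for_loop x y c) s
     (\<lambda>t' s'. \<exists>t1. t + t' = t1 + 4 + 8 * (K - k) \<and> J K t1 s' \<and>
        agree (insert x (wregs c)) s0 s')"
  using assms(7-)
proof (induction "K - k" arbitrary: k t s)
  case 0
  have "reg s y = K" using 0 assms by auto
  with 0 show ?case by (intro run_WhileFalse) auto
next
  case (Suc r)
  have y: "reg s y = K" using Suc assms by auto
  have k: "k < K" using Suc by auto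
  show ?case
  proof (rule run_WhileTrue)
    show "ev s (Op Less (Reg x) (Reg y)) \<noteq> 0" using y k Suc by simp
    have "run w c s (\<lambda>t' s'. J (Suc k) (t + t') (set_reg x (Suc k) s'))"
      by (rule step) (use k Suc in auto)
    from run_frame[OF this]
    show "run w (Seq c (Assign x (Op Add (Reg x) (Const 1)))) s
     (\<lambda>t1 s1. run w (for_loop x y c) s1
       (\<lambda>t2 s'. \<exists>t1'. t + (1 + cost (Op Less (Reg x) (Reg y)) + t1 + t2) = t1' + 4 + 8 * (K - k) \<and> J K t1' s' \<and>
                    agree (insert x (wregs c)) s0 s'))"
      unfolding run_Seq run_Assign
    proof (rule run_mono, goal_cases)
      case (1 ta sa)
      have xa: "reg sa x = k" using 1 assms(1) Suc by auto
      have "run w (for_loop x y c) (set_reg x (Suc k) sa)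
        (\<lambda>t' s'. \<exists>t1. t + ta + t' = t1 + 4 + 8 * (K - Suc k) \<and> J K t1 s' \<and>
        agree (insert x (wregs c)) s0 s')"
        by (rule Suc.hyps(1)) (use 1 Suc k in auto)
      then have "run w (for_loop x y c) (set_reg x (Suc k) sa)
        (\<lambda>t2 s'. \<exists>t1'. t + (1 + cost (Op Less (Reg x) (Reg y)) + (ta + (1 + cost (Op Add (Reg x) (Const 1)))) + t2) = t1' + 4 + 8 * (K - k) \<and> J K t1' s' \<and>
                    agree (insert x (wregs c)) s0 s')"
        proof (rule run_mono, elim exE conjE, goal_cases)
          case (1 t2 s' t1)
          then show ?case using k by (intro exI[of _ t1]) (auto simp: algebra_simps)
        qed
      then show ?case using xa k assms(5) by simp
    qed
  qed auto
qed

lemma run_For: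
  assumes "x \<notin> wregs c" "y \<notin> wregs c" "x \<noteq> y" "reg s y \<le> w"
    and "J 0 0 (set_reg x 0 s)"
    and "\<And>k t s'. k < reg s y \<Longrightarrow> agree (insert x (wregs c)) s s' \<Longrightarrow> reg s' x = k \<Longrightarrow>
       J k t s' \<Longrightarrow> run w c s' (\<lambda>t' s''. J (Suc k) (t + t') (set_reg x (Suc k) s''))"
    and "\<And>t s'. J (reg s y) t s' \<Longrightarrow> agree (insert x (wregs c)) s s' \<Longrightarrow>
       Q (t + 6 + 8 * reg s y) s'"
  shows "run w (For x y c) s Q"
  unfolding For_def run_Seq run_Assign
proof (intro conjI)
  have "run w (for_loop x y c) (set_reg x 0 s)
     (\<lambda>t' s'. \<exists>t1. 0 + t' = t1 + 4 + 8 * (reg s y - 0) \<and> J (reg s y) t1 s' \<and>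
        agree (insert x (wregs c)) s s')"
    by (rule run_For_aux[where J=J]) (use assms in auto)
  then show "run w (for_loop x y c)
     (set_reg x (ev s (Const 0)) s) (\<lambda>t2. Q (1 + cost (Const 0) + t2))"
    using assms(7) by (auto elim!: run_mono simp: add_ac)
qed auto

text \<open>Linked lists of the arcs out of each node are stored with indices shifted by one, \<open>0\<close> being the
  end of a list. The entry \<open>prv src i k\<close> stands for the last arc out of \<open>i\<close> before arc \<open>k\<close>.\<close>

primrec prv :: "(nat \<Rightarrow> nat) \<Rightarrow> nat \<Rightarrow> nat \<Rightarrow> nat" where
  "prv f i 0 = 0"
| "prv f i (Suc k) = (if f k = i then Suc k else prv f i k)"

lemma prv_le: "prv f i k \<le> k"
  by (induction k) auto

lemma prv_cases:
  obtains "prv f i k = 0" "\<forall>q<k. f q \<noteq> i"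
  | q where "prv f i k = Suc q" "q < k" "f q = i" "\<forall>p. q < p \<longrightarrow> p < k \<longrightarrow> f p \<noteq> i"
proof (induction k arbitrary: thesis)
  case (Suc k)
  show ?case
  proof (cases "f k = i")
    case True
    with Suc.prems(2)[of k] show ?thesis by simp
  next
    case False
    show ?thesis
    proof (rule Suc.IH)
      assume "prv f i k = 0" "\<forall>q<k. f q \<noteq> i"
      with False Suc.prems(1) show thesis by (simp add: less_Suc_eq)
    next
      fix q assume "prv f i k = Suc q" "q < k" "f q = i" "\<forall>p. q < p \<longrightarrow> p < k \<longrightarrow> f p \<noteq> i"
      with False Suc.prems(2)[of q] show thesis by (simp add: less_Suc_eq)
    qed
  qed
qed simp

lemma prv_pos_iff: "0 < prv f i k \<longleftrightarrow> (\<exists>q<k. f q = i)"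
  by (rule prv_cases[of f i k]) auto

text \<open>Decrementing first lets the body see the true arc number and leaves it in place as the
  index for fetching the next, again shifted, entry.\<close>

definition ForOut :: "string \<Rightarrow> expr \<Rightarrow> com \<Rightarrow> com" where
  "ForOut x f c = Seq (Assign x (Read ''hd'' f))
     (While (Reg x) (Seq (Assign x (Op Sub (Reg x) (Const 1))) (Seq c (Assign x (Read ''nx'' (Reg x))))))"

lemma wregs_ForOut [simp]: "wregs (ForOut x f c) = insert x (wregs c)"
  and alloc_free_ForOut [simp]: "alloc_free (ForOut x f c) = alloc_free c"
  by (auto simp: ForOut_def)

text \<open>The invariant ranges over the set \<open>D\<close> of arcs already visited, so users
  never see the order of the list. One round costs 2 for the test, 4 for the decrement and 3 for the
  fetch, hence 9 per arc.\<close>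

lemma run_ForOut:
  fixes src :: "nat \<Rightarrow> nat"
  defines "out \<equiv> \<lambda>i m. {q. q < m \<and> src q = i}"
  assumes "x \<notin> wregs c" "m \<le> w"
    and f: "safe s f" "ev s f < length (arr s ''hd'')" "arr s ''hd'' ! ev s f = prv src (ev s f) m"
    and nx: "\<And>D t s' q. J D t s' \<Longrightarrow> q < m \<Longrightarrow>
      q < length (arr s' ''nx'') \<and> arr s' ''nx'' ! q = prv src (src q) q"
    and J_set_reg: "\<And>D t s' k. J D t s' \<Longrightarrow> J D t (set_reg x k s')"
    and J0: "J {} 0 s"
    and step: "\<And>D q t s'. q < m \<Longrightarrow> src q = ev s f \<Longrightarrow> D \<subseteq> out (ev s f) m \<Longrightarrow> q \<notin> D \<Longrightarrow>
       agree (insert x (wregs c)) s s' \<Longrightarrow> reg s' x = q \<Longrightarrow>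
       J D t s' \<Longrightarrow> run w c s' (\<lambda>t'. J (insert q D) (t + t'))"
    and fin: "\<And>t s'. J (out (ev s f) m) t s' \<Longrightarrow> agree (insert x (wregs c)) s s' \<Longrightarrow>
       Q (t + 4 + cost f + 9 * card (out (ev s f) m)) s'"
  shows "run w (ForOut x f c) s Q"
proof -
  define i where "i = ev s f"
  define b where "b = Seq (Assign x (Op Sub (Reg x) (Const 1))) (Seq c (Assign x (Read ''nx'' (Reg x))))"
  have finite: "finite (out i k)" for k unfolding out_def by simp
  \<comment> \<open>The arcs out of \<open>i\<close> numbered \<open>k\<close> or higher have been
    visited. Induction is strong because the list jumps from \<open>k\<close> to the last matching
    arc below it.\<close>
  have loop: "run w (While (Reg x) b) s' (\<lambda>t' s'. \<exists>t1. t + t' = t1 + 2 + 9 * card (out i k) \<and> J (out i m) t1 s' \<and>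
        agree (insert x (wregs c)) s s')"
    if "k \<le> m" "J (out i m - out i k) t s'" "reg s' x = prv src i k"
      "agree (insert x (wregs c)) s s'" for k t s'
    using that
  proof (induction k arbitrary: t s' rule: less_induct)
    case (less k)
    show ?case
    proof (rule prv_cases[of src i k])
      assume *: "prv src i k = 0" "\<forall>q<k. src q \<noteq> i"
      then have "out i k = {}" by (auto simp: out_def)
      with less.prems * show ?thesis by (intro run_WhileFalse) auto
    next
      fix q assume *: "prv src i k = Suc q" "q < k" "src q = i" "\<forall>p. q < p \<longrightarrow> p < k \<longrightarrow> src p \<noteq> i"
      have out_k: "out i k = insert q (out i q)" "q \<notin> out i q"
        using * by (auto simp: out_def) (metis linorder_less_linear)
      have qm: "q < m" using * less.prems by simp
      have J1: "J (out i m - out i k) t (set_reg x q s')" by (rule J_set_reg) fact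
      have ins: "insert q (out i m - out i k) = out i m - out i q"
        unfolding out_k using \<open>q < m\<close> * by (auto simp: out_def)
      have body: "run w c (set_reg x q s') (\<lambda>t'. J (insert q (out i m - out i k)) (t + t'))"
        by (rule step) (use * less.prems J1 in \<open>auto simp: i_def out_def\<close>)
      show ?thesis
      proof (rule run_WhileTrue)
        show "run w b s' (\<lambda>t1 s1. run w (While (Reg x) b) s1 (\<lambda>t2 s'.
          \<exists>t1'. t + (1 + cost (Reg x) + t1 + t2) = t1' + 2 + 9 * card (out i k) \<and> J (out i m) t1' s' \<and>
             agree (insert x (wregs c)) s s'))"
        unfolding b_def run_Seq run_Assign
        proof (intro conjI)
          show "run w c (set_reg x (ev s' (Op Sub (Reg x) (Const 1))) s')
            (\<lambda>t1a s1. safe s1 (Read ''nx'' (Reg x)) \<and> ev s1 (Read ''nx'' (Reg x)) \<le> w \<and>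
             run w (While (Reg x) (Seq (Assign x (Op Sub (Reg x) (Const 1))) (Seq c (Assign x (Read ''nx'' (Reg x))))))
              (set_reg x (ev s1 (Read ''nx'' (Reg x))) s1)
              (\<lambda>t2 s'. \<exists>t1'. t + (1 + cost (Reg x) + (1 + cost (Op Sub (Reg x) (Const 1)) + (t1a + (1 + cost (Read ''nx'' (Reg x))))) + t2)
                 = t1' + 2 + 9 * card (out i k) \<and> J (out i m) t1' s' \<and>
                 agree (insert x (wregs c)) s s'))"
          proof -
            have "ev s' (Op Sub (Reg x) (Const 1)) = q" using * less.prems by simp
            moreover have "run w c (set_reg x q s') (\<lambda>t1a s1. safe s1 (Read ''nx'' (Reg x)) \<and> ev s1 (Read ''nx'' (Reg x)) \<le> w \<and>
             run w (While (Reg x) b) (set_reg x (ev s1 (Read ''nx'' (Reg x))) s1)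
              (\<lambda>t2 s'. \<exists>t1'. t + (1 + cost (Reg x) + (1 + cost (Op Sub (Reg x) (Const 1)) + (t1a + (1 + cost (Read ''nx'' (Reg x))))) + t2)
                 = t1' + 2 + 9 * card (out i k) \<and> J (out i m) t1' s' \<and>
                 agree (insert x (wregs c)) s s'))"
            proof (rule run_mono[OF run_frame[OF body]], elim conjE, goal_cases)
              case (1 ta sa)
              have x: "reg sa x = q" using 1 assms(2) by simp
              have n: "q < length (arr sa ''nx'')" "arr sa ''nx'' ! q = prv src (src q) q"
                using nx[OF 1(1) qm] by auto
              have "run w (While (Reg x) b) (set_reg x (prv src i q) sa)
                (\<lambda>t' s'. \<exists>t1. (t + ta) + t' = t1 + 2 + 9 * card (out i q) \<and> J (out i m) t1 s' \<and>
                  agree (insert x (wregs c)) s s')"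
                by (rule less.IH) (use * qm 1 less.prems ins in \<open>auto intro: J_set_reg\<close>)
              then have "run w (While (Reg x) b) (set_reg x (prv src i q) sa) (\<lambda>t2 s'. \<exists>t1'. t + (1 + cost (Reg x) + (1 + cost (Op Sub (Reg x) (Const 1)) + (ta + (1 + cost (Read ''nx'' (Reg x))))) + t2)
                 = t1' + 2 + 9 * card (out i k) \<and> J (out i m) t1' s' \<and>
                 agree (insert x (wregs c)) s s')"
              proof (rule run_mono, elim exE conjE, goal_cases)
                case (1 t2 s' t1)
                then show ?case using out_k finite by (intro exI[of _ t1]) auto
              qed
              then show ?case using x n * assms(3) qm prv_le[of src i q] by simp
            qed
            ultimately show ?thesis unfolding b_def by simp
          qed
        qed (use * less.prems assms(3) in auto)
      qed (use * less.prems in auto)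
    qed
  qed
  have "run w (While (Reg x) b) (set_reg x (prv src i m) s)
     (\<lambda>t' s'. \<exists>t1. 0 + t' = t1 + 2 + 9 * card (out i m) \<and> J (out i m) t1 s' \<and>
        agree (insert x (wregs c)) s s')"
    by (rule loop) (use J0 in \<open>auto intro: J_set_reg\<close>)
  then have "run w (While (Reg x) b) (set_reg x (prv src i m) s) (\<lambda>t2. Q (1 + cost (Read ''hd'' f) + t2))"
  proof (rule run_mono, elim exE conjE, goal_cases)
    case (1 t s' t1)
    then have "1 + cost (Read ''hd'' f) + t = t1 + 4 + cost f + 9 * card (out (ev s f) m)"
      by (simp add: i_def)
    with 1 show ?case using fin[of t1 s'] by (metis i_def)
  qed
  then show ?thesis
    unfolding ForOut_def using f prv_le[of src "ev s f" m] assms(3) by (simp add: i_def b_def)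
qed

section \<open>Counters of the propagation\<close>

lemma sum_of_bool_eq: "a < d \<Longrightarrow> (\<Sum>x<d. of_bool (P \<and> x = a)) = (of_bool P :: nat)" for a d :: nat
  by (cases P) (simp_all add: of_bool_def)

lemma sum_of_bool_eq': "finite A \<Longrightarrow> (\<Sum>x\<in>A. of_bool (P x)) = card (A \<inter> {x. P x})"
  by (simp add: of_bool_def sum.If_cases)

text \<open>Arc \<open>q + e\<close> reverses arc \<open>q\<close> for \<open>q < e\<close>. Values
  are positions, so all that remains of the instance is a boolean table. The assumption
  \<open>edge_inj\<close> excludes parallel arcs; it later identifies the other arcs out of a
  variable with its other neighbours.\<close>

locale net =
  fixes n d e :: nat and src dst :: "nat \<Rightarrow> nat" and R :: "nat \<Rightarrow> nat \<Rightarrow> nat \<Rightarrow> bool"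
  assumes src_less: "q < 2 * e \<Longrightarrow> src q < n" and dst_less: "q < 2 * e \<Longrightarrow> dst q < n"
    and src_neq_dst: "q < 2 * e \<Longrightarrow> src q \<noteq> dst q"
    and edge_inj: "q < 2 * e \<Longrightarrow> q' < 2 * e \<Longrightarrow> src q = src q' \<Longrightarrow> dst q = dst q' \<Longrightarrow> q = q'"
    and src_flip: "q < e \<Longrightarrow> src (q + e) = dst q" and dst_flip: "q < e \<Longrightarrow> dst (q + e) = src q"
    and R_flip: "q < e \<Longrightarrow> R (q + e) c b \<longleftrightarrow> R q b c"
begin

definition out :: "nat \<Rightarrow> nat set" where "out i = {q. q < 2 * e \<and> src q = i}"

definition flip :: "nat \<Rightarrow> nat" where "flip q = (if q < e then q + e else q - e)"

lemma flip_less: "q < 2 * e \<Longrightarrow> flip q < 2 * e"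
  and flip_flip: "q < 2 * e \<Longrightarrow> flip (flip q) = q"
  by (auto simp: flip_def)

lemma src_of_flip: "q < 2 * e \<Longrightarrow> src (flip q) = dst q"
  using src_flip[of q] dst_flip[of "q - e"] by (auto simp: flip_def)

lemma dst_of_flip: "q < 2 * e \<Longrightarrow> dst (flip q) = src q"
  using dst_flip[of q] src_flip[of "q - e"] by (auto simp: flip_def)

lemma finite_out [simp]: "finite (out i)"
  by (simp add: out_def)

definition doms :: "(nat \<Rightarrow> nat set) \<Rightarrow> bool" where
  "doms A \<longleftrightarrow> (\<forall>i. A i \<subseteq> {..<d})"

lemma doms_finite: "doms A \<Longrightarrow> finite (A i)"
  by (auto simp: doms_def intro: finite_subset)

lemma doms_card: "doms A \<Longrightarrow> card (A i) \<le> d"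
  by (metis card_lessThan card_mono doms_def finite_lessThan)

lemma doms_delete: "doms A \<Longrightarrow> doms (A(i := A i - X))"
  by (auto simp: doms_def)

type_synonym table = "nat \<Rightarrow> nat \<Rightarrow> nat \<Rightarrow> nat"

definition Wf :: "(nat \<Rightarrow> nat set) \<Rightarrow> table" where
  "Wf A q b a = card {c \<in> A (dst q). R q b c \<and> \<not> R q a c}"

text \<open>The table \<open>W\<close> is a parameter, not fixed to \<open>Wf A\<close>: during a
  deletion the stored table lies between the counts for the old and the new domains, and
  \<open>N\<close> and \<open>S\<close> have to be described relative to it.\<close>

definition Nf :: "table \<Rightarrow> table" where
  "Nf W i b a = card {q \<in> out i. 0 < W q b a}"

definition good :: "table \<Rightarrow> nat \<Rightarrow> nat \<Rightarrow> nat \<Rightarrow> bool" where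
  "good W q b a \<longleftrightarrow> (\<forall>p\<in>out (src q). p \<noteq> q \<longrightarrow> W p b a = 0)"

definition Sf :: "(nat \<Rightarrow> nat set) \<Rightarrow> table \<Rightarrow> table" where
  "Sf A W q b c = card {a \<in> A (src q). a \<noteq> b \<and> R q a c \<and> good W q b a}"

text \<open>With \<open>F\<close> empty, no check along an arc can succeed, which is how convergence
  is read off. Dead values need no certificate, since \<open>Check\<close> also tests
  \<open>alive\<close>.\<close>

definition pend :: "(nat \<times> nat) set \<Rightarrow> (nat \<Rightarrow> nat set) \<Rightarrow> table \<Rightarrow> bool" where
  "pend F A S \<longleftrightarrow> (\<forall>q<2*e. \<forall>b\<in>A (src q). (q, b) \<notin> F \<longrightarrow> (\<exists>c\<in>A (dst q). R q b c \<and> S q b c = 0))"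

text \<open>The sum runs over arcs instead of variables, so that a triple \<open>(i, b, a)\<close>
  is weighted by the number of arcs out of \<open>i\<close>: the length of the scan that follows a
  fall of its truncated count.\<close>

definition phi :: "table \<Rightarrow> nat" where
  "phi W = (\<Sum>q<2*e. \<Sum>b<d. \<Sum>a<d. min 2 (Nf W (src q) b a))"

lemma Nf_le: "Nf W i b a \<le> card (out i)"
  unfolding Nf_def by (rule card_mono) auto

lemma card_out_le: "card (out i) \<le> 2 * e"
proof -
  have "out i \<subseteq> {..<2*e}" by (auto simp: out_def)
  from card_mono[OF _ this] show ?thesis by simp
qed

text \<open>Taking away the contribution of \<open>q\<close> itself leaves the obstacles on the
  other arcs. The subtraction never truncates, because \<open>q\<close> is among the counted arcs
  whenever its entry is positive.\<close>

lemma good_iff: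
  assumes "q < 2 * e"
  shows "good W q b a \<longleftrightarrow> Nf W (src q) b a - of_bool (0 < W q b a) = 0"
proof -
  let ?X = "{p \<in> out (src q). 0 < W p b a}"
  have "good W q b a \<longleftrightarrow> ?X - {q} = {}"
    unfolding good_def by auto
  also have "\<dots> \<longleftrightarrow> card (?X - {q}) = 0" by simp
  also have "card (?X - {q}) = Nf W (src q) b a - of_bool (0 < W q b a)"
    using assms by (auto simp: Nf_def card_Diff_singleton_if out_def)
  finally show ?thesis .
qed

lemma Wf_le: "doms A \<Longrightarrow> Wf A q b a \<le> d"
  unfolding Wf_def
  by (rule order.trans[OF card_mono[of "A (dst q)"]]) (auto simp: doms_finite doms_card)

lemma Sf_le: "doms A \<Longrightarrow> Sf A W q b c \<le> d"
  unfolding Sf_def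
  by (rule order.trans[OF card_mono[of "A (src q)"]]) (auto simp: doms_finite doms_card)

text \<open>The form old value = new value + change, used also in \<open>Sf_delete\<close> and
  \<open>Nf_dec\<close>, stays clear of truncated subtraction.\<close>

lemma Wf_delete:
  assumes "doms A" "v \<in> A i"
  shows "Wf A q b a = Wf (A(i := A i - {v})) q b a + of_bool (dst q = i \<and> R q b v \<and> \<not> R q a v)"
proof (cases "dst q = i \<and> R q b v \<and> \<not> R q a v")
  case True
  have "{c \<in> A (dst q). R q b c \<and> \<not> R q a c} =
     insert v {c \<in> (A(i := A i - {v})) (dst q). R q b c \<and> \<not> R q a c}"
    using True assms by auto
  then show ?thesis unfolding Wf_def using True doms_finite[OF assms(1)] by simp
next
  case False
  then have "{c \<in> A (dst q). R q b c \<and> \<not> R q a c} =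
     {c \<in> (A(i := A i - {v})) (dst q). R q b c \<and> \<not> R q a c}"
    by auto
  then have "Wf A q b a = Wf (A(i := A i - {v})) q b a" by (simp only: Wf_def)
  with False show ?thesis by (simp only: of_bool_eq add_0_right)
qed

lemma Sf_delete:
  assumes "doms A" "v \<in> A i"
  shows "Sf A W q b c =
    Sf (A(i := A i - {v})) W q b c + of_bool (src q = i \<and> b \<noteq> v \<and> R q v c \<and> good W q b v)"
proof (cases "src q = i \<and> b \<noteq> v \<and> R q v c \<and> good W q b v")
  case True
  have "{a \<in> A (src q). a \<noteq> b \<and> R q a c \<and> good W q b a} =
     insert v {a \<in> (A(i := A i - {v})) (src q). a \<noteq> b \<and> R q a c \<and> good W q b a}"
    using True assms by auto
  then show ?thesis unfolding Sf_def using True doms_finite[OF assms(1)] by simp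
next
  case False
  then have "{a \<in> A (src q). a \<noteq> b \<and> R q a c \<and> good W q b a} =
     {a \<in> (A(i := A i - {v})) (src q). a \<noteq> b \<and> R q a c \<and> good W q b a}"
    by auto
  then have "Sf A W q b c = Sf (A(i := A i - {v})) W q b c" by (simp only: Sf_def)
  with False show ?thesis by (simp only: of_bool_eq add_0_right)
qed

definition dec :: "table \<Rightarrow> nat \<Rightarrow> nat \<Rightarrow> nat \<Rightarrow> table" where
  "dec W p b a = (\<lambda>q' b' a'. W q' b' a' - of_bool (q' = p \<and> b' = b \<and> a' = a))"

lemma Nf_dec:
  assumes "p < 2 * e" "0 < W p b a"
  shows "Nf W i b' a' = Nf (dec W p b a) i b' a' + of_bool (i = src p \<and> b' = b \<and> a' = a \<and> W p b a = 1)"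
proof (cases "i = src p \<and> b' = b \<and> a' = a \<and> W p b a = 1")
  case True
  have "{q \<in> out i. 0 < W q b' a'} = insert p {q \<in> out i. 0 < dec W p b a q b' a'}"
    using True assms by (auto simp: dec_def out_def)
  moreover have "p \<notin> {q \<in> out i. 0 < dec W p b a q b' a'}"
    using True by (auto simp: dec_def)
  ultimately show ?thesis unfolding Nf_def using True by simp
next
  case False
  then have "{q \<in> out i. 0 < W q b' a'} = {q \<in> out i. 0 < dec W p b a q b' a'}"
    using assms by (auto simp: dec_def out_def)
  then show ?thesis unfolding Nf_def using False by simp
qed

text \<open>A decrement can only create replacements, and only when the entry reaches zero: it then
  removes an obstacle for the other arcs out of \<open>src p\<close>, never for \<open>p\<close>,
  which ignores its own entry.\<close>

lemma good_dec:
  assumes "p < 2 * e" "0 < W p b a"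
  shows "good (dec W p b a) q b' a' \<longleftrightarrow>
    good W q b' a' \<or> (src q = src p \<and> q \<noteq> p \<and> b' = b \<and> a' = a \<and> W p b a = 1 \<and> good (dec W p b a) q b a)"
proof -
  have 1: "good W q b' a' \<Longrightarrow> good (dec W p b a) q b' a'"
    by (auto simp: good_def dec_def)
  have 2: "good W q b' a'" if "good (dec W p b a) q b' a'"
    "\<not> (src q = src p \<and> q \<noteq> p \<and> b' = b \<and> a' = a \<and> W p b a = 1)"
  proof -
    have "W r b' a' = 0" if r: "r \<in> out (src q)" "r \<noteq> q" for r
    proof (cases "r = p \<and> b' = b \<and> a' = a")
      case True
      then have "W p b a - 1 = 0" "src q = src p" "q \<noteq> p"
        using \<open>good (dec W p b a) q b' a'\<close> r by (auto simp: good_def dec_def out_def)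
      then have False using that(2) True assms that
        using \<open>\<not> (src q = src p \<and> q \<noteq> p \<and> b' = b \<and> a' = a \<and> W p b a = 1)\<close> by auto
      then show ?thesis ..
    next
      case False
      then show ?thesis
        using \<open>good (dec W p b a) q b' a'\<close> r by (auto simp: good_def dec_def)
    qed
    then show ?thesis by (simp add: good_def)
  qed
  from 1 2 show ?thesis by blast
qed

lemma not_good_dec:
  assumes "p < 2 * e" "0 < W p b a" "src q = src p" "q \<noteq> p"
  shows "\<not> good W q b a"
  using assms by (auto simp: good_def out_def)

lemma Sf_dec:
  assumes "doms A" "p < 2 * e" "0 < W p b a"
  shows "Sf A (dec W p b a) q b' c = Sf A W q b' c +
     of_bool (src q = src p \<and> q \<noteq> p \<and> b' = b \<and> W p b a = 1 \<and> a \<in> A (src p) \<and> a \<noteq> b \<and> R q a c \<and>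
        good (dec W p b a) q b a)"
proof (cases "src q = src p \<and> q \<noteq> p \<and> b' = b \<and> W p b a = 1 \<and> a \<in> A (src p) \<and> a \<noteq> b \<and> R q a c \<and>
        good (dec W p b a) q b a")
  case True
  have "{a' \<in> A (src q). a' \<noteq> b' \<and> R q a' c \<and> good (dec W p b a) q b' a'} =
     insert a {a' \<in> A (src q). a' \<noteq> b' \<and> R q a' c \<and> good W q b' a'}"
    using True good_dec[of p W b a q b', OF assms(2,3)] by auto
  moreover have "\<not> good W q b a"
    using not_good_dec[of p W b a q] assms True by blast
  ultimately show ?thesis unfolding Sf_def using True doms_finite[OF assms(1)] by simp
next
  case False
  then have "{a' \<in> A (src q). a' \<noteq> b' \<and> R q a' c \<and> good (dec W p b a) q b' a'} =
     {a' \<in> A (src q). a' \<noteq> b' \<and> R q a' c \<and> good W q b' a'}"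
    using good_dec[of p W b a q b', OF assms(2,3)] by auto
  then have "Sf A (dec W p b a) q b' c = Sf A W q b' c" by (simp only: Sf_def)
  with False show ?thesis by (simp only: of_bool_eq add_0_right)
qed

text \<open>If the new count is below 2, the old one was at most 2, so \<open>min 2\<close> really
  falls by one, once for every arc out of \<open>src p\<close>. Any other decrement leaves
  \<open>phi\<close> at most as large as before.\<close>

lemma phi_dec:
  assumes "p < 2 * e" "0 < W p b a" "b < d" "a < d"
  shows "phi (dec W p b a) + of_bool (W p b a = 1 \<and> Nf (dec W p b a) (src p) b a < 2) * card (out (src p)) \<le> phi W"
proof -
  let ?W = "dec W p b a"
  have le: "min 2 (Nf ?W (src q) b' a') \<le> min 2 (Nf W (src q) b' a')" for q b' a'
  proof (rule min.mono)
    show "Nf ?W (src q) b' a' \<le> Nf W (src q) b' a'"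
      unfolding Nf_dec[of p W b a "src q" b' a', OF assms(1,2)] by (rule le_add1)
  qed simp
  show ?thesis
  proof (cases "W p b a = 1 \<and> Nf ?W (src p) b a < 2")
    case False
    have "phi ?W \<le> phi W" unfolding phi_def by (intro sum_mono le)
    with False show ?thesis by auto
  next
    case True
    have key: "Nf W (src p) b a = Nf ?W (src p) b a + 1"
      using Nf_dec[of p W b a "src p" b a, OF assms(1,2)] conjunct1[OF True] by (simp only: simp_thms of_bool_eq)
    have less2: "Nf ?W (src p) b a < 2" using True by blast
    \<comment> \<open>An indicator placed at \<open>(b, a)\<close> for each arc with source
      \<open>src p\<close> makes the inequality hold entry by entry; summing the indicators over all
      arcs gives \<open>card (out (src p))\<close>.\<close>
    have step: "(\<Sum>b'<d. \<Sum>a'<d. min 2 (Nf ?W (src q) b' a')) + of_bool (src q = src p)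
        \<le> (\<Sum>b'<d. \<Sum>a'<d. min 2 (Nf W (src q) b' a'))" for q
    proof -
      have "(\<Sum>a'<d. min 2 (Nf ?W (src q) b' a')) + of_bool (src q = src p \<and> b' = b)
        \<le> (\<Sum>a'<d. min 2 (Nf W (src q) b' a'))" for b'
      proof -
        have "(\<Sum>a'<d. min 2 (Nf ?W (src q) b' a')) + of_bool (src q = src p \<and> b' = b)
          = (\<Sum>a'<d. min 2 (Nf ?W (src q) b' a') + of_bool (src q = src p \<and> b' = b \<and> a' = a))"
          using sum_of_bool_eq[OF assms(4), of "src q = src p \<and> b' = b"] by (simp only: sum.distrib conj_assoc)
        also have "\<dots> \<le> (\<Sum>a'<d. min 2 (Nf W (src q) b' a'))"
        proof (rule sum_mono)
          fix a'
          show "min 2 (Nf ?W (src q) b' a') + of_bool (src q = src p \<and> b' = b \<and> a' = a) \<le> min 2 (Nf W (src q) b' a')"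
          proof (cases "src q = src p \<and> b' = b \<and> a' = a")
            case t: True
            have eqs: "src q = src p" "b' = b" "a' = a" using t by blast+
            show ?thesis unfolding eqs key using less2 by simp
          next
            case False
            then have "of_bool (src q = src p \<and> b' = b \<and> a' = a) = (0::nat)" by (simp only: of_bool_def if_False)
            then show ?thesis using le[of q b' a'] by (simp only: add_0_right)
          qed
        qed
        finally show ?thesis .
      qed
      then have "(\<Sum>b'<d. (\<Sum>a'<d. min 2 (Nf ?W (src q) b' a')) + of_bool (src q = src p \<and> b' = b))
        \<le> (\<Sum>b'<d. \<Sum>a'<d. min 2 (Nf W (src q) b' a'))"
        by (rule sum_mono)
      moreover have "(\<Sum>b'<d. (\<Sum>a'<d. min 2 (Nf ?W (src q) b' a')) + of_bool (src q = src p \<and> b' = b))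
        = (\<Sum>b'<d. (\<Sum>a'<d. min 2 (Nf ?W (src q) b' a'))) + of_bool (src q = src p)"
        using sum_of_bool_eq[OF assms(3), of "src q = src p"] by (simp only: sum.distrib)
      ultimately show ?thesis by simp
    qed
    have "card (out (src p)) = (\<Sum>q<2*e. of_bool (src q = src p))"
    proof -
      have "(\<Sum>q<2*e. of_bool (src q = src p)) = card ({..<2*e} \<inter> {q. src q = src p})"
        by (rule sum_of_bool_eq') simp
      moreover have "{..<2*e} \<inter> {q. src q = src p} = out (src p)" by (auto simp: out_def)
      ultimately show ?thesis by simp
    qed
    then have "phi ?W + card (out (src p)) = (\<Sum>q<2*e. (\<Sum>b'<d. \<Sum>a'<d. min 2 (Nf ?W (src q) b' a')) + of_bool (src q = src p))"
      by (simp add: phi_def sum.distrib)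
    also have "\<dots> \<le> phi W" unfolding phi_def by (rule sum_mono) (rule step)
    finally show ?thesis using True by simp
  qed
qed

lemma phi_le: "phi W \<le> 4 * e * d * d"
proof -
  have "phi W \<le> (\<Sum>q<2*e. \<Sum>b<d. \<Sum>a<d. 2)"
    unfolding phi_def by (intro sum_mono) auto
  then show ?thesis by simp
qed

end

section \<open>The propagation procedures\<close>

definition ix2 :: "nat \<Rightarrow> nat \<Rightarrow> nat \<Rightarrow> nat" where "ix2 d q b = q * d + b"
definition ix3 :: "nat \<Rightarrow> nat \<Rightarrow> nat \<Rightarrow> nat \<Rightarrow> nat" where "ix3 d q b a = (q * d + b) * d + a"

lemma ix2_less [simp]:
  assumes "q < m" "b < d"
  shows "ix2 d q b < m * d"
proof -
  have "q * d + b < (q + 1) * d" using assms by simp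
  also have "\<dots> \<le> m * d" using assms by (intro mult_right_mono) auto
  finally show ?thesis by (simp add: ix2_def)
qed

lemma ix3_eq: "ix3 d q b a = ix2 d (ix2 d q b) a"
  by (simp add: ix2_def ix3_def)

lemma ix3_less [simp]: "q < m \<Longrightarrow> b < d \<Longrightarrow> a < d \<Longrightarrow> ix3 d q b a < m * d * d"
  unfolding ix3_eq by (intro ix2_less)

lemma ix2_inj [simp]:
  assumes "b < d" "b' < d"
  shows "ix2 d q b = ix2 d q' b' \<longleftrightarrow> q = q' \<and> b = b'"
proof
  assume "ix2 d q b = ix2 d q' b'"
  then have "(q * d + b) div d = (q' * d + b') div d" "(q * d + b) mod d = (q' * d + b') mod d"
    by (simp_all add: ix2_def)
  with assms show "q = q' \<and> b = b'" by simp
qed simp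

lemma ix3_inj [simp]:
  "b < d \<Longrightarrow> b' < d \<Longrightarrow> a < d \<Longrightarrow> a' < d \<Longrightarrow>
     ix3 d q b a = ix3 d q' b' a' \<longleftrightarrow> q = q' \<and> b = b' \<and> a = a'"
  by (simp add: ix3_eq)

definition I2 :: "expr \<Rightarrow> expr \<Rightarrow> expr" where
  "I2 f g = Op Add (Op Mul f (Reg ''d'')) g"

definition I3 :: "expr \<Rightarrow> expr \<Rightarrow> expr \<Rightarrow> expr" where
  "I3 f g h = I2 (I2 f g) h"

lemma I2_simps [simp]: "ev s (I2 f g) = ix2 (reg s ''d'') (ev s f) (ev s g)"
  "safe s (I2 f g) \<longleftrightarrow> safe s f \<and> safe s g" "cost (I2 f g) = 3 + cost f + cost g"
  by (auto simp: I2_def ix2_def)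

lemma I3_simps [simp]: "ev s (I3 f g h) = ix3 (reg s ''d'') (ev s f) (ev s g) (ev s h)"
  "safe s (I3 f g h) \<longleftrightarrow> safe s f \<and> safe s g \<and> safe s h" "cost (I3 f g h) = 6 + cost f + cost g + cost h"
  by (auto simp: I3_def ix3_def ix2_def)

text \<open>The flag keeps a pair from being stacked twice, which bounds the height of the stack,
  and thus its space, by \<open>2 * e * d\<close>.\<close>

definition Push :: "expr \<Rightarrow> expr \<Rightarrow> com" where
  "Push f g = Cond (Read ''fl'' (I2 f g)) skip
     (Seq (Write ''fl'' (I2 f g) (Const 1))
     (Seq (Write ''stq'' (Reg ''sp'') f)
     (Seq (Write ''stb'' (Reg ''sp'') g)
       (Assign ''sp'' (Op Add (Reg ''sp'') (Const 1))))))"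

text \<open>Branch-free: \<open>e\<close> is added, and for arcs numbered \<open>e\<close> or higher
  \<open>2 * e\<close> is taken away again.\<close>

definition Flip :: "expr \<Rightarrow> expr" where
  "Flip f = Op Sub (Op Add f (Reg ''e'')) (Op Mul (Reg ''E'') (Op Sub (Const 1) (Op Less f (Reg ''e''))))"

definition Gain :: com where
  "Gain = For ''c'' ''d'' (Write ''S'' (I3 (Reg ''g'') (Reg ''y'') (Reg ''c''))
     (Op Add (Read ''S'' (I3 (Reg ''g'') (Reg ''y'') (Reg ''c'')))
             (Read ''R'' (I3 (Reg ''g'') (Reg ''z'') (Reg ''c'')))))"

definition Loss :: com where
  "Loss = For ''c'' ''d'' (Write ''S'' (I3 (Reg ''x'') (Reg ''y'') (Reg ''c''))
     (Op Sub (Read ''S'' (I3 (Reg ''x'') (Reg ''y'') (Reg ''c'')))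
             (Read ''R'' (I3 (Reg ''x'') (Reg ''v'') (Reg ''c'')))))"

text \<open>The block of a variable in the array \<open>N\<close> is that of one of its arcs: with a block for each of the
  \<open>n\<close> variables, the array would be too large when many variables are isolated.\<close>

definition Nix :: "expr \<Rightarrow> expr \<Rightarrow> expr \<Rightarrow> expr" where
  "Nix f g h = I3 (Op Sub (Read ''hd'' (Read ''src'' f)) (Const 1)) g h"

definition Good :: "expr \<Rightarrow> expr \<Rightarrow> expr \<Rightarrow> expr" where
  "Good f g h = Op Eq (Op Sub (Read ''N'' (Nix f g h)) (Op Less (Const 0) (Read ''W'' (I3 f g h)))) (Const 0)"

definition Spread :: com where
  "Spread = ForOut ''g'' (Read ''src'' (Reg ''p''))
    (Cond (Op Mul (Op Sub (Const 1) (Op Eq (Reg ''g'') (Reg ''p'')))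
            (Good (Reg ''g'') (Reg ''y'') (Reg ''z'')))
      (Seq (Push (Reg ''g'') (Reg ''y'')) Gain) skip)"

text \<open>Products act as conjunction and \<open>1 - x\<close> as negation; nothing is
  short-circuited, so every read must be in bounds. A dead \<open>z\<close>, or
  \<open>z = y\<close>, is never counted in \<open>S\<close>, and while two positive entries remain
  every arc still sees an obstacle on another one.\<close>

definition Critical :: expr where
  "Critical = Op Mul (Op Less (Read ''N'' (Nix (Reg ''p'') (Reg ''y'') (Reg ''z''))) (Const 2))
     (Op Mul (Read ''alive'' (I2 (Read ''src'' (Reg ''p'')) (Reg ''z'')))
       (Op Sub (Const 1) (Op Eq (Reg ''z'') (Reg ''y''))))"

definition Lower :: com where
  "Lower = Seq (Write ''N'' (Nix (Reg ''p'') (Reg ''y'') (Reg ''z''))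
      (Op Sub (Read ''N'' (Nix (Reg ''p'') (Reg ''y'') (Reg ''z''))) (Const 1)))
    (Cond Critical Spread skip)"

definition Dec :: com where
  "Dec = Seq (Write ''W'' (I3 (Reg ''p'') (Reg ''y'') (Reg ''z''))
      (Op Sub (Read ''W'' (I3 (Reg ''p'') (Reg ''y'') (Reg ''z''))) (Const 1)))
    (Cond (Read ''W'' (I3 (Reg ''p'') (Reg ''y'') (Reg ''z''))) skip
    Lower)"

text \<open>A deleted value of \<open>i\<close> may be the certificate of any pair on an arc into
  \<open>i\<close>, so all \<open>d\<close> pairs of each such arc are pushed, dead ones
  included.\<close>

definition Delete_push :: com where
  "Delete_push = ForOut ''x'' (Reg ''i'') (For ''y'' ''d'' (Push (Flip (Reg ''x'')) (Reg ''y'')))"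

definition Delete_loss :: com where
  "Delete_loss = ForOut ''x'' (Reg ''i'') (For ''y'' ''d''
      (Cond (Op Mul (Op Sub (Const 1) (Op Eq (Reg ''y'') (Reg ''v'')))
               (Good (Reg ''x'') (Reg ''y'') (Reg ''v''))) Loss skip))"

definition Delete_dec :: com where
  "Delete_dec = ForOut ''x'' (Reg ''i'')
      (Seq (Assign ''p'' (Flip (Reg ''x'')))
      (For ''y'' ''d'' (For ''z'' ''d''
        (Cond (Op Mul (Read ''R'' (I3 (Reg ''p'') (Reg ''y'') (Reg ''v'')))
                 (Op Sub (Const 1) (Read ''R'' (I3 (Reg ''p'') (Reg ''z'') (Reg ''v''))))) Dec skip))))"

text \<open>The order matters. \<open>Delete_loss\<close> evaluates \<open>Good\<close> on the
  tables of the old domains, in order to withdraw exactly what was counted; the \<open>alive\<close>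
  flag falls before \<open>Delete_dec\<close>, so that \<open>Critical\<close> cannot bring the
  deleted value back into \<open>S\<close>.\<close>

definition Delete :: com where
  "Delete =
    Seq Delete_push
    (Seq Delete_loss
    (Seq (Write ''alive'' (I2 (Reg ''i'') (Reg ''v'')) (Const 0))
    Delete_dec))"

text \<open>The register \<open>k\<close> accumulates a conjunction as a product. Starting it with
  the \<open>alive\<close> flag makes stale pairs on the worklist harmless.\<close>

definition Check :: com where
  "Check = Seq (Assign ''k'' (Read ''alive'' (I2 (Read ''src'' (Reg ''q'')) (Reg ''v''))))
    (For ''c'' ''d'' (Assign ''k'' (Op Mul (Reg ''k'') (Op Sub (Const 1)
      (Op Mul (Read ''alive'' (I2 (Read ''dst'' (Reg ''q'')) (Reg ''c'')))
        (Op Mul (Read ''R'' (I3 (Reg ''q'') (Reg ''v'') (Reg ''c'')))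
          (Op Eq (Read ''S'' (I3 (Reg ''q'') (Reg ''v'') (Reg ''c''))) (Const 0))))))))"

definition Pop :: com where
  "Pop = Seq (Assign ''sp'' (Op Sub (Reg ''sp'') (Const 1)))
    (Seq (Assign ''q'' (Read ''stq'' (Reg ''sp'')))
    (Seq (Assign ''v'' (Read ''stb'' (Reg ''sp'')))
    (Write ''fl'' (I2 (Reg ''q'') (Reg ''v'')) (Const 0))))"

definition Propagate :: com where
  "Propagate = While (Reg ''sp'') (Seq Pop (Seq Check (Cond (Reg ''k'')
     (Seq (Assign ''i'' (Read ''src'' (Reg ''q''))) Delete) skip)))"

lemmas com_defs = Push_def Gain_def Loss_def Spread_def Lower_def Dec_def Delete_push_def Delete_loss_def Delete_dec_def Delete_def Check_def Pop_def Propagate_def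

lemma wregs_simps [simp]:
  "wregs (Push f g) = {''_'', ''sp''}"
  "wregs Gain = {''c''}"
  "wregs Loss = {''c''}"
  "wregs Delete_push = {''_'', ''sp'', ''x'', ''y''}"
  "wregs Delete_loss = {''_'', ''c'', ''x'', ''y''}"
  "wregs Dec = {''_'', ''c'', ''g'', ''sp''}"
  "wregs Delete = {''_'', ''c'', ''g'', ''p'', ''sp'', ''x'', ''y'', ''z''}"
  "wregs Check = {''c'', ''k''}"
  by (auto simp: com_defs)

lemma alloc_free_simps [simp]: "alloc_free (Push f g)" "alloc_free Gain" "alloc_free Loss"
  "alloc_free Dec" "alloc_free Delete" "alloc_free Check" "alloc_free Propagate"
  by (auto simp: com_defs)

text \<open>Stored numbers are counters, variable and arc numbers, and stack heights up to
  \<open>2 * e * d\<close>. Array indices such as \<open>ix3\<close> occur only inside expressions,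
  where the word bound is not checked; hence this short list suffices.\<close>

locale prog = net +
  fixes w :: nat
  assumes w_bounds: "1 \<le> w" "n \<le> w" "d \<le> w" "2 * e \<le> w" "2 * e * d \<le> w"
begin

definition head :: "nat \<Rightarrow> nat" where "head i = prv src i (2 * e)"

lemma head_pos: "0 < head i \<longleftrightarrow> out i \<noteq> {}"
  by (auto simp: head_def prv_pos_iff out_def)

lemma src_head: "out i \<noteq> {} \<Longrightarrow> src (head i - 1) = i \<and> head i - 1 < 2 * e"
  unfolding head_def by (rule prv_cases[of src i "2*e"]) (auto simp: out_def)

lemma head_inj [simp]: "out i \<noteq> {} \<Longrightarrow> out j \<noteq> {} \<Longrightarrow> head i - 1 = head j - 1 \<longleftrightarrow> i = j"
  by (metis src_head)

section \<open>Representation of the abstract tables in a store\<close>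

definition static :: "store \<Rightarrow> bool" where
  "static s \<longleftrightarrow> reg s ''n'' = n \<and> reg s ''d'' = d \<and> reg s ''e'' = e \<and> reg s ''E'' = 2 * e \<and>
     length (arr s ''src'') = 2 * e \<and> (\<forall>q<2*e. arr s ''src'' ! q = src q) \<and>
     length (arr s ''dst'') = 2 * e \<and> (\<forall>q<2*e. arr s ''dst'' ! q = dst q) \<and>
     length (arr s ''R'') = 2 * e * d * d \<and>
     (\<forall>q<2*e. \<forall>b<d. \<forall>c<d. arr s ''R'' ! ix3 d q b c = of_bool (R q b c)) \<and>
     length (arr s ''hd'') = n \<and> (\<forall>i<n. arr s ''hd'' ! i = head i) \<and>
     length (arr s ''nx'') = 2 * e \<and> (\<forall>q<2*e. arr s ''nx'' ! q = prv src (src q) q)"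

text \<open>The flags determine \<open>F\<close>; the bijection says that the slots below
  \<open>sp\<close> list it without repetition, so that \<open>sp\<close> equals
  \<open>card F\<close>.\<close>

definition stack :: "store \<Rightarrow> (nat \<times> nat) set \<Rightarrow> bool" where
  "stack s F \<longleftrightarrow>
     length (arr s ''fl'') = 2 * e * d \<and>
     F = {(q, b). q < 2 * e \<and> b < d \<and> arr s ''fl'' ! ix2 d q b \<noteq> 0} \<and>
     length (arr s ''stq'') = 2 * e * d \<and> length (arr s ''stb'') = 2 * e * d \<and>
     bij_betw (\<lambda>k. (arr s ''stq'' ! k, arr s ''stb'' ! k)) {..<reg s ''sp''} F"

text \<open>Domains and tables are independent parameters, since in the middle of a deletion
  \<open>alive\<close>, \<open>W\<close>, \<open>N\<close> and \<open>S\<close> reflect different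
  stages.\<close>

definition rep ::
    "store \<Rightarrow> (nat \<Rightarrow> nat set) \<Rightarrow> table \<Rightarrow> table \<Rightarrow> table \<Rightarrow> (nat \<times> nat) set \<Rightarrow> bool" where
  "rep s A W N S F \<longleftrightarrow> static s \<and>
     length (arr s ''alive'') = n * d \<and>
     (\<forall>i<n. \<forall>p<d. arr s ''alive'' ! ix2 d i p = of_bool (p \<in> A i)) \<and>
     length (arr s ''W'') = 2 * e * d * d \<and>
     (\<forall>q<2*e. \<forall>b<d. \<forall>a<d. arr s ''W'' ! ix3 d q b a = W q b a) \<and>
     length (arr s ''N'') = 2 * e * d * d \<and>
     (\<forall>i<n. out i \<noteq> {} \<longrightarrow> (\<forall>b<d. \<forall>a<d. arr s ''N'' ! ix3 d (head i - 1) b a = N i b a)) \<and>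
     length (arr s ''S'') = 2 * e * d * d \<and>
     (\<forall>q<2*e. \<forall>b<d. \<forall>c<d. arr s ''S'' ! ix3 d q b c = S q b c) \<and>
     stack s F"

lemma static_set_reg [simp]: "x \<notin> {''n'', ''d'', ''e'', ''E''} \<Longrightarrow> static (set_reg x v s) = static s"
  by (auto simp: static_def)

lemma stack_set_arr [simp]:
  "x \<notin> {''fl'', ''stq'', ''stb''} \<Longrightarrow> stack (set_arr x l s) F = stack s F"
  by (auto simp: stack_def)

lemma stack_set_reg [simp]: "x \<noteq> ''sp'' \<Longrightarrow> stack (set_reg x v s) F = stack s F"
  unfolding stack_def by simp

lemma rep_set_reg [simp]:
  "x \<notin> {''n'', ''d'', ''e'', ''E'', ''sp''} \<Longrightarrow> rep (set_reg x v s) A W N S F = rep s A W N S F"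
  by (simp add: rep_def)

lemma static_set_arr [simp]:
  "x \<notin> {''src'', ''dst'', ''R'', ''hd'', ''nx''} \<Longrightarrow> static (set_arr x l s) = static s"
  by (auto simp: static_def)

lemma rep_D:
  assumes "rep s A W N S F"
  shows "reg s ''n'' = n" "reg s ''d'' = d" "reg s ''e'' = e" "reg s ''E'' = 2 * e"
    "length (arr s ''src'') = 2 * e" "length (arr s ''dst'') = 2 * e"
    "length (arr s ''R'') = 2 * e * d * d" "length (arr s ''hd'') = n" "length (arr s ''nx'') = 2 * e"
    "length (arr s ''alive'') = n * d" "length (arr s ''W'') = 2 * e * d * d"
    "length (arr s ''N'') = 2 * e * d * d" "length (arr s ''S'') = 2 * e * d * d"
    "length (arr s ''fl'') = 2 * e * d" "length (arr s ''stq'') = 2 * e * d"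
    "length (arr s ''stb'') = 2 * e * d"
    "\<And>q. q < 2 * e \<Longrightarrow> arr s ''src'' ! q = src q"
    "\<And>q. q < 2 * e \<Longrightarrow> arr s ''dst'' ! q = dst q"
    "\<And>q b c. q < 2 * e \<Longrightarrow> b < d \<Longrightarrow> c < d \<Longrightarrow> arr s ''R'' ! ix3 d q b c = of_bool (R q b c)"
    "\<And>i. i < n \<Longrightarrow> arr s ''hd'' ! i = head i"
    "\<And>q. q < 2 * e \<Longrightarrow> arr s ''nx'' ! q = prv src (src q) q"
    "\<And>i p. i < n \<Longrightarrow> p < d \<Longrightarrow> arr s ''alive'' ! ix2 d i p = of_bool (p \<in> A i)"
    "\<And>q b a. q < 2 * e \<Longrightarrow> b < d \<Longrightarrow> a < d \<Longrightarrow> arr s ''W'' ! ix3 d q b a = W q b a"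
    "\<And>i b a. i < n \<Longrightarrow> out i \<noteq> {} \<Longrightarrow> b < d \<Longrightarrow> a < d \<Longrightarrow> arr s ''N'' ! ix3 d (head i - Suc 0) b a = N i b a"
    "\<And>q b c. q < 2 * e \<Longrightarrow> b < d \<Longrightarrow> c < d \<Longrightarrow> arr s ''S'' ! ix3 d q b c = S q b c"
    "\<And>q b. q < 2 * e \<Longrightarrow> b < d \<Longrightarrow> arr s ''fl'' ! ix2 d q b = 0 \<longleftrightarrow> (q, b) \<notin> F"
    "F \<subseteq> {..<2*e} \<times> {..<d}" "card F = reg s ''sp''"
    "bij_betw (\<lambda>k. (arr s ''stq'' ! k, arr s ''stb'' ! k)) {..<reg s ''sp''} F"
  using assms unfolding rep_def static_def stack_def by (auto dest: bij_betw_same_card)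

lemma rep_finite: "rep s A W N S F \<Longrightarrow> finite F"
  by (rule finite_subset[OF rep_D(27)]) auto

lemma rep_sp: "rep s A W N S F \<Longrightarrow> reg s ''sp'' \<le> 2 * e * d"
  using card_mono[OF _ rep_D(27)] rep_D(28) by (metis card_cartesian_product card_lessThan finite_cartesian_product finite_lessThan)

text \<open>Tables are total functions, but the store fixes only their entries in range; tables that
  agree there are interchangeable.\<close>

lemma rep_cong:
  assumes "rep s A W N S F"
    and "\<And>q b a. q < 2 * e \<Longrightarrow> b < d \<Longrightarrow> a < d \<Longrightarrow> W q b a = W' q b a"
    and "\<And>i b a. i < n \<Longrightarrow> b < d \<Longrightarrow> a < d \<Longrightarrow> N i b a = N' i b a"
    and "\<And>q b a. q < 2 * e \<Longrightarrow> b < d \<Longrightarrow> a < d \<Longrightarrow> S q b a = S' q b a"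
  shows "rep s A W' N' S' F"
  using assms unfolding rep_def by simp

lemma rep_write_W:
  assumes "rep s A W N S F" "q < 2 * e" "b < d" "a < d"
    and "\<And>q' b' a'. W' q' b' a' = (if q' = q \<and> b' = b \<and> a' = a then v else W q' b' a')"
  shows "rep (set_arr ''W'' ((arr s ''W'')[ix3 d q b a := v]) s) A W' N S F"
  using assms by (simp add: rep_def nth_list_update)

lemma rep_write_S:
  assumes "rep s A W N S F" "q < 2 * e" "b < d" "a < d"
    and "\<And>q' b' a'. S' q' b' a' = (if q' = q \<and> b' = b \<and> a' = a then v else S q' b' a')"
  shows "rep (set_arr ''S'' ((arr s ''S'')[ix3 d q b a := v]) s) A W N S' F"
  using assms by (simp add: rep_def nth_list_update)

text \<open>Blocks of different variables do not collide: \<open>head i - 1\<close> is an arc out of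
  \<open>i\<close> and therefore determines \<open>i\<close>.\<close>

lemma rep_write_N:
  assumes "rep s A W N S F" "i < n" "out i \<noteq> {}" "b < d" "a < d"
    and "\<And>i' b' a'. N' i' b' a' = (if i' = i \<and> b' = b \<and> a' = a then v else N i' b' a')"
  shows "rep (set_arr ''N'' ((arr s ''N'')[ix3 d (head i - Suc 0) b a := v]) s) A W N' S F"
  using assms src_head[OF assms(3)] head_inj[unfolded One_nat_def]
  by (simp add: rep_def nth_list_update)

lemma rep_write_alive:
  assumes "rep s A W N S F" "i < n" "p < d"
  shows "rep (set_arr ''alive'' ((arr s ''alive'')[ix2 d i p := 0]) s) (A(i := A i - {p})) W N S F"
  using assms by (simp add: rep_def nth_list_update)

lemma ev_Flip [simp]:
  "rep s A W N S F \<Longrightarrow> ev s f = q \<Longrightarrow> q < 2 * e \<Longrightarrow> ev s (Flip f) = flip q"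
  by (simp add: rep_D rep_D Flip_def flip_def)

lemma Flip_simps [simp]: "safe s (Flip f) = safe s f" "cost (Flip f) = 9 + 2 * cost f"
  by (auto simp: Flip_def)

text \<open>The expressions \<open>f\<close> and \<open>g\<close> are evaluated again after array
  writes, hence the demand that their values depend on registers only.\<close>

lemma run_Push:
  assumes r: "rep s A W N S F" and q: "q < 2 * e" and b: "b < d"
    and f: "\<And>s'. reg s' = reg s \<Longrightarrow> safe s' f \<and> ev s' f = q"
    and g: "\<And>s'. reg s' = reg s \<Longrightarrow> safe s' g \<and> ev s' g = b"
  shows "run w (Push f g) s (\<lambda>t s'. t \<le> 18 + 3 * (cost f + cost g) \<and> rep s' A W N S (insert (q, b) F))"
proof (cases "(q, b) \<in> F")
  case True
  then show ?thesis using assms w_bounds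
    by (simp add: Push_def skip_def rep_D[OF r] insert_absorb)
next
  case False
  \<comment> \<open>A pair outside \<open>F\<close> leaves \<open>F\<close> short of all
    \<open>2 * e * d\<close> pairs, so the stack has a free slot.\<close>
  have "insert (q, b) F \<subseteq> {..<2*e} \<times> {..<d}" using q b rep_D(27)[OF r] by auto
  from card_mono[OF _ this] have sp: "reg s ''sp'' < 2 * e * d"
    using False rep_finite[OF r] rep_D(28)[OF r] by (simp add: card_cartesian_product)
  define s' where "s' = set_reg ''sp'' (Suc (reg s ''sp'')) (set_arr ''stb'' ((arr s ''stb'')[reg s ''sp'' := b])
     (set_arr ''stq'' ((arr s ''stq'')[reg s ''sp'' := q]) (set_arr ''fl'' ((arr s ''fl'')[ix2 d q b := 1]) s)))"
  have "rep s' A W N S (insert (q, b) F)"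
  proof -
    let ?f = "\<lambda>s k. (arr s ''stq'' ! k, arr s ''stb'' ! k)"
    have 1: "bij_betw (?f s') {..<reg s ''sp''} F"
      using rep_D(29)[OF r] by (rule iffD1[OF bij_betw_cong, rotated]) (simp add: s'_def)
    have 2: "?f s' (reg s ''sp'') = (q, b)"
      using sp by (simp add: s'_def rep_D[OF r])
    have "bij_betw (?f s') (insert (reg s ''sp'') {..<reg s ''sp''}) (insert (q, b) F)"
      using notIn_Un_bij_betw[of "reg s ''sp''" "{..<reg s ''sp''}" "?f s'" F] 1 2 False by simp
    moreover have "insert (reg s ''sp'') {..<reg s ''sp''} = {..<reg s' ''sp''}"
      by (auto simp: s'_def)
    moreover have "F = {(q, b). q < 2 * e \<and> b < d \<and> arr s ''fl'' ! ix2 d q b \<noteq> 0}"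
      using r by (simp add: rep_def stack_def)
    then have "insert (q, b) F = {(q, b). q < 2 * e \<and> b < d \<and> arr s' ''fl'' ! ix2 d q b \<noteq> 0}"
      using q b by (auto simp: s'_def nth_list_update rep_D[OF r])
    ultimately show ?thesis using r by (simp add: rep_def s'_def stack_def)
  qed
  then show ?thesis
    using assms w_bounds False sp src_less[OF q] by (simp add: Push_def s'_def rep_D[OF r])
qed

text \<open>The strict bound on the old counters leaves room for the increment within the word
  bound.\<close>

lemma run_Gain:
  assumes r: "rep s A W N S F" and q: "reg s ''g'' = q" "q < 2 * e" and b: "reg s ''y'' = b" "b < d"
    and a: "reg s ''z'' = a" "a < d" and le: "\<And>c. S q b c < d"
  shows "run w Gain s (\<lambda>t s'. t \<le> 6 + 39 * d \<and>
     rep s' A W N (\<lambda>q' b' c. S q' b' c + of_bool (q' = q \<and> b' = b \<and> R q a c)) F)"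
  unfolding Gain_def
proof (rule run_For[where J = "\<lambda>k t s. t \<le> 31 * k \<and>
     rep s A W N (\<lambda>q' b' c. S q' b' c + of_bool (q' = q \<and> b' = b \<and> c < k \<and> R q a c)) F"], goal_cases)
  case (6 k t s1)
  then have r1: "rep s1 A W N (\<lambda>q' b' c. S q' b' c + of_bool (q' = q \<and> b' = b \<and> c < k \<and> R q a c)) F"
    and k: "k < d" by (auto simp: rep_D[OF r])
  have "S q b k + of_bool (R q a k) \<le> w"
    using le[of k] w_bounds by (auto simp: of_bool_def)
  moreover have "rep (set_arr ''S'' ((arr s1 ''S'')[ix3 d q b k := S q b k + of_bool (R q a k)]) s1) A W N
       (\<lambda>q' b' c. S q' b' c + of_bool (q' = q \<and> b' = b \<and> c < Suc k \<and> R q a c)) F"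
    by (rule rep_write_S[OF r1]) (use q b k in \<open>auto simp: less_Suc_eq\<close>)
  ultimately show ?case
    using 6 q a b k by (simp add: rep_D[OF r1])
next
  case (7 t s')
  then show ?case by (auto simp: rep_D[OF r] elim!: rep_cong)
qed (use assms w_bounds in \<open>auto simp: rep_D[OF r]\<close>)

lemma run_Loss:
  assumes r: "rep s A W N S F" and q: "reg s ''x'' = q" "q < 2 * e" and b: "reg s ''y'' = b" "b < d"
    and a: "reg s ''v'' = a" "a < d" and le: "\<And>c. S q b c \<le> d"
  shows "run w Loss s (\<lambda>t s'. t \<le> 6 + 39 * d \<and>
     rep s' A W N (\<lambda>q' b' c. S q' b' c - of_bool (q' = q \<and> b' = b \<and> R q a c)) F)"
  unfolding Loss_def
proof (rule run_For[where J = "\<lambda>k t s. t \<le> 31 * k \<and>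
     rep s A W N (\<lambda>q' b' c. S q' b' c - of_bool (q' = q \<and> b' = b \<and> c < k \<and> R q a c)) F"], goal_cases)
  case (6 k t s1)
  then have r1: "rep s1 A W N (\<lambda>q' b' c. S q' b' c - of_bool (q' = q \<and> b' = b \<and> c < k \<and> R q a c)) F"
    and k: "k < d" by (auto simp: rep_D[OF r])
  have "S q b k - of_bool (R q a k) \<le> w"
    using le[of k] w_bounds by (auto simp: of_bool_def)
  moreover have "rep (set_arr ''S'' ((arr s1 ''S'')[ix3 d q b k := S q b k - of_bool (R q a k)]) s1) A W N
       (\<lambda>q' b' c. S q' b' c - of_bool (q' = q \<and> b' = b \<and> c < Suc k \<and> R q a c)) F"
    by (rule rep_write_S[OF r1]) (use q b k in \<open>auto simp: less_Suc_eq\<close>)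
  ultimately show ?case
    using 6 q a b k by (simp add: rep_D[OF r1])
next
  case (7 t s')
  then show ?case by (auto simp: rep_D[OF r] elim!: rep_cong)
qed (use assms w_bounds in \<open>auto simp: rep_D[OF r]\<close>)

end

lemma run_Write_Seq:
  assumes "safe s f" "safe s g" "ev s f = k" "ev s g = v" "k < length (arr s a)" "v \<le> w"
    and "run w c (set_arr a ((arr s a)[k := v]) s) (\<lambda>t. Q (1 + cost f + cost g + t))"
  shows "run w (Seq (Write a f g) c) s Q"
  using assms by simp

lemma run_Assign_Seq:
  assumes "safe s f" "ev s f = v" "v \<le> w"
    and "run w c (set_reg x v s) (\<lambda>t. Q (1 + cost f + t))"
  shows "run w (Seq (Assign x f) c) s Q"
  using assms by simp

lemma run_Seq_mono:
  assumes "run w c1 s P" "\<And>t1 s1. P t1 s1 \<Longrightarrow> agree (wregs c1) s s1 \<Longrightarrow>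
     run w c2 s1 (\<lambda>t2. Q (t1 + t2))"
  shows "run w (Seq c1 c2) s Q"
  unfolding run_Seq by (rule run_mono[OF run_frame[OF assms(1)]]) (use assms(2) in blast)

lemma run_CondI:
  assumes "safe s f" "ev s f \<noteq> 0 \<Longrightarrow> run w c1 s (\<lambda>t. Q (1 + cost f + t))"
    "ev s f = 0 \<Longrightarrow> run w c2 s (\<lambda>t. Q (1 + cost f + t))"
  shows "run w (Cond f c1 c2) s Q"
  using assms by simp

lemma run_skip [simp]: "run w skip s Q \<longleftrightarrow> Q 2 (set_reg ''_'' 0 s)"
  by (simp add: skip_def numeral_2_eq_2)

section \<open>Amortised cost of one decrement\<close>

context net begin

text \<open>A value is not counted as its own replacement, which gives the strictness that
  \<open>run_Gain\<close> asks for.\<close>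

lemma Sf_less:
  assumes "doms A" "b < d"
  shows "Sf A W q b c < d"
proof -
  have "Sf A W q b c \<le> card ({..<d} - {b})"
    unfolding Sf_def using assms by (intro card_mono) (auto simp: doms_def)
  with assms show ?thesis by simp
qed

text \<open>A pair on the worklist pays \<open>100 * d\<close> for its check. Lowering \<open>min 2 (Nf W i b a)\<close> releases
  \<open>220 * d\<close> for each arc out of \<open>i\<close>, which pays for \<open>Spread\<close> and the pairs that it pushes.\<close>

definition pot :: "(nat \<times> nat) set \<Rightarrow> table \<Rightarrow> nat" where
  "pot F W = 100 * (d * card F) + 220 * (d * phi W)"

end

context prog begin

lemma ev_Good:
  assumes "rep s A W (Nf W) S F" "q < 2 * e" "b < d" "a < d" "ev s f = q" "ev s g = b" "ev s h = a"
  shows "ev s (Good f g h) = of_bool (good W q b a)"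
proof -
  have "out (src q) \<noteq> {}" using assms(2) by (auto simp: out_def)
  then show ?thesis
    using assms src_less[OF assms(2)] good_iff[OF assms(2), of W b a]
    by (auto simp: Good_def Nix_def rep_D[OF assms(1)])
qed

lemma safe_Good:
  assumes "rep s A W N S F" "q < 2 * e" "b < d" "a < d" "ev s f = q" "ev s g = b" "ev s h = a"
    "safe s f" "safe s g" "safe s h"
  shows "safe s (Good f g h)"
proof -
  have "out (src q) \<noteq> {}" using assms(2) by (auto simp: out_def)
  then show ?thesis
    using assms src_less[OF assms(2)] src_head[of "src q"]
    by (simp add: Good_def Nix_def rep_D[OF assms(1)])
qed

lemma cost_Nix [simp]: "cost (Nix f g h) = 10 + cost f + cost g + cost h"
  by (simp add: Nix_def)

lemma cost_Good [simp]: "cost (Good f g h) = 23 + 2 * (cost f + cost g + cost h)"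
  by (simp add: Good_def)

text \<open>The 200 covers the fixed costs. Everything that \<open>Spread\<close> does, including
  the prepaid checks of the pairs it pushes, comes out of the decrease of
  \<open>phi\<close>.\<close>

lemma run_Dec:
  assumes A: "doms A" and r: "rep s A W (Nf W) (Sf A W) F" and pd: "pend F A (Sf A W)"
    and p: "reg s ''p'' = p" "p < 2 * e" and b: "reg s ''y'' = b" "b < d" and a: "reg s ''z'' = a" "a < d"
    and W: "0 < W p b a" "W p b a \<le> d"
  shows "run w Dec s (\<lambda>t s'. \<exists>F'. rep s' A (dec W p b a) (Nf (dec W p b a)) (Sf A (dec W p b a)) F' \<and>
     pend F' A (Sf A (dec W p b a)) \<and> t + pot F' (dec W p b a) \<le> 200 + pot F W)"
proof -
  define W' where "W' = dec W p b a"
  note bounds = w_bounds src_less[OF p(2)] p b a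
  have out: "out (src p) \<noteq> {}" "p \<in> out (src p)" using p by (auto simp: out_def)
  define s1 where "s1 = set_arr ''W'' ((arr s ''W'')[ix3 d p b a := W p b a - 1]) s"
  have r1: "rep s1 A W' (Nf W) (Sf A W) F"
    unfolding s1_def by (rule rep_write_W[OF r]) (use p b a in \<open>auto simp: W'_def dec_def\<close>)
  have reg1: "reg s1 ''p'' = p" "reg s1 ''y'' = b" "reg s1 ''z'' = a"
    using p b a by (simp_all add: s1_def)
  have phi: "phi W' + of_bool (W p b a = 1 \<and> Nf W' (src p) b a < 2) * card (out (src p)) \<le> phi W"
    unfolding W'_def by (rule phi_dec) (use p b a W in auto)
  have N: "Nf W i b' a' = Nf W' i b' a' + of_bool (i = src p \<and> b' = b \<and> a' = a \<and> W p b a = 1)" for i b' a'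
    unfolding W'_def by (rule Nf_dec) (use p W in auto)
  have S: "Sf A W' q b' c = Sf A W q b' c +
     of_bool (src q = src p \<and> q \<noteq> p \<and> b' = b \<and> W p b a = 1 \<and> a \<in> A (src p) \<and> a \<noteq> b \<and> R q a c \<and>
        good W' q b a)" for q b' c
    unfolding W'_def by (rule Sf_dec) (use A p W in auto)
  have W'p: "W' p b a = W p b a - 1" by (simp add: W'_def dec_def)
  \<comment> \<open>Stated for arbitrary \<open>F'\<close> and with both worklist sizes added
    across, so that it can be instantiated after an unknown number of pushes.\<close>
  have pot: "pot F' W' + 100 * d * card F + 220 * d * (of_bool (W p b a = 1 \<and> Nf W' (src p) b a < 2) * card (out (src p)))
     \<le> 100 * d * card F' + pot F W" for F'
    using mult_le_mono2[OF phi, of "220 * d"] by (simp add: pot_def algebra_simps)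
  let ?post = "\<lambda>t s'. \<exists>F'. rep s' A W' (Nf W') (Sf A W') F' \<and> pend F' A (Sf A W') \<and> t + pot F' W' \<le> 200 + pot F W"
  have "run w Dec s ?post"
    unfolding Dec_def
  proof (rule run_Write_Seq[where k = "ix3 d p b a" and v = "W p b a - 1"], goal_cases)
    case 7
    have "run w (Cond (Read ''W'' (I3 (Reg ''p'') (Reg ''y'') (Reg ''z''))) skip
    Lower) s1 (\<lambda>t. ?post (30 + t))"
    proof (rule run_CondI, goal_cases)
      case 1
      then show ?case using bounds by (simp add: rep_D[OF r1] reg1)
    next
      case 2
      then have "W p b a \<noteq> 1" using bounds W'p by (auto simp: rep_D[OF r1] reg1)
      then have "Nf W' = Nf W" "Sf A W' = Sf A W" using N S by (auto intro!: ext)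
      then show ?case using r1 pd pot[of F] by auto
    next
      case 3
      then have W1: "W p b a = 1" using bounds W'p W by (auto simp: rep_D[OF r1] reg1)
      define s2 where "s2 = set_arr ''N'' ((arr s1 ''N'')[ix3 d (head (src p) - Suc 0) b a := Nf W (src p) b a - 1]) s1"
      have r2: "rep s2 A W' (Nf W') (Sf A W) F"
        unfolding s2_def by (rule rep_write_N[OF r1]) (use bounds out N W1 in auto)
      have reg2: "reg s2 ''p'' = p" "reg s2 ''y'' = b" "reg s2 ''z'' = a"
        using p b a by (simp_all add: s1_def s2_def)
      have cond: "run w (Cond Critical Spread skip) s2 (\<lambda>t. ?post (75 + t))"
      proof (rule run_CondI, goal_cases)
        case 1
        show ?case using bounds src_head[OF out(1)] by (simp add: rep_D[OF r2] reg2 Nix_def Critical_def)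
      next
        case 3
        \<comment> \<open>Without \<open>Spread\<close> the counters are already right: either
          \<open>a\<close> is dead or equal to \<open>b\<close>, or at least two arcs keep positive
          entries and no arc out of \<open>src p\<close> is good.\<close>
        have "of_bool (good W' q b a \<and> q \<in> out (src p)) * (of_bool (a \<in> A (src p) \<and> a \<noteq> b)) = (0::nat)"
          if "q \<noteq> p" for q
        proof -
          have "Nf W' (src p) b a \<le> 1" if "good W' q b a" "q \<in> out (src p)"
            using that good_iff[of q W' b a] by (auto simp: out_def of_bool_def split: if_splits)
          then show ?thesis using 3 bounds out by (auto simp: rep_D[OF r2] reg2 Nix_def Critical_def)
        qed
        then have "Sf A W' q b' c = Sf A W q b' c" if "q < 2 * e" for q b' c
          unfolding S using that by (auto simp: out_def)
        then have "rep s2 A W' (Nf W') (Sf A W') F" "pend F A (Sf A W')"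
          using pd by (auto intro: rep_cong[OF r2] simp: pend_def)
        then show ?case using pot[of F] by (auto simp: Critical_def intro!: exI[of _ F])
      next
        case 2
        have c: "Nf W' (src p) b a < 2" "a \<in> A (src p)" "a \<noteq> b"
          using 2 bounds out by (auto simp: rep_D[OF r2] reg2 Nix_def Critical_def)
        \<comment> \<open>In \<open>T D\<close> only the arcs in \<open>D\<close> have moved from
          the old to the new counters.\<close>
        define T where "T = (\<lambda>D q b' c. if q \<in> D then Sf A W' q b' c else Sf A W q b' c)"
        \<comment> \<open>Per arc: 36 for the test, 24 for \<open>Push\<close>,
          \<open>6 + 39 * d\<close> for \<open>Gain\<close> and \<open>100 * d\<close> for a new
          pair, together at most \<open>205 * d\<close>. The list traversal adds 9, covered by
          \<open>15 * d\<close>; this is the origin of the 220 in \<open>pot\<close>.\<close>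
        let ?J = "\<lambda>D t s'. \<exists>F'. rep s' A W' (Nf W') (T D) F' \<and> pend F' A (T D) \<and>
          t + 100 * d * card F' \<le> 100 * d * card F + card D * (205 * d)"
        have "run w Spread s2 (\<lambda>t. ?post (106 + t))"
        unfolding Spread_def
        proof (rule run_ForOut[where J = ?J and m = "2*e" and src = src, folded out_def], goal_cases)
          case (9 D q t s3)
          then obtain F3 where r3: "rep s3 A W' (Nf W') (T D) F3" and pd3: "pend F3 A (T D)"
            and t3: "t + 100 * d * card F3 \<le> 100 * d * card F + card D * (205 * d)" by blast
          have ev: "ev s2 (Read ''src'' (Reg ''p'')) = src p" using bounds by (simp add: rep_D[OF r2] reg2)
          have q: "q < 2 * e" "src q = src p" "q \<notin> D" "reg s3 ''g'' = q" using 9 ev by auto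
          have regs: "reg s3 ''p'' = p" "reg s3 ''y'' = b" "reg s3 ''z'' = a" using 9 bounds reg2 by auto
          have D: "card (insert q D) = Suc (card D)" "D \<subseteq> out (src p)"
            using 9 ev by (auto intro: finite_subset[OF _ finite_out] card_insert_disjoint)
          have T: "T (insert q D) q' b' c = T D q' b' c +
            of_bool (q' = q \<and> b' = b \<and> R q a c \<and> q \<noteq> p \<and> good W' q b a)" for q' b' c
            using q c W1 by (auto simp: T_def S)
          show ?case
          proof (rule run_CondI, goal_cases)
            case 1
            show ?case using bounds q regs by (simp add: safe_Good[OF r3])
          next
            case 3
            then have "\<not> (q \<noteq> p \<and> good W' q b a)"
              using bounds q regs by (auto simp: ev_Good[OF r3])
            then have "T (insert q D) = T D" using T by (auto intro!: ext)
            then show ?case using r3 pd3 t3 D bounds by (auto intro!: exI[of _ F3])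
          next
            case 2
            then have g: "q \<noteq> p" "good W' q b a"
              using bounds q regs by (auto simp: ev_Good[OF r3])
            show ?case
            proof (rule run_Seq_mono)
              show "run w (Push (Reg ''g'') (Reg ''y'')) s3
                (\<lambda>t s'. t \<le> 18 + 3 * (cost (Reg ''g'') + cost (Reg ''y'')) \<and> rep s' A W' (Nf W') (T D) (insert (q, b) F3))"
                by (rule run_Push) (use r3 bounds q regs in auto)
            next
              fix t4 s4
              assume *: "t4 \<le> 18 + 3 * (cost (Reg ''g'') + cost (Reg ''y'')) \<and> rep s4 A W' (Nf W') (T D) (insert (q, b) F3)"
                "agree (wregs (Push (Reg ''g'') (Reg ''y''))) s3 s4"
              have "run w Gain s4 (\<lambda>t s'. t \<le> 6 + 39 * d \<and>
                 rep s' A W' (Nf W') (\<lambda>q' b' c. T D q' b' c + of_bool (q' = q \<and> b' = b \<and> R q a c)) (insert (q, b) F3))"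
              proof (rule run_Gain)
                show "T D q b c < d" for c
                  unfolding T_def using A b by (auto intro: Sf_less)
              qed (use * bounds q regs in auto)
              then show "run w Gain s4 (\<lambda>t2. ?J (insert q D) (t + (1 + cost (Op Mul (Op Sub (Const 1) (Op Eq (Reg ''g'') (Reg ''p'')))
                (Good (Reg ''g'') (Reg ''y'') (Reg ''z''))) + (t4 + t2))))"
              proof (rule run_mono)
                fix t5 s5
                assume 5: "t5 \<le> 6 + 39 * d \<and>
                 rep s5 A W' (Nf W') (\<lambda>q' b' c. T D q' b' c + of_bool (q' = q \<and> b' = b \<and> R q a c)) (insert (q, b) F3)"
                have eq: "T (insert q D) = (\<lambda>q' b' c. T D q' b' c + of_bool (q' = q \<and> b' = b \<and> R q a c))"
                  using T g by (auto intro!: ext)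
                \<comment> \<open>Only counters of the pair just pushed have grown, so all other
                  certificates survive.\<close>
                have "pend (insert (q, b) F3) A (T (insert q D))"
                  using pd3 unfolding pend_def eq by fastforce
                moreover have "card (insert (q, b) F3) \<le> Suc (card F3)"
                  by (simp add: card_insert_if rep_finite[OF r3])
                then have "100 * d * card (insert (q, b) F3) \<le> 100 * d * card F3 + 100 * d"
                  using mult_le_mono2[of "card (insert (q, b) F3)" "Suc (card F3)" "100 * d"] by simp
                ultimately show "?J (insert q D) (t + (1 + cost (Op Mul (Op Sub (Const 1) (Op Eq (Reg ''g'') (Reg ''p'')))
                (Good (Reg ''g'') (Reg ''y'') (Reg ''z''))) + (t4 + t5))) s5"
                  using 5 * t3 D bounds unfolding eq
                  by (intro exI[of _ "insert (q, b) F3"]) auto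
              qed
            qed
          qed
        next
          case (10 t s3)
          have ev: "ev s2 (Read ''src'' (Reg ''p'')) = src p" using bounds by (simp add: rep_D[OF r2] reg2)
          from 10 obtain F3 where r3: "rep s3 A W' (Nf W') (T (out (src p))) F3" and pd3: "pend F3 A (T (out (src p)))"
            and t3: "t + 100 * d * card F3 \<le> 100 * d * card F + card (out (src p)) * (205 * d)" unfolding ev by blast
          have eq: "T (out (src p)) q b' c = Sf A W' q b' c" if "q < 2 * e" for q b' c
            using that by (auto simp: T_def S out_def)
          have "rep s3 A W' (Nf W') (Sf A W') F3" using eq by (auto intro: rep_cong[OF r3])
          have "pend F3 A (Sf A W')" using pd3 eq by (auto simp: pend_def)
          moreover have "9 * card (out (src p)) \<le> 15 * (d * card (out (src p)))" using bounds by simp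
          moreover have "t + pot F3 W' + 15 * (d * card (out (src p))) \<le> pot F W"
            using t3 pot[of F3] W1 c by (simp add: algebra_simps)
          ultimately have "t + pot F3 W' + 9 * card (out (src p)) \<le> pot F W" by linarith
          then show ?case unfolding ev using \<open>rep s3 A W' (Nf W') (Sf A W') F3\<close> \<open>pend F3 A (Sf A W')\<close>
            by (auto intro!: exI[of _ F3])
        next
          case 8
          show ?case using r2 pd by (auto simp: T_def intro!: exI[of _ F])
        qed (use bounds in \<open>auto simp: rep_D[OF r2] reg2 rep_D(9,21) head_def\<close>)
        then show ?case by (rule run_mono) (auto simp: Critical_def)
      qed
      show ?case
        unfolding Lower_def
      proof (rule run_Write_Seq[where k = "ix3 d (head (src p) - Suc 0) b a" and v = "Nf W (src p) b a - 1"], goal_cases)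
        case 7
        show ?case unfolding s2_def[symmetric] using cond by (rule run_mono) auto
      qed (use bounds out src_head[OF out(1)] Nf_le[of W "src p" b a] card_out_le[of "src p"] in \<open>auto simp: rep_D[OF r1] reg1 Nix_def\<close>)
    qed
    then show ?case unfolding s1_def[symmetric] by (rule run_mono) auto
  qed (use bounds W in \<open>auto simp: rep_D[OF r]\<close>)
  then show ?thesis unfolding W'_def .
qed

end

section \<open>Deleting a value\<close>

context net begin

lemma pend_mono: "pend F A S \<Longrightarrow> F \<subseteq> F' \<Longrightarrow> pend F' A S"
  unfolding pend_def by blast

text \<open>Loop invariants describe partly updated tables by progress predicates that agree only on
  entries in range. This and the next two congruences carry \<open>N\<close>, \<open>S\<close> and
  \<open>phi\<close> from one description to the next.\<close>

lemma Nf_cong: "(\<And>q. q < 2 * e \<Longrightarrow> W q b a = W' q b a) \<Longrightarrow> Nf W i b a = Nf W' i b a"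
  unfolding Nf_def out_def by (metis (mono_tags, lifting) mem_Collect_eq)

lemma Sf_cong:
  assumes "doms A" "\<And>q a. q < 2 * e \<Longrightarrow> a < d \<Longrightarrow> W q b a = W' q b a"
  shows "Sf A W q b c = Sf A W' q b c"
proof -
  have "good W q b a = good W' q b a" if "a \<in> A (src q)" for a
    using assms that unfolding good_def doms_def out_def by (auto simp: subset_eq)
  then show ?thesis unfolding Sf_def by (intro arg_cong[where f = card]) auto
qed

lemma phi_cong:
  assumes "\<And>q b a. q < 2 * e \<Longrightarrow> b < d \<Longrightarrow> a < d \<Longrightarrow> W q b a = W' q b a"
  shows "phi W = phi W'"
  unfolding phi_def using assms by (intro sum.cong refl) (auto intro!: arg_cong[where f = "min 2"] Nf_cong)

end

context prog begin

text \<open>Each arc brings at most \<open>d\<close> new pairs, each with a prepaid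
  \<open>100 * d\<close> and at most 54 for the push itself; together with the loop overheads this
  stays below \<open>180 * (d * d)\<close>.\<close>

lemma run_Delete_push:
  assumes r: "rep s A W N S F" and i: "reg s ''i'' = i" "i < n" and d: "0 < d"
  shows "run w Delete_push s
    (\<lambda>t s'. \<exists>F'. rep s' A W N S F' \<and> F \<subseteq> F' \<and> (\<forall>x\<in>out i. \<forall>y<d. (flip x, y) \<in> F') \<and>
      t + 100 * (d * card F') \<le> 5 + 100 * (d * card F) + card (out i) * (180 * (d * d)))"
proof -
  have dd: "d \<le> d * d" "1 \<le> d" using d by auto
  show ?thesis
  unfolding Delete_push_def
  proof (rule run_ForOut[where m = "2*e" and src = src and J = "\<lambda>D t s'. \<exists>F'. rep s' A W N S F' \<and> F \<subseteq> F' \<and>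
      (\<forall>x\<in>D. \<forall>y<d. (flip x, y) \<in> F') \<and> t + 100 * (d * card F') \<le> 100 * (d * card F) + card D * (170 * (d * d))",
      folded out_def], goal_cases)
    case (9 D q t s1)
    then obtain F1 where r1: "rep s1 A W N S F1" and F1: "F \<subseteq> F1" "\<forall>x\<in>D. \<forall>y<d. (flip x, y) \<in> F1"
      and t1: "t + 100 * (d * card F1) \<le> 100 * (d * card F) + card D * (170 * (d * d))" by blast
    have D: "card (insert q D) = Suc (card D)"
      using 9 i by (auto intro: finite_subset[OF _ finite_out] card_insert_disjoint)
    show ?case
    proof (rule run_For[where J = "\<lambda>k t s'. \<exists>F'. rep s' A W N S F' \<and> F1 \<subseteq> F' \<and>
        (\<forall>y<k. (flip q, y) \<in> F') \<and> t + 100 * (d * card F') \<le> 100 * (d * card F1) + k * (54 + 100 * d)"], goal_cases)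
      case (6 k t s2)
      then obtain F2 where r2: "rep s2 A W N S F2" and F2: "F1 \<subseteq> F2" "\<forall>y<k. (flip q, y) \<in> F2"
        and t2: "t + 100 * (d * card F2) \<le> 100 * (d * card F1) + k * (54 + 100 * d)" by blast
      have regs: "reg s2 ''x'' = q" "reg s2 ''y'' = k" "k < d" using 6 9 by (auto simp: rep_D[OF r1])
      have card: "d * card (insert (flip q, k) F2) \<le> d * card F2 + d"
        using mult_le_mono2[of "card (insert (flip q, k) F2)" "Suc (card F2)" d]
        by (simp add: card_insert_if rep_finite[OF r2])
      have ev: "ev s' (Flip (Reg ''x'')) = flip q" if "reg s' = reg s2" for s'
        using that regs 9(1) by (simp add: Flip_def flip_def rep_D(3,4)[OF r2])
      have "run w (Push (Flip (Reg ''x'')) (Reg ''y'')) s2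
         (\<lambda>t s'. t \<le> 18 + 3 * (cost (Flip (Reg ''x'')) + cost (Reg ''y'')) \<and> rep s' A W N S (insert (flip q, k) F2))"
        by (rule run_Push) (use r2 regs 9 ev flip_less in auto)
      then show ?case
      proof (rule run_mono, goal_cases)
        case (1 t3 s3)
        then show ?case using F2 t2 card
          by (intro exI[of _ "insert (flip q, k) F2"]) (auto simp: less_Suc_eq)
      qed
    next
      case (7 t2 s2)
      then obtain F2 where r2: "rep s2 A W N S F2" and F2: "F1 \<subseteq> F2" "\<forall>y<d. (flip q, y) \<in> F2"
        and t2: "t2 + 100 * (d * card F2) \<le> 100 * (d * card F1) + d * (54 + 100 * d)" by (auto simp: rep_D[OF r1])
      have t2': "t2 + 100 * (d * card F2) \<le> 100 * (d * card F1) + 54 * d + 100 * (d * d)"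
        using t2 by (simp add: algebra_simps)
      have "t + t2 + 6 + 8 * d + 100 * (d * card F2) \<le> 100 * (d * card F) + card D * (170 * (d * d)) + 170 * (d * d)"
        using t1 t2' dd by linarith
      then show ?case using F1 F2 D r2 dd
        by (intro exI[of _ F2]) (auto simp: rep_D[OF r1])
    qed (use r1 w_bounds in \<open>auto simp: rep_D[OF r1]\<close>)
  next
    case (10 t s1)
    then obtain F1 where r1: "rep s1 A W N S F1" and F1: "F \<subseteq> F1" "\<forall>x\<in>out i. \<forall>y<d. (flip x, y) \<in> F1"
      and t1: "t + 100 * (d * card F1) \<le> 100 * (d * card F) + card (out i) * (170 * (d * d))" using i by auto
    have "card (out i) * 9 \<le> card (out i) * (10 * (d * d))" using dd by (intro mult_le_mono2) linarith
    have "t + 5 + 9 * card (out i) + 100 * (d * card F1) \<le> 5 + 100 * (d * card F) + card (out i) * (180 * (d * d))"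
    proof -
      have "card (out i) * (180 * (d * d)) = card (out i) * (170 * (d * d)) + card (out i) * (10 * (d * d))"
        by (simp add: algebra_simps)
      then show ?thesis using t1 \<open>card (out i) * 9 \<le> _\<close> by linarith
    qed
    then show ?case using r1 F1 i by (intro exI[of _ F1]) auto
  qed (use r i w_bounds in \<open>auto simp: rep_D[OF r] rep_D(9,21) head_def\<close>)
qed

text \<open>Here \<open>S\<close> passes to the smaller domains while \<open>alive\<close> and
  \<open>W\<close> still belong to the old ones; the mixed term for \<open>S\<close> records this
  intermediate stage.\<close>

lemma run_Delete_loss:
  assumes A: "doms A" and r: "rep s A W (Nf W) (Sf A W) F" and i: "reg s ''i'' = i" "i < n"
    and v: "reg s ''v'' = v" "v \<in> A i"
  shows "run w Delete_loss s
    (\<lambda>t s'. rep s' A W (Nf W) (Sf (A(i := A i - {v})) W) F \<and> t \<le> 5 + card (out i) * (120 * (d * d)))"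
proof -
  define A' where "A' = A(i := A i - {v})"
  have vd: "v < d" using A v by (auto simp: doms_def)
  then have dd: "d \<le> d * d" "1 \<le> d" by auto
  have S: "Sf A W q b c = Sf A' W q b c + of_bool (src q = i \<and> b \<noteq> v \<and> R q v c \<and> good W q b v)" for q b c
    unfolding A'_def by (rule Sf_delete) (use A v in auto)
  define T where "T = (\<lambda>P q b c. if P q b then Sf A' W q b c else Sf A W q b c)"
  have Td: "T P q b c \<le> d" for P q b c
    using Sf_le[OF A] Sf_le[OF doms_delete[OF A]] by (auto simp: T_def A'_def)
  show ?thesis
  unfolding Delete_loss_def
  proof (rule run_ForOut[where m = "2*e" and src = src and J = "\<lambda>D t s'.
      rep s' A W (Nf W) (T (\<lambda>q b. q \<in> D)) F \<and> t \<le> card D * (110 * (d * d))",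
      folded out_def], goal_cases)
    case (9 D q t s1)
    then have r1: "rep s1 A W (Nf W) (T (\<lambda>q b. q \<in> D)) F" and t1: "t \<le> card D * (110 * (d * d))" by auto
    have D: "card (insert q D) = Suc (card D)"
      using 9 i by (auto intro: finite_subset[OF _ finite_out] card_insert_disjoint)
    have q: "q < 2 * e" "src q = i" "q \<notin> D" "reg s1 ''x'' = q" "reg s1 ''v'' = v" using 9 i v by auto
    show ?case
    proof (rule run_For[where J = "\<lambda>k t s'. rep s' A W (Nf W) (T (\<lambda>q' b. q' \<in> D \<or> (q' = q \<and> b < k))) F \<and>
        t \<le> k * (90 * d)"], goal_cases)
      case (6 k t s2)
      then have r2: "rep s2 A W (Nf W) (T (\<lambda>q' b. q' \<in> D \<or> (q' = q \<and> b < k))) F" (is "rep _ _ _ _ ?T _")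
        and t2: "t \<le> k * (90 * d)" by auto
      have regs: "reg s2 ''x'' = q" "reg s2 ''y'' = k" "k < d" "reg s2 ''v'' = v" "v < d" "q < 2 * e"
        using 6 q vd by (auto simp: rep_D[OF r1])
      \<comment> \<open>The correction is a product of two indicators: the first is what
        \<open>Loss\<close> subtracts, the second is the outcome of the branch test.\<close>
      have T: "T (\<lambda>q' b. q' \<in> D \<or> (q' = q \<and> b < Suc k)) q' b c =
        ?T q' b c - of_bool (q' = q \<and> b = k \<and> R q v c) * of_bool (k \<noteq> v \<and> good W q k v)" for q' b c
        using q by (auto simp: T_def S less_Suc_eq)
      show ?case
      proof (rule run_CondI, goal_cases)
        case 1
        show ?case using regs by (simp add: safe_Good[OF r2])
      next
        case 2
        then have "k \<noteq> v \<and> good W q k v" using regs by (auto simp: ev_Good[OF r2])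
        then have eq: "T (\<lambda>q' b. q' \<in> D \<or> (q' = q \<and> b < Suc k)) =
           (\<lambda>q' b c. ?T q' b c - of_bool (q' = q \<and> b = k \<and> R q v c))"
          using T by (auto intro!: ext)
        have "run w Loss s2 (\<lambda>t s'. t \<le> 6 + 39 * d \<and>
          rep s' A W (Nf W) (\<lambda>q' b c. ?T q' b c - of_bool (q' = q \<and> b = k \<and> R q v c)) F)"
          by (rule run_Loss) (use r2 regs Td in auto)
        then show ?case
          by (rule run_mono) (use t2 dd eq in auto)
      next
        case 3
        then have "\<not> (k \<noteq> v \<and> good W q k v)" using regs by (auto simp: ev_Good[OF r2])
        then have "T (\<lambda>q' b. q' \<in> D \<or> (q' = q \<and> b < Suc k)) = ?T" using T by (auto intro!: ext)
        then show ?case using r2 t2 dd by simp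
      qed
    next
      case (7 t2 s2)
      then have r2: "rep s2 A W (Nf W) (T (\<lambda>q' b. q' \<in> D \<or> (q' = q \<and> b < d))) F"
        and t2: "t2 \<le> d * (90 * d)" by (auto simp: rep_D[OF r1])
      have t2': "t2 \<le> 90 * (d * d)" using t2 by (simp add: algebra_simps)
      have "rep s2 A W (Nf W) (T (\<lambda>q' b. q' \<in> insert q D)) F"
        by (rule rep_cong[OF r2]) (auto simp: T_def)
      moreover have "t + (t2 + 6 + 8 * d) \<le> card D * (110 * (d * d)) + 110 * (d * d)"
        using t1 t2' dd by linarith
      ultimately show ?case using D by (auto simp: rep_D[OF r1])
    qed (use r1 w_bounds in \<open>auto simp: rep_D[OF r1] T_def\<close>)
  next
    case (10 t s1)
    then have r1: "rep s1 A W (Nf W) (T (\<lambda>q b. q \<in> out i)) F" and t1: "t \<le> card (out i) * (110 * (d * d))"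
      using i by auto
    have "rep s1 A W (Nf W) (Sf A' W) F"
      by (rule rep_cong[OF r1]) (auto simp: T_def S out_def)
    have "card (out i) * 9 \<le> card (out i) * (10 * (d * d))" using dd by (intro mult_le_mono2) linarith
    have "t + 5 + 9 * card (out i) \<le> 5 + card (out i) * (120 * (d * d))"
    proof -
      have "card (out i) * (120 * (d * d)) = card (out i) * (110 * (d * d)) + card (out i) * (10 * (d * d))"
        by (simp add: algebra_simps)
      then show ?thesis using t1 \<open>card (out i) * 9 \<le> _\<close> by linarith
    qed
    with \<open>rep s1 A W (Nf W) (Sf A' W) F\<close> show ?case using i by (auto simp: A'_def)
  qed (use r i w_bounds in \<open>auto simp: rep_D[OF r] rep_D(9,21) head_def T_def\<close>)
qed

text \<open>A deletion at \<open>i\<close> affects \<open>W\<close> only on arcs into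
  \<open>i\<close>, that is, on flips of arcs out of \<open>i\<close>. Each affected entry falls by
  exactly one, so the old table is led to the new one by single steps of \<open>dec\<close>, with
  \<open>N\<close>, \<open>S\<close> and \<open>pend\<close> exact in between.\<close>

lemma run_Delete_dec:
  assumes A: "doms A" and i: "reg s ''i'' = i" "i < n" and v: "reg s ''v'' = v" "v \<in> A i"
    and r: "rep s (A(i := A i - {v})) (Wf A) (Nf (Wf A)) (Sf (A(i := A i - {v})) (Wf A)) F"
    and pd: "pend F (A(i := A i - {v})) (Sf (A(i := A i - {v})) (Wf A))"
  defines "A' \<equiv> A(i := A i - {v})"
  shows "run w Delete_dec s
    (\<lambda>t s'. \<exists>F'. rep s' A' (Wf A') (Nf (Wf A')) (Sf A' (Wf A')) F' \<and> pend F' A' (Sf A' (Wf A')) \<and>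
      t + pot F' (Wf A') \<le> 5 + pot F (Wf A) + card (out i) * (300 * (d * d)))"
proof -
  have A': "doms A'" unfolding A'_def using A by (rule doms_delete)
  have vd: "v < d" using A v by (auto simp: doms_def)
  then have dd: "d \<le> d * d" "1 \<le> d" by auto
  have W: "Wf A q b a = Wf A' q b a + of_bool (dst q = i \<and> R q b v \<and> \<not> R q a v)" for q b a
    unfolding A'_def by (rule Wf_delete) (use A v in auto)
  \<comment> \<open>Entries selected by the progress predicate \<open>P\<close> already count for
    the smaller domain.\<close>
  define V where "V = (\<lambda>P q b a. if P q b a then Wf A' q b a else Wf A q b a)"
  define G where "G = (\<lambda>P F s. rep s A' (V P) (Nf (V P)) (Sf A' (V P)) F \<and> pend F A' (Sf A' (V P)))"
  show ?thesis
  unfolding Delete_dec_def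
  proof (rule run_ForOut[where m = "2*e" and src = src and J = "\<lambda>D t s'. \<exists>F'. G (\<lambda>q b a. q \<in> flip ` D) F' s' \<and>
      t + pot F' (V (\<lambda>q b a. q \<in> flip ` D)) \<le> pot F (Wf A) + card D * (290 * (d * d))", folded out_def], goal_cases)
    case (9 D x t s1)
    then obtain F1 where r1: "G (\<lambda>q b a. q \<in> flip ` D) F1 s1"
      and t1: "t + pot F1 (V (\<lambda>q b a. q \<in> flip ` D)) \<le> pot F (Wf A) + card D * (290 * (d * d))" by blast
    have D: "card (insert x D) = Suc (card D)"
      using 9 i by (auto intro: finite_subset[OF _ finite_out] card_insert_disjoint)
    have x: "x < 2 * e" "src x = i" "x \<notin> D" "reg s1 ''x'' = x" "reg s1 ''v'' = v" using 9 i v by auto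
    define p where "p = flip x"
    have p: "p < 2 * e" "dst p = i" using x by (auto simp: p_def flip_less dst_of_flip)
    \<comment> \<open>\<open>flip\<close> is an involution on arcs, so different arcs have different
      flips and the entries of \<open>p\<close> are still untouched.\<close>
    have pD: "p \<notin> flip ` D"
    proof
      assume "p \<in> flip ` D"
      then obtain x' where "x' \<in> D" "flip x = flip x'" by (auto simp: p_def)
      moreover have "x' < 2 * e" using \<open>x' \<in> D\<close> 9(3) by (auto simp: out_def)
      ultimately show False using x flip_flip by metis
    qed
    note rr1 = r1[unfolded G_def, THEN conjunct1]
    have s1': "G (\<lambda>q b a. q \<in> flip ` D) F1 (set_reg ''p'' p s1)" using r1 by (simp add: G_def)
    have ev: "ev s1 (Flip (Reg ''x'')) = p" using ev_Flip[OF rr1] x by (simp add: p_def)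
    show ?case
    proof (rule run_Assign_Seq[where v = p], goal_cases)
      case 4
      show ?case
      proof (rule run_For[where J = "\<lambda>k t s'. \<exists>F'. G (\<lambda>q b a. q \<in> flip ` D \<or> (q = p \<and> b < k)) F' s' \<and>
          t + pot F' (V (\<lambda>q b a. q \<in> flip ` D \<or> (q = p \<and> b < k))) \<le>
          pot F1 (V (\<lambda>q b a. q \<in> flip ` D)) + k * (254 * d)"], goal_cases)
        case (6 k t2 s2)
        then obtain F2 where r2: "G (\<lambda>q b a. q \<in> flip ` D \<or> (q = p \<and> b < k)) F2 s2"
          and t2: "t2 + pot F2 (V (\<lambda>q b a. q \<in> flip ` D \<or> (q = p \<and> b < k))) \<le>
            pot F1 (V (\<lambda>q b a. q \<in> flip ` D)) + k * (254 * d)" by blast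
        note rr2 = r2[unfolded G_def, THEN conjunct1]
        have k: "k < d" "reg s2 ''p'' = p" "reg s2 ''y'' = k" "reg s2 ''v'' = v" using 6 x by (auto simp: rep_D[OF rr1])
        show ?case
        proof (rule run_For[where J = "\<lambda>l t s'. \<exists>F'. G (\<lambda>q b a. q \<in> flip ` D \<or> (q = p \<and> (b < k \<or> b = k \<and> a < l))) F' s' \<and>
          t + pot F' (V (\<lambda>q b a. q \<in> flip ` D \<or> (q = p \<and> (b < k \<or> b = k \<and> a < l)))) \<le>
          pot F2 (V (\<lambda>q b a. q \<in> flip ` D \<or> (q = p \<and> b < k))) + l * 232"], goal_cases)
          case (6 l t3 s3)
          let ?P = "\<lambda>l q b a. q \<in> flip ` D \<or> (q = p \<and> (b < k \<or> b = k \<and> a < l))"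
          from 6 obtain F3 where r3: "G (?P l) F3 s3"
            and t3: "t3 + pot F3 (V (?P l)) \<le> pot F2 (V (\<lambda>q b a. q \<in> flip ` D \<or> (q = p \<and> b < k))) + l * 232" by blast
          note rr3 = r3[unfolded G_def, THEN conjunct1] and pd3 = r3[unfolded G_def, THEN conjunct2]
          have l: "l < d" "reg s3 ''p'' = p" "reg s3 ''y'' = k" "reg s3 ''v'' = v" "reg s3 ''z'' = l"
            using 6 k by (auto simp: rep_D[OF rr2])
          \<comment> \<open>The old and the new count differ exactly when \<open>v\<close> itself is
            a witness for the pair, which is what the program tests.\<close>
          have V: "V (?P (Suc l)) = (if R p k v \<and> \<not> R p l v then dec (V (?P l)) p k l else V (?P l))"
            using pD p by (auto simp: V_def dec_def W less_Suc_eq intro!: ext)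
          show ?case
          proof (rule run_CondI, goal_cases)
            case 1
            show ?case using l k p vd by (simp add: rep_D[OF rr3])
          next
            case 2
            then have Rp: "R p k v" "\<not> R p l v" using l k p vd by (auto simp: rep_D[OF rr3] of_bool_def split: if_splits)
            have "run w Dec s3 (\<lambda>t s'. \<exists>F'. rep s' A' (dec (V (?P l)) p k l) (Nf (dec (V (?P l)) p k l))
                (Sf A' (dec (V (?P l)) p k l)) F' \<and>
              pend F' A' (Sf A' (dec (V (?P l)) p k l)) \<and> t + pot F' (dec (V (?P l)) p k l) \<le> 200 + pot F3 (V (?P l)))"
            proof (rule run_Dec[OF A' rr3 pd3])
              \<comment> \<open>The entry still has its old value, and \<open>v\<close> is among the
                values it counts; hence it is positive.\<close>
              have *: "V (?P l) p k l = Wf A p k l" using pD by (auto simp: V_def)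
              show "0 < V (?P l) p k l" unfolding * using Rp p by (simp add: W)
              show "V (?P l) p k l \<le> d" unfolding * using Wf_le[OF A] .
            qed (use l k p in auto)
            then show ?case
            proof (rule run_mono, elim exE conjE, goal_cases)
              case (1 t4 s4 F4)
              have eqV: "V (?P (Suc l)) = dec (V (?P l)) p k l" using V Rp by simp
              show ?case using 1 t3 unfolding G_def eqV
                by (intro exI[of _ F4]) auto
            qed
          next
            case 3
            then have Rp: "\<not> (R p k v \<and> \<not> R p l v)" using l k p vd by (auto simp: rep_D[OF rr3] of_bool_def split: if_splits)
            with V have eqV: "V (?P (Suc l)) = V (?P l)" by (simp only: if_False)
            show ?case unfolding G_def eqV run_skip using t3 rr3 pd3 by (intro exI[of _ F3]) auto
          qed
        next
          case (7 t3 s3)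
          have eq: "V (\<lambda>q b a. q \<in> flip ` D \<or> (q = p \<and> (b < k \<or> b = k \<and> a < d))) q b a =
            V (\<lambda>q b a. q \<in> flip ` D \<or> (q = p \<and> b < Suc k)) q b a" if "a < d" for q b a
            using that by (auto simp: V_def less_Suc_eq)
          let ?V1 = "V (\<lambda>q b a. q \<in> flip ` D \<or> (q = p \<and> (b < k \<or> b = k \<and> a < d)))"
          let ?V2 = "V (\<lambda>q b a. q \<in> flip ` D \<or> (q = p \<and> b < Suc k))"
          from 7 obtain F3 where r3: "rep s3 A' ?V1 (Nf ?V1) (Sf A' ?V1) F3" and pd3: "pend F3 A' (Sf A' ?V1)"
            and t3: "t3 + pot F3 ?V1 \<le> pot F2 (V (\<lambda>q b a. q \<in> flip ` D \<or> (q = p \<and> b < k))) + d * 232"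
            by (auto simp: rep_D[OF rr2] G_def)
          have N: "Nf ?V1 q b a = Nf ?V2 q b a" if "a < d" for q b a using eq that by (intro Nf_cong)
          have S: "Sf A' ?V1 = Sf A' ?V2" using eq by (auto intro!: ext Sf_cong A')
          have "phi ?V1 = phi ?V2" using eq by (intro phi_cong)
          then have P: "pot F' ?V1 = pot F' ?V2" for F' by (simp add: pot_def)
          have "rep s3 A' ?V2 (Nf ?V2) (Sf A' ?V2) F3"
            by (rule rep_cong[OF r3]) (auto simp: eq N S)
          moreover have "t2 + (t3 + 6 + 8 * d) + pot F3 ?V2 \<le> pot F1 (V (\<lambda>q b a. q \<in> flip ` D)) + Suc k * (254 * d)"
            using t2 t3 dd unfolding P by simp
          ultimately show ?case using pd3 S by (auto simp: rep_D[OF rr2] G_def intro!: exI[of _ F3])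
        qed (use r2 w_bounds in \<open>auto simp: rep_D[OF rr2] G_def\<close>)
      next
        case (7 t2 s2)
        have eq: "V (\<lambda>q b a. q \<in> flip ` D \<or> (q = p \<and> b < d)) q b a =
            V (\<lambda>q b a. q \<in> flip ` insert x D) q b a" if "b < d" for q b a
          using that by (auto simp: V_def p_def)
        let ?V1 = "V (\<lambda>q b a. q \<in> flip ` D \<or> (q = p \<and> b < d))"
        let ?V2 = "V (\<lambda>q b a. q \<in> flip ` insert x D)"
        from 7 obtain F2 where r2: "rep s2 A' ?V1 (Nf ?V1) (Sf A' ?V1) F2" and pd2: "pend F2 A' (Sf A' ?V1)"
          and t2: "t2 + pot F2 ?V1 \<le> pot F1 (V (\<lambda>q b a. q \<in> flip ` D)) + d * (254 * d)"
          by (auto simp: rep_D[OF rr1] G_def)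
        have N: "Nf ?V1 q b a = Nf ?V2 q b a" if "b < d" for q b a using eq that by (intro Nf_cong)
        have S: "Sf A' ?V1 q b c = Sf A' ?V2 q b c" if "b < d" for q b c using eq that by (intro Sf_cong A')
        have "phi ?V1 = phi ?V2" using eq by (intro phi_cong)
        then have P: "pot F' ?V1 = pot F' ?V2" for F' by (simp add: pot_def)
        have "rep s2 A' ?V2 (Nf ?V2) (Sf A' ?V2) F2"
          by (rule rep_cong[OF r2]) (auto simp: eq N S)
        moreover have "pend F2 A' (Sf A' ?V2)" using pd2 S A' by (auto simp: pend_def doms_def subset_eq)
        moreover have t2': "t2 + pot F2 ?V2 \<le> pot F1 (V (\<lambda>q b a. q \<in> flip ` D)) + 254 * (d * d)"
          using t2 unfolding P by (simp add: algebra_simps)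
        have "t + (12 + (t2 + 6 + 8 * d)) + pot F2 ?V2 \<le> pot F (Wf A) + card D * (290 * (d * d)) + 290 * (d * d)"
          using t1 t2' dd by linarith
        ultimately show ?case using D by (auto simp: rep_D[OF rr1] G_def intro!: exI[of _ F2])
      qed (use s1' w_bounds in \<open>auto simp: rep_D[OF rr1] G_def\<close>)
    qed (use ev p w_bounds in auto)
  next
    case (10 t s1)
    let ?V = "V (\<lambda>q b a. q \<in> flip ` out i)"
    from 10 i obtain F1 where r1: "rep s1 A' ?V (Nf ?V) (Sf A' ?V) F1" and pd1: "pend F1 A' (Sf A' ?V)"
      and t1: "t + pot F1 ?V \<le> pot F (Wf A) + card (out i) * (290 * (d * d))" by (auto simp: G_def)
    \<comment> \<open>The flips of the arcs out of \<open>i\<close> are all the arcs into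
      \<open>i\<close>, and on every other arc the deletion changes no count.\<close>
    have eq: "?V q b a = Wf A' q b a" if "q < 2 * e" for q b a
    proof (cases "dst q = i")
      case True
      then have "q \<in> flip ` out i"
        using that by (intro image_eqI[of _ _ "flip q"]) (auto simp: flip_flip out_def flip_less src_of_flip)
      then show ?thesis by (simp add: V_def)
    next
      case False
      then show ?thesis by (simp add: V_def W)
    qed
    have N: "Nf ?V = Nf (Wf A')" using eq by (auto intro!: ext Nf_cong)
    have S: "Sf A' ?V = Sf A' (Wf A')" using eq by (auto intro!: ext Sf_cong A')
    have "phi ?V = phi (Wf A')" using eq by (intro phi_cong)
    then have P: "pot F1 ?V = pot F1 (Wf A')" by (simp add: pot_def)
    have "rep s1 A' (Wf A') (Nf (Wf A')) (Sf A' (Wf A')) F1"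
      by (rule rep_cong[OF r1]) (auto simp: eq N S)
    moreover have "pend F1 A' (Sf A' (Wf A'))" using pd1 S by simp
    moreover have "t + 5 + 9 * card (out i) + pot F1 (Wf A') \<le> 5 + pot F (Wf A) + card (out i) * (300 * (d * d))"
    proof -
      have "card (out i) * 9 \<le> card (out i) * (10 * (d * d))" using dd by (intro mult_le_mono2) linarith
      moreover have "card (out i) * (300 * (d * d)) = card (out i) * (290 * (d * d)) + card (out i) * (10 * (d * d))"
        by (simp add: algebra_simps)
      ultimately show ?thesis using t1 P by linarith
    qed
    ultimately show ?case using i by (auto intro!: exI[of _ F1])
  qed (use r i pd w_bounds in \<open>auto simp: rep_D[OF r] rep_D(9,21) head_def V_def G_def A'_def[symmetric] intro!: exI[of _ F]\<close>)
qed

end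

text \<open>Each round pays for its test and body out of the potential that indexes the invariant,
  so the potential falls strictly: one induction yields both termination and the time bound.\<close>

lemma run_While_potential:
  assumes "\<And>\<phi> s. I \<phi> s \<Longrightarrow> safe s f"
    and step: "\<And>\<phi> s. I \<phi> s \<Longrightarrow> ev s f \<noteq> 0 \<Longrightarrow>
      run w c s (\<lambda>t s'. \<exists>\<phi>'. I \<phi>' s' \<and> t + 1 + cost f + \<phi>' \<le> \<phi>)"
  shows "I \<phi> s \<Longrightarrow> run w (While f c) s
    (\<lambda>t s'. \<exists>\<phi>'. I \<phi>' s' \<and> ev s' f = 0 \<and> t + \<phi>' \<le> \<phi> + 1 + cost f)"
proof (induction \<phi> arbitrary: s rule: less_induct)
  case (less \<phi>)
  show ?case
  proof (cases "ev s f = 0")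
    case True
    then show ?thesis using less.prems assms(1) by (intro run_WhileFalse) auto
  next
    case False
    show ?thesis
    proof (rule run_WhileTrue)
      show "run w c s (\<lambda>t1 s1. run w (While f c) s1 (\<lambda>t2 s'. \<exists>\<phi>'. I \<phi>' s' \<and> ev s' f = 0 \<and>
        1 + cost f + t1 + t2 + \<phi>' \<le> \<phi> + 1 + cost f))"
      proof (rule run_mono[OF step[OF less.prems False]], elim exE conjE, goal_cases)
        case (1 t1 s1 \<phi>1)
        have "run w (While f c) s1 (\<lambda>t s'. \<exists>\<phi>'. I \<phi>' s' \<and> ev s' f = 0 \<and> t + \<phi>' \<le> \<phi>1 + 1 + cost f)"
          by (rule less.IH) (use 1 in auto)
        then show ?case
        proof (rule run_mono, elim exE conjE, goal_cases)
          case (1 t2 s2 \<phi>2)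
          then show ?case using \<open>t1 + 1 + cost f + \<phi>1 \<le> \<phi>\<close> by (intro exI[of _ \<phi>2]) auto
        qed
      qed
    qed (use False less.prems assms(1) in auto)
  qed
qed

section \<open>Eliminations along arcs and the worklist loop\<close>

context net begin

text \<open>CNS conditioned on the arc \<open>q\<close>, over positions; the arrows to all other
  neighbours are expressed by vanishing counters.\<close>

definition cnse :: "(nat \<Rightarrow> nat set) \<Rightarrow> nat \<Rightarrow> nat \<Rightarrow> bool" where
  "cnse A q v \<longleftrightarrow> (\<forall>c\<in>A (dst q). R q v c \<longrightarrow>
     (\<exists>a\<in>A (src q). a \<noteq> v \<and> R q a c \<and> good (Wf A) q v a))"

definition elim :: "(nat \<Rightarrow> nat set) \<Rightarrow> (nat \<Rightarrow> nat set) \<Rightarrow> bool" where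
  "elim A A' \<longleftrightarrow> (\<exists>q<2*e. \<exists>v\<in>A (src q). cnse A q v \<and> A' = A(src q := A (src q) - {v}))"

lemma cnse_iff:
  assumes "doms A"
  shows "cnse A q v \<longleftrightarrow> (\<forall>c\<in>A (dst q). R q v c \<longrightarrow> Sf A (Wf A) q v c \<noteq> 0)"
proof -
  have "Sf A (Wf A) q v c \<noteq> 0 \<longleftrightarrow> (\<exists>a\<in>A (src q). a \<noteq> v \<and> R q a c \<and> good (Wf A) q v a)" for c
    using doms_finite[OF assms] by (auto simp: Sf_def)
  then show ?thesis by (simp add: cnse_def)
qed

text \<open>A deletion at \<open>i\<close> treats every arc out of \<open>i\<close>. Counting each
  domain once per arc makes the mass fall by just that number.\<close>

definition mass :: "(nat \<Rightarrow> nat set) \<Rightarrow> nat" where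
  "mass A = (\<Sum>q<2*e. card (A (src q)))"

lemma mass_le: "doms A \<Longrightarrow> mass A \<le> 2 * e * d"
  unfolding mass_def using sum_mono[of "{..<2*e}" "\<lambda>q. card (A (src q))" "\<lambda>_. d"]
  by (simp add: doms_card)

lemma mass_delete:
  assumes "doms A" "v \<in> A i"
  shows "mass A = mass (A(i := A i - {v})) + card (out i)"
proof -
  have "card (A (src q)) = card ((A(i := A i - {v})) (src q)) + of_bool (src q = i)" for q
    using card.remove[OF doms_finite[OF assms(1)] assms(2)] by auto
  moreover have "card (out i) = (\<Sum>q<2*e. of_bool (src q = i))"
  proof -
    have "{..<2*e} \<inter> {q. src q = i} = out i" by (auto simp: out_def)
    then show ?thesis by (simp add: sum_of_bool_eq')
  qed
  ultimately show ?thesis by (simp add: mass_def sum.distrib)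
qed

end

context prog begin

definition Inv :: "(nat \<Rightarrow> nat set) \<Rightarrow> (nat \<times> nat) set \<Rightarrow> store \<Rightarrow> bool" where
  "Inv A F s \<longleftrightarrow> doms A \<and> rep s A (Wf A) (Nf (Wf A)) (Sf A (Wf A)) F \<and> pend F A (Sf A (Wf A))"

text \<open>The pair that triggered the deletion was popped without a certificate; the union in the
  hypothesis excuses the pairs of \<open>v\<close> on arcs out of \<open>i\<close>, which vanish
  together with \<open>v\<close>. The 600 is the sum of 180, 120 and 300 for the three
  loops.\<close>

lemma run_Delete:
  assumes A: "doms A" and r: "rep s A (Wf A) (Nf (Wf A)) (Sf A (Wf A)) F"
    and pd: "pend (F \<union> out i \<times> {v}) A (Sf A (Wf A))" and i: "reg s ''i'' = i" "i < n" and v: "reg s ''v'' = v" "v \<in> A i"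
  shows "run w Delete s (\<lambda>t s'. \<exists>F'. Inv (A(i := A i - {v})) F' s' \<and>
     t + pot F' (Wf (A(i := A i - {v}))) \<le> 25 + pot F (Wf A) + card (out i) * (600 * (d * d)))"
proof -
  define A' where "A' = A(i := A i - {v})"
  have vd: "v < d" using A v by (auto simp: doms_def)
  let ?c = "card (out i)"
  show ?thesis
    unfolding Delete_def A'_def[symmetric]
  proof (rule run_Seq_mono[OF run_Delete_push[OF r i]], goal_cases)
    case 1
    show ?case using vd by simp
  next
    case (2 t1 s1)
    then obtain F1 where r1: "rep s1 A (Wf A) (Nf (Wf A)) (Sf A (Wf A)) F1"
      and F1: "F \<subseteq> F1" "\<forall>x\<in>out i. \<forall>y<d. (flip x, y) \<in> F1"
      and t1: "t1 + 100 * (d * card F1) \<le> 5 + 100 * (d * card F) + ?c * (180 * (d * d))" by blast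
    have i1: "reg s1 ''i'' = i" "reg s1 ''v'' = v" using 2 i v by auto
    show ?case
    proof (rule run_Seq_mono[OF run_Delete_loss[OF A r1 i1(1) i(2) i1(2) v(2)]], fold A'_def, goal_cases)
      case (1 t2 s2)
      then have r2: "rep s2 A (Wf A) (Nf (Wf A)) (Sf A' (Wf A)) F1" and t2: "t2 \<le> 5 + ?c * (120 * (d * d))" by auto
      have i2: "reg s2 ''i'' = i" "reg s2 ''v'' = v" using 1 i1 by auto
      \<comment> \<open>On arcs into \<open>i\<close>, where \<open>v\<close> could be the
        certificate, all pairs have just been pushed; on the other arcs \<open>c\<close> stays alive
        and its counter can only fall.\<close>
      have pd2: "pend F1 A' (Sf A' (Wf A))"
        unfolding pend_def
      proof (intro allI impI ballI)
        fix q b assume "q < 2 * e" "b \<in> A' (src q)" "(q, b) \<notin> F1"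
        then have q: "q < 2 * e" "b \<in> A (src q)" "b < d" "(q, b) \<notin> F1" "(q, b) \<notin> F \<union> out i \<times> {v}"
          using F1(1) A by (auto simp: A'_def doms_def out_def subset_eq split: if_splits)
        have "dst q \<noteq> i"
        proof
          assume "dst q = i"
          then have "flip q \<in> out i" using q by (auto simp: out_def flip_less src_of_flip)
          then have "(flip (flip q), b) \<in> F1" using F1 q by blast
          with q show False by (simp add: flip_flip)
        qed
        moreover obtain c where "c \<in> A (dst q)" "R q b c" "Sf A (Wf A) q b c = 0"
          using pd q unfolding pend_def by blast
        ultimately show "\<exists>c\<in>A' (dst q). R q b c \<and> Sf A' (Wf A) q b c = 0"
          using Sf_delete[OF A v(2), of "Wf A" q b c] unfolding A'_def[symmetric]
          by (intro bexI[of _ c]) (auto simp: A'_def)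
      qed
      show ?case
      proof (rule run_Write_Seq[where k = "ix2 d i v" and v = 0], goal_cases)
        case 7
        define s3 where "s3 = set_arr ''alive'' ((arr s2 ''alive'')[ix2 d i v := 0]) s2"
        have r3: "rep s3 A' (Wf A) (Nf (Wf A)) (Sf A' (Wf A)) F1"
          unfolding s3_def A'_def by (rule rep_write_alive[OF r2[unfolded A'_def] i(2) vd])
        have i3: "reg s3 ''i'' = i" "reg s3 ''v'' = v" using i2 by (auto simp: s3_def)
        show ?case unfolding s3_def[symmetric]
        proof (rule run_mono[OF run_Delete_dec[OF A i3(1) i(2) i3(2) v(2) r3[unfolded A'_def] pd2[unfolded A'_def]]],
            fold A'_def, elim exE conjE, goal_cases)
          case (1 t4 s4 F4)
          have "?c * (600 * (d * d)) = ?c * (180 * (d * d)) + ?c * (120 * (d * d)) + ?c * (300 * (d * d))"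
            by (simp add: algebra_simps)
          then have "t1 + (t2 + (8 + t4)) + pot F4 (Wf A') \<le> 25 + pot F (Wf A) + ?c * (600 * (d * d))"
            using t1 t2 1(3) unfolding pot_def by linarith
          then show ?case using 1 doms_delete[OF A, of i "{v}"]
            by (intro exI[of _ F4]) (simp add: Inv_def A'_def)
        qed
      qed (use i i2 vd in \<open>auto simp: rep_D[OF r2]\<close>)
    qed
  qed
qed

lemma run_Pop:
  assumes r: "rep s A W N S F" and sp: "reg s ''sp'' \<noteq> 0"
  shows "run w Pop s (\<lambda>t s'. t = 17 \<and> (\<exists>q b. (q, b) \<in> F \<and> reg s' ''q'' = q \<and> reg s' ''v'' = b \<and>
     rep s' A W N S (F - {(q, b)}) \<and> card F = Suc (card (F - {(q, b)}))))"
proof -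
  define k where "k = reg s ''sp'' - 1"
  define q where "q = arr s ''stq'' ! k"
  define b where "b = arr s ''stb'' ! k"
  let ?f = "\<lambda>k. (arr s ''stq'' ! k, arr s ''stb'' ! k)"
  have k: "reg s ''sp'' = Suc k" "k < 2 * e * d" using sp rep_sp[OF r] by (auto simp: k_def)
  have bij: "bij_betw ?f {..<Suc k} F" using rep_D(29)[OF r] k by simp
  have qb: "(q, b) \<in> F" using bij_betw_apply[OF bij, of k] unfolding q_def b_def by simp
  then have lt: "q < 2 * e" "b < d" using rep_D(27)[OF r] by auto
  define s' where "s' = set_arr ''fl'' ((arr s ''fl'')[ix2 d q b := 0])
    (set_reg ''v'' b (set_reg ''q'' q (set_reg ''sp'' k s)))"
  have "bij_betw ?f ({..<Suc k} - {k}) (F - {?f k})"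
    using bij by (rule bij_betw_DiffI) (use qb in \<open>auto simp: bij_betw_def q_def b_def\<close>)
  moreover have "{..<Suc k} - {k} = {..<k}" by auto
  ultimately have "bij_betw ?f {..<k} (F - {(q, b)})" by (simp add: q_def b_def)
  moreover have "F - {(q, b)} = {(q, b). q < 2 * e \<and> b < d \<and> arr s' ''fl'' ! ix2 d q b \<noteq> 0}" (is "_ = ?Z")
  proof (rule set_eqI, clarify)
    fix x y
    have "(x, y) \<in> F \<longleftrightarrow> x < 2 * e \<and> y < d \<and> arr s ''fl'' ! ix2 d x y \<noteq> 0"
      using r by (auto simp: rep_def stack_def)
    then show "(x, y) \<in> F - {(q, b)} \<longleftrightarrow> (x, y) \<in> ?Z"
      using lt by (auto simp: s'_def nth_list_update rep_D(14)[OF r])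
  qed
  ultimately have "rep s' A W N S (F - {(q, b)})"
    using r by (simp add: rep_def stack_def s'_def)
  moreover have "card F = Suc (card (F - {(q, b)}))"
    by (rule card.remove[OF rep_finite[OF r] qb])
  ultimately show ?thesis
    using k lt qb w_bounds src_less[OF lt(1)] unfolding Pop_def
    by (simp add: rep_D[OF r] q_def[symmetric] b_def[symmetric] s'_def)
qed

lemma run_Check:
  assumes A: "doms A" and r: "rep s A W N S F" and q: "reg s ''q'' = q" "q < 2 * e" and v: "reg s ''v'' = v" "v < d"
  shows "run w Check s (\<lambda>t s'. t \<le> 15 + 44 * d \<and> rep s' A W N S F \<and>
     reg s' ''k'' = of_bool (v \<in> A (src q) \<and> (\<forall>c\<in>A (dst q). R q v c \<longrightarrow> S q v c \<noteq> 0)))"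
  unfolding Check_def
proof (rule run_Assign_Seq[where v = "of_bool (v \<in> A (src q))"], goal_cases)
  case 4
  define s1 where "s1 = set_reg ''k'' (of_bool (v \<in> A (src q))) s"
  have r1: "rep s1 A W N S F" using r by (simp add: s1_def)
  have reg1: "reg s1 ''q'' = q" "reg s1 ''v'' = v" using q v by (auto simp: s1_def)
  show ?case unfolding s1_def[symmetric]
  proof (rule run_For[where J = "\<lambda>k t s'. t \<le> 36 * k \<and> rep s' A W N S F \<and>
     reg s' ''k'' = of_bool (v \<in> A (src q) \<and> (\<forall>c<k. c \<in> A (dst q) \<longrightarrow> R q v c \<longrightarrow> S q v c \<noteq> 0))"], goal_cases)
    case (6 k t s2)
    then have r2: "rep s2 A W N S F" and t: "t \<le> 36 * k" and k: "k < d" "reg s2 ''c'' = k"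
      and kk: "reg s2 ''k'' = of_bool (v \<in> A (src q) \<and> (\<forall>c<k. c \<in> A (dst q) \<longrightarrow> R q v c \<longrightarrow> S q v c \<noteq> 0))"
      by (auto simp: rep_D[OF r1])
    have reg2: "reg s2 ''q'' = q" "reg s2 ''v'' = v" using 6 reg1 by auto
    show ?case using r2 t k kk q v reg2 w_bounds dst_less[OF q(2)]
      by (auto simp: rep_D[OF r2] less_Suc_eq of_bool_def split: if_splits)
  next
    case (7 t s2)
    then have "reg s2 ''k'' = of_bool (v \<in> A (src q) \<and> (\<forall>c<d. c \<in> A (dst q) \<longrightarrow> R q v c \<longrightarrow> S q v c \<noteq> 0))"
      and "t \<le> 36 * d" by (auto simp: rep_D[OF r1])
    moreover have "(\<forall>c<d. c \<in> A (dst q) \<longrightarrow> R q v c \<longrightarrow> S q v c \<noteq> 0) \<longleftrightarrow> (\<forall>c\<in>A (dst q). R q v c \<longrightarrow> S q v c \<noteq> 0)"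
      using A by (auto simp: doms_def subset_eq)
    ultimately show ?case using 7 by (simp add: rep_D[OF r1])
  qed (use r1 w_bounds in \<open>auto simp: rep_D(2)[OF r] s1_def\<close>)
qed (use q v w_bounds src_less in \<open>auto simp: rep_D[OF r] of_bool_def\<close>)

text \<open>The mass releases \<open>700 * (d * d)\<close> for each arc out of the variable of a
  deleted value: 600 parts pay for \<open>Delete\<close>, and the rest, together with the
  \<open>100 * d\<close> of the popped pair, covers popping, checking and the fixed costs.\<close>

lemma run_Propagate:
  assumes "Inv A F s"
  shows "run w Propagate s (\<lambda>t s'. \<exists>A'. Inv A' {} s' \<and> elim\<^sup>*\<^sup>* A A' \<and>
     (\<forall>q<2*e. \<forall>v\<in>A' (src q). \<not> cnse A' q v) \<and> t \<le> 2 + pot F (Wf A) + 700 * (d * d * mass A))"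
proof -
  define I where "I = (\<lambda>\<phi> s. \<exists>A' F'. Inv A' F' s \<and> elim\<^sup>*\<^sup>* A A' \<and> \<phi> = pot F' (Wf A') + 700 * (d * d * mass A'))"
  have "run w Propagate s (\<lambda>t s'. \<exists>\<phi>'. I \<phi>' s' \<and> ev s' (Reg ''sp'') = 0 \<and>
     t + \<phi>' \<le> (pot F (Wf A) + 700 * (d * d * mass A)) + 1 + cost (Reg ''sp''))"
    unfolding Propagate_def
  proof (rule run_While_potential)
    show "I (pot F (Wf A) + 700 * (d * d * mass A)) s" using assms by (auto simp: I_def)
  next
    fix \<phi> s1 assume "I \<phi> s1" and sp: "ev s1 (Reg ''sp'') \<noteq> 0"
    then obtain A1 F1 where I1: "Inv A1 F1 s1" and el: "elim\<^sup>*\<^sup>* A A1"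
      and phi: "\<phi> = pot F1 (Wf A1) + 700 * (d * d * mass A1)" by (auto simp: I_def)
    from I1 have A: "doms A1" and r1: "rep s1 A1 (Wf A1) (Nf (Wf A1)) (Sf A1 (Wf A1)) F1"
      and pd1: "pend F1 A1 (Sf A1 (Wf A1))" by (auto simp: Inv_def)
    have sp1: "reg s1 ''sp'' \<noteq> 0" using sp by simp
    show "run w (Seq Pop (Seq Check (Cond (Reg ''k'') (Seq (Assign ''i'' (Read ''src'' (Reg ''q''))) Delete) skip))) s1
      (\<lambda>t s'. \<exists>\<phi>'. I \<phi>' s' \<and> t + 1 + cost (Reg ''sp'') + \<phi>' \<le> \<phi>)"
    proof (rule run_Seq_mono[OF run_Pop[OF r1 sp1]], elim exE conjE, goal_cases)
      case (1 t2 s2 q v)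
      define F2 where "F2 = F1 - {(q, v)}"
      note r2 = 1(6)[folded F2_def] and card = 1(7)[folded F2_def]
      have lt: "q < 2 * e" "v < d" using rep_D(27)[OF r1] 1 by auto
      have d: "1 \<le> d" "d \<le> d * d" using lt by auto
      show ?case
      proof (rule run_Seq_mono[OF run_Check[OF A r2 1(4) lt(1) 1(5) lt(2)]], elim conjE, goal_cases)
        case (1 t3 s3)
        note r3 = 1(3)
        have reg3: "reg s3 ''q'' = q" "reg s3 ''v'' = v"
          using 1 \<open>reg s2 ''q'' = q\<close> \<open>reg s2 ''v'' = v\<close> by auto
        have cond: "reg s3 ''k'' = of_bool (v \<in> A1 (src q) \<and> cnse A1 q v)"
          using 1 by (simp add: cnse_iff[OF A])
        have pot: "pot F1 (Wf A1) = pot F2 (Wf A1) + 100 * d"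
          using card by (simp add: pot_def algebra_simps)
        show ?case
        proof (rule run_CondI, goal_cases)
          case 2
          then have v: "v \<in> A1 (src q)" "cnse A1 q v" using cond by (auto simp: of_bool_def split: if_splits)
          define i where "i = src q"
          define s4 where "s4 = set_reg ''i'' i s3"
          define A2 where "A2 = A1(i := A1 i - {v})"
          have iq: "q \<in> out i" "i < n" "v \<in> A1 i" using lt v src_less by (auto simp: i_def out_def)
          have "0 < card (out i)" using iq(1) by (auto simp: card_gt_0_iff)
          \<comment> \<open>At least the arc \<open>q\<close> leaves \<open>i\<close>, so the
            surplus of \<open>100 * (d * d)\<close> is really available.\<close>
          then have c: "d * d \<le> card (out i) * (d * d)" using mult_le_mono1[of 1 "card (out i)" "d * d"] by simp
          have pd2: "pend (F2 \<union> out i \<times> {v}) A1 (Sf A1 (Wf A1))"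
            by (rule pend_mono[OF pd1]) (use iq in \<open>auto simp: F2_def\<close>)
          have r4: "rep s4 A1 (Wf A1) (Nf (Wf A1)) (Sf A1 (Wf A1)) F2" using r3 by (simp add: s4_def)
          have reg4: "reg s4 ''i'' = i" "reg s4 ''v'' = v" using reg3 by (auto simp: s4_def)
          have el2: "elim\<^sup>*\<^sup>* A A2"
            using el by (rule rtranclp.rtrancl_into_rtrancl) (use lt v in \<open>auto simp: elim_def A2_def i_def\<close>)
          show ?case
          proof (rule run_Assign_Seq[where v = i], goal_cases)
            case 4
            show ?case unfolding s4_def[symmetric]
            proof (rule run_mono[OF run_Delete[OF A r4 pd2 reg4(1) iq(2) reg4(2) iq(3)]], fold A2_def,
                elim exE conjE, goal_cases)
              case (1 t5 s5 F5)
              have "700 * (d * d * mass A1) = 700 * (d * d * mass A2) + 700 * (card (out i) * (d * d))"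
                using mass_delete[OF A iq(3)] unfolding A2_def by (simp add: algebra_simps)
              moreover have "card (out i) * (600 * (d * d)) = 600 * (card (out i) * (d * d))" by simp
              ultimately have "62 + (t3 + t5) + (pot F5 (Wf A2) + 700 * (d * d * mass A2)) \<le> \<phi>"
                using 1(2) \<open>t3 \<le> 15 + 44 * d\<close> pot phi c d by linarith
              with 1(1) el2 show ?case using \<open>t2 = 17\<close>
                by (intro exI[of _ "pot F5 (Wf A2) + 700 * (d * d * mass A2)"]) (auto simp: I_def)
            qed
          qed (use reg3 iq w_bounds lt in \<open>auto simp: rep_D[OF r3] i_def\<close>)
        next
          case 3
          have nc: "\<not> (v \<in> A1 (src q) \<and> cnse A1 q v)" using 3 cond by (auto simp: of_bool_def split: if_splits)
          \<comment> \<open>The failed check supplies the certificate of the popped pair.\<close>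
          have "pend F2 A1 (Sf A1 (Wf A1))"
            unfolding pend_def
          proof (intro allI impI ballI)
            fix q' b assume q': "q' < 2 * e" "b \<in> A1 (src q')" "(q', b) \<notin> F2"
            show "\<exists>c\<in>A1 (dst q'). R q' b c \<and> Sf A1 (Wf A1) q' b c = 0"
            proof (cases "(q', b) = (q, v)")
              case True
              with nc q' show ?thesis by (auto simp: cnse_iff[OF A])
            next
              case False
              with q' pd1 show ?thesis by (auto simp: F2_def pend_def)
            qed
          qed
          then have "Inv A1 F2 (set_reg ''_'' 0 s3)" using A r3 by (simp add: Inv_def)
          moreover have "30 + t3 + (pot F2 (Wf A1) + 700 * (d * d * mass A1)) \<le> \<phi>"
            using \<open>t3 \<le> 15 + 44 * d\<close> pot phi d by linarith
          ultimately show ?case using el \<open>t2 = 17\<close> unfolding run_skip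
            by (intro exI[of _ "pot F2 (Wf A1) + 700 * (d * d * mass A1)"]) (auto simp: I_def)
        qed simp
      qed
    qed
  qed (auto simp: I_def)
  then show ?thesis
  proof (rule run_mono, elim exE conjE, goal_cases)
    case (1 t s' \<phi>')
    then obtain A' F' where I: "Inv A' F' s'" "elim\<^sup>*\<^sup>* A A'" by (auto simp: I_def)
    from I have A: "doms A'" and r1: "rep s' A' (Wf A') (Nf (Wf A')) (Sf A' (Wf A')) F'"
      and pd1: "pend F' A' (Sf A' (Wf A'))" by (auto simp: Inv_def)
    have "F' = {}" using rep_D(28)[OF r1] rep_finite[OF r1] 1 by simp
    moreover have "\<not> cnse A' q v" if "q < 2 * e" "v \<in> A' (src q)" for q v
    proof -
      have "v < d" using that A by (auto simp: doms_def)
      then show ?thesis using pd1 that \<open>F' = {}\<close> by (auto simp: cnse_iff[OF A] pend_def)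
    qed
    ultimately show ?case using I 1 by auto
  qed
qed

end

section \<open>Initialisation\<close>

definition Ends :: com where
  "Ends = For ''q'' ''e''
    (Seq (Write ''src'' (Reg ''q'') (Read ''fst'' (Reg ''q'')))
    (Seq (Write ''dst'' (Reg ''q'') (Read ''snd'' (Reg ''q'')))
    (Seq (Write ''src'' (Op Add (Reg ''q'') (Reg ''e'')) (Read ''snd'' (Reg ''q'')))
      (Write ''dst'' (Op Add (Reg ''q'') (Reg ''e'')) (Read ''fst'' (Reg ''q''))))))"

definition Matrices :: com where
  "Matrices = For ''q'' ''e'' (For ''y'' ''d'' (For ''z'' ''d''
      (Seq (Write ''R'' (I3 (Reg ''q'') (Reg ''y'') (Reg ''z'')) (Read ''rel'' (I3 (Reg ''q'') (Reg ''y'') (Reg ''z''))))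
        (Write ''R'' (I3 (Op Add (Reg ''q'') (Reg ''e'')) (Reg ''z'') (Reg ''y''))
          (Read ''rel'' (I3 (Reg ''q'') (Reg ''y'') (Reg ''z'')))))))"

text \<open>Arcs are inserted at the front in increasing order, so when arc \<open>q\<close> is
  reached the head of its source is the last earlier arc out of that variable, as \<open>prv\<close>
  prescribes.\<close>

definition Link :: com where
  "Link = For ''q'' ''E''
    (Seq (Write ''nx'' (Reg ''q'') (Read ''hd'' (Read ''src'' (Reg ''q''))))
      (Write ''hd'' (Read ''src'' (Reg ''q'')) (Op Add (Reg ''q'') (Const 1))))"

text \<open>With a single variable there is no second index and nothing is CNS, hence the outer
  test. Position 0 is the one that is kept.\<close>

definition Isolated :: com where
  "Isolated = Cond (Op Less (Const 1) (Reg ''n''))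
    (For ''i'' ''n'' (Cond (Read ''hd'' (Reg ''i'')) skip
      (For ''y'' ''d'' (Cond (Reg ''y'') (Write ''alive'' (I2 (Reg ''i'') (Reg ''y'')) (Const 0)) skip)))) skip"

definition Witnesses :: com where
  "Witnesses = For ''c'' ''d'' (Write ''W'' (I3 (Reg ''q'') (Reg ''y'') (Reg ''z''))
        (Op Add (Read ''W'' (I3 (Reg ''q'') (Reg ''y'') (Reg ''z'')))
          (Op Mul (Read ''alive'' (I2 (Read ''dst'' (Reg ''q'')) (Reg ''c'')))
            (Op Mul (Read ''R'' (I3 (Reg ''q'') (Reg ''y'') (Reg ''c'')))
              (Op Sub (Const 1) (Read ''R'' (I3 (Reg ''q'') (Reg ''z'') (Reg ''c''))))))))"

definition Count :: com where
  "Count = For ''q'' ''E'' (For ''y'' ''d'' (For ''z'' ''d''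
    (Seq Witnesses
      (Write ''N'' (Nix (Reg ''q'') (Reg ''y'') (Reg ''z''))
        (Op Add (Read ''N'' (Nix (Reg ''q'') (Reg ''y'') (Reg ''z'')))
          (Op Less (Const 0) (Read ''W'' (I3 (Reg ''q'') (Reg ''y'') (Reg ''z'')))))))))"

text \<open>\<open>Good\<close> needs the finished tables \<open>W\<close> and \<open>N\<close>,
  which forces a separate pass after \<open>Count\<close>. Pushing every pair makes
  \<open>pend\<close> hold vacuously at the start.\<close>

definition Support :: com where
  "Support = For ''g'' ''E'' (For ''y'' ''d'' (Seq (Push (Reg ''g'') (Reg ''y''))
    (For ''z'' ''d'' (Cond (Op Mul (Read ''alive'' (I2 (Read ''src'' (Reg ''g'')) (Reg ''z'')))
        (Op Mul (Op Sub (Const 1) (Op Eq (Reg ''z'') (Reg ''y''))) (Good (Reg ''g'') (Reg ''y'') (Reg ''z''))))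
      Gain skip))))"

lemma wregs_init [simp]:
  "wregs Ends = {''q''}" "wregs Matrices = {''q'', ''y'', ''z''}" "wregs Link = {''q''}"
  "wregs Witnesses = {''c''}" "wregs Isolated = {''_'', ''i'', ''y''}" "wregs Count = {''c'', ''q'', ''y'', ''z''}"
  "wregs Support = {''_'', ''c'', ''g'', ''sp'', ''y'', ''z''}"
  by (auto simp: Ends_def Matrices_def Link_def Isolated_def Witnesses_def Count_def Support_def)

lemma alloc_free_init [simp]: "alloc_free Ends" "alloc_free Matrices" "alloc_free Link" "alloc_free Isolated"
  "alloc_free Count" "alloc_free Support"
  by (auto simp: Ends_def Matrices_def Link_def Isolated_def Witnesses_def Count_def Support_def)

section \<open>Cost and correctness of the initialisation\<close>

context prog begin

definition dims :: "store \<Rightarrow> bool" where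
  "dims s \<longleftrightarrow> length (arr s ''src'') = 2 * e \<and> length (arr s ''dst'') = 2 * e \<and>
     length (arr s ''R'') = 2 * e * d * d \<and> length (arr s ''hd'') = n \<and> length (arr s ''nx'') = 2 * e \<and>
     length (arr s ''alive'') = n * d \<and> length (arr s ''W'') = 2 * e * d * d \<and>
     length (arr s ''N'') = 2 * e * d * d \<and> length (arr s ''S'') = 2 * e * d * d \<and>
     length (arr s ''fl'') = 2 * e * d \<and> length (arr s ''stq'') = 2 * e * d \<and>
     length (arr s ''stb'') = 2 * e * d \<and> length (arr s ''fst'') = e \<and> length (arr s ''snd'') = e \<and>
     length (arr s ''rel'') = e * d * d"

lemma dims_set_reg [simp]: "dims (set_reg x v s) = dims s"
  by (simp add: dims_def)

lemma dims_write [simp]: "dims (set_arr a ((arr s a)[k := v]) s) = dims s"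
proof -
  have "length (arr (set_arr a ((arr s a)[k := v]) s) x) = length (arr s x)" for x by simp
  then show ?thesis by (simp only: dims_def)
qed

definition regs :: "store \<Rightarrow> bool" where
  "regs s \<longleftrightarrow> reg s ''n'' = n \<and> reg s ''d'' = d \<and> reg s ''e'' = e \<and> reg s ''E'' = 2 * e \<and> reg s ''sp'' = 0"

text \<open>Before \<open>rep\<close> can hold, a step is described by the arrays that it may
  change.\<close>

definition same :: "string set \<Rightarrow> store \<Rightarrow> store \<Rightarrow> bool" where
  "same X s s' \<longleftrightarrow> dims s' \<and> (\<forall>a. a \<notin> X \<longrightarrow> arr s' a = arr s a)"

lemma same_set_reg [simp]: "same X s (set_reg x v s') = same X s s'"
  by (simp add: same_def)

lemma same_write [simp]: "same X s s' \<Longrightarrow> a \<in> X \<Longrightarrow> same X s (set_arr a ((arr s' a)[k := v]) s')"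
  by (auto simp: same_def)

lemma run_Ends:
  assumes dm: "dims s" and rg: "regs s"
    and fst: "\<And>q. q < e \<Longrightarrow> arr s ''fst'' ! q = src q"
    and snd: "\<And>q. q < e \<Longrightarrow> arr s ''snd'' ! q = dst q"
  shows "run w Ends s (\<lambda>t s'. t \<le> 6 + e * 50 \<and> same {''src'', ''dst''} s s' \<and>
     (\<forall>q<2*e. arr s' ''src'' ! q = src q \<and> arr s' ''dst'' ! q = dst q))"
proof -
  note rg' = rg[unfolded regs_def]
  define G where "G = (\<lambda>k s'. same {''src'', ''dst''} s s' \<and>
    (\<forall>q<k. arr s' ''src'' ! q = src q \<and> arr s' ''dst'' ! q = dst q \<and>
       arr s' ''src'' ! (q + e) = dst q \<and> arr s' ''dst'' ! (q + e) = src q))"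
  have G_set_reg [simp]: "G k (set_reg x v s') = G k s'" for k x v s' by (simp add: G_def)
  show ?thesis
    unfolding Ends_def
  proof (rule run_For[where J = "\<lambda>k t s'. t \<le> k * 42 \<and> G k s'"], goal_cases)
    case (6 k t s1)
    then have k: "k < e" and t: "t \<le> k * 42" and G1: "G k s1"
      and r1: "reg s1 ''q'' = k" "reg s1 ''e'' = e"
      using rg' by auto
    have dm1: "dims s1" "arr s1 ''fst'' = arr s ''fst''" "arr s1 ''snd'' = arr s ''snd''"
      using G1 by (auto simp: G_def same_def)
    have b: "src k \<le> w" "dst k \<le> w" using src_less[of k] dst_less[of k] k w_bounds by auto
    define s2 where "s2 = set_arr ''src'' ((arr s1 ''src'')[k := src k]) s1"
    define s3 where "s3 = set_arr ''dst'' ((arr s2 ''dst'')[k := dst k]) s2"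
    define s4 where "s4 = set_arr ''src'' ((arr s3 ''src'')[k + e := dst k]) s3"
    define s5 where "s5 = set_arr ''dst'' ((arr s4 ''dst'')[k + e := src k]) s4"
    note S = s2_def s3_def s4_def s5_def
    have "same {''src'', ''dst''} s s1" using G1 by (simp add: G_def)
    then have "same {''src'', ''dst''} s s5" unfolding S by (intro same_write) auto
    then have "G (Suc k) s5"
      using G1 k dm1(1) by (auto simp: G_def S less_Suc_eq dims_def nth_list_update)
    then show ?case
      using k t b r1 dm1(1) fst[of k] snd[of k]
      by (simp add: dm1(2,3) dims_def S)
  next
    case (7 t s')
    then have G: "G e s'" using rg' by simp
    have "arr s' ''src'' ! q = src q \<and> arr s' ''dst'' ! q = dst q" if "q < 2 * e" for q
    proof (cases "q < e")
      case True
      with G show ?thesis by (simp add: G_def)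
    next
      case False
      then have "q - e < e" "q = q - e + e" using that by auto
      with G src_flip dst_flip show ?thesis unfolding G_def by metis
    qed
    then show ?case using 7 rg' by (simp add: G_def)
  qed (use rg' dm w_bounds in \<open>auto simp: G_def same_def\<close>)
qed

lemma run_Matrices:
  assumes dm: "dims s" and rg: "regs s" and d: "0 < e \<Longrightarrow> 0 < d"
    and rel: "\<And>q b c. q < e \<Longrightarrow> b < d \<Longrightarrow> c < d \<Longrightarrow> arr s ''rel'' ! ix3 d q b c = of_bool (R q b c)"
  shows "run w Matrices s (\<lambda>t s'. t \<le> 6 + e * (100 * (d * d)) \<and> same {''R''} s s' \<and>
     (\<forall>q<2*e. \<forall>b<d. \<forall>c<d. arr s' ''R'' ! ix3 d q b c = of_bool (R q b c)))"
proof -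
  note rg' = rg[unfolded regs_def]
  define G where "G = (\<lambda>P s'. same {''R''} s s' \<and>
    (\<forall>q<e. \<forall>b<d. \<forall>c<d. P q b c \<longrightarrow> arr s' ''R'' ! ix3 d q b c = of_bool (R q b c) \<and>
       arr s' ''R'' ! ix3 d (q + e) c b = of_bool (R q b c)))"
  have G_set_reg [simp]: "G P (set_reg x v s') = G P s'" for P x v s' by (simp add: G_def)
  show ?thesis
    unfolding Matrices_def
  proof (rule run_For[where J = "\<lambda>k t s'. t \<le> k * (90 * (d * d)) \<and> G (\<lambda>q b c. q < k) s'"], goal_cases)
    case (6 k t s3)
    then have k: "k < e" and t: "t \<le> k * (90 * (d * d))" and G3: "G (\<lambda>q b c. q < k) s3"
      and r3: "reg s3 ''q'' = k" "reg s3 ''d'' = d" "reg s3 ''e'' = e"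
      using rg' by auto
    have d0: "1 \<le> d" "d \<le> d * d" "1 \<le> d * d" using d k by auto
    show ?case
    proof (rule run_For[where J = "\<lambda>y t s'. t \<le> y * (64 * d) \<and> G (\<lambda>q b c. q < k \<or> q = k \<and> b < y) s'"], goal_cases)
      case (6 y t4 s4)
      then have y: "y < d" and t4: "t4 \<le> y * (64 * d)" and G4: "G (\<lambda>q b c. q < k \<or> q = k \<and> b < y) s4"
        and r4: "reg s4 ''q'' = k" "reg s4 ''d'' = d" "reg s4 ''e'' = e" "reg s4 ''y'' = y"
        using r3 by auto
      show ?case
      proof (rule run_For[where J = "\<lambda>z t s'. t \<le> z * 50 \<and> G (\<lambda>q b c. q < k \<or> q = k \<and> (b < y \<or> b = y \<and> c < z)) s'"], goal_cases)
        case (6 z t5 s5)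
        then have z: "z < d" and t5: "t5 \<le> z * 50"
          and G5: "G (\<lambda>q b c. q < k \<or> q = k \<and> (b < y \<or> b = y \<and> c < z)) s5"
          and r5: "reg s5 ''q'' = k" "reg s5 ''d'' = d" "reg s5 ''e'' = e" "reg s5 ''y'' = y" "reg s5 ''z'' = z"
          using r4 by auto
        have dm5: "dims s5" "arr s5 ''rel'' = arr s ''rel''" using G5 by (auto simp: G_def same_def)
        define s6 where "s6 = set_arr ''R'' ((arr s5 ''R'')[ix3 d k y z := of_bool (R k y z)]) s5"
        define s7 where "s7 = set_arr ''R'' ((arr s6 ''R'')[ix3 d (k + e) z y := of_bool (R k y z)]) s6"
        have "k < 2 * e" using k by simp
        have "same {''R''} s s5" using G5 by (simp add: G_def)
        then have "same {''R''} s s7" unfolding s7_def s6_def by (intro same_write) auto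
        moreover have "arr s7 ''R'' ! ix3 d q b c = of_bool (R q b c) \<and> arr s7 ''R'' ! ix3 d (q + e) c b = of_bool (R q b c)"
          if "q < k \<or> q = k \<and> (b < y \<or> b = y \<and> c < Suc z)" "q < e" "b < d" "c < d" for q b c
        proof (cases "q = k \<and> b = y \<and> c = z")
          case True
          then show ?thesis using dm5(1) that \<open>k < 2 * e\<close> k by (simp add: s7_def s6_def dims_def nth_list_update)
        next
          case False
          then have "q < k \<or> q = k \<and> (b < y \<or> b = y \<and> c < z)" using that by auto
          then have "arr s5 ''R'' ! ix3 d q b c = of_bool (R q b c) \<and> arr s5 ''R'' ! ix3 d (q + e) c b = of_bool (R q b c)"
            using G5 that unfolding G_def by blast
          then show ?thesis using dm5(1) that k y z False \<open>k < 2 * e\<close>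
            by (simp add: s7_def s6_def dims_def nth_list_update)
        qed
        ultimately have "G (\<lambda>q b c. q < k \<or> q = k \<and> (b < y \<or> b = y \<and> c < Suc z)) s7"
          unfolding G_def by blast
        then show ?case using k y z r5 dm5(1) rel[of k y z] t5 w_bounds
          by (simp add: dims_def s7_def s6_def dm5(2) of_bool_def)
      next
        case (7 t5 s5)
        then have "G (\<lambda>q b c. q < k \<or> q = k \<and> b < Suc y) s5"
          using r4 by (auto simp: G_def less_Suc_eq)
        moreover have "t5 \<le> d * 50" using 7 r4 by auto
        ultimately show ?case using t4 d0 r4 by simp
      qed (use G4 r4 w_bounds in auto)
    next
      case (7 t4 s4)
      then have "G (\<lambda>q b c. q < Suc k) s4" using r3 by (auto simp: G_def less_Suc_eq)
      moreover have "t4 \<le> 64 * (d * d)" using 7 r3 by (auto simp: algebra_simps)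
      then have "t + (t4 + 6 + 8 * d) \<le> Suc k * (90 * (d * d))" using t d0 unfolding mult_Suc by linarith
      ultimately show ?case using r3 by auto
    qed (use G3 r3 w_bounds in \<open>auto simp: G_def\<close>)
  next
    case (7 t s')
    then have G: "G (\<lambda>q b c. q < e) s'" using rg' by simp
    have R: "arr s' ''R'' ! ix3 d q b c = of_bool (R q b c)" if "q < 2 * e" "b < d" "c < d" for q b c
    proof (cases "q < e")
      case True
      with G that show ?thesis by (simp add: G_def)
    next
      case False
      then have q: "q - e < e" "q = q - e + e" using that by auto
      with G that have "arr s' ''R'' ! ix3 d (q - e + e) b c = of_bool (R (q - e) c b)" unfolding G_def by blast
      with q R_flip[of "q - e" b c] show ?thesis by simp
    qed
    \<comment> \<open>An edge forces \<open>d > 0\<close>, so the loop overhead of 8 per edge fits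
      into \<open>10 * (d * d)\<close>.\<close>
    have "e * (90 * (d * d)) + e * 8 \<le> e * (100 * (d * d))"
    proof (cases "e = 0")
      case False
      then have "8 \<le> 10 * (d * d)" using d by (cases d) auto
      then have "e * 8 \<le> e * (10 * (d * d))" by (rule mult_le_mono2)
      moreover have "e * (100 * (d * d)) = e * (90 * (d * d)) + e * (10 * (d * d))" by (simp add: algebra_simps)
      ultimately show ?thesis by linarith
    qed simp
    moreover have "t \<le> e * (90 * (d * d))" "reg s ''e'' = e" using 7 rg' by auto
    ultimately have "t + 6 + 8 * reg s ''e'' \<le> 6 + e * (100 * (d * d))" by linarith
    with R show ?case using G by (auto simp: G_def)
  qed (use rg' dm w_bounds in \<open>auto simp: G_def same_def\<close>)
qed

end

context net begin

text \<open>Intersecting with \<open>{0}\<close>, instead of assigning it, keeps an empty domain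
  empty.\<close>

definition collapse :: "(nat \<Rightarrow> nat set) \<Rightarrow> nat \<Rightarrow> nat set" where
  "collapse A = (\<lambda>i. if 1 < n \<and> i < n \<and> out i = {} then A i \<inter> {0} else A i)"

lemma doms_collapse: "doms A \<Longrightarrow> doms (collapse A)"
  by (auto simp: doms_def collapse_def)

end

context prog begin

lemma run_Link:
  assumes dm: "dims s" and rg: "regs s"
    and src: "\<And>q. q < 2 * e \<Longrightarrow> arr s ''src'' ! q = src q"
    and hd: "\<And>i. i < n \<Longrightarrow> arr s ''hd'' ! i = 0"
  shows "run w Link s (\<lambda>t s'. t \<le> 6 + e * 50 \<and> same {''nx'', ''hd''} s s' \<and>
     (\<forall>i<n. arr s' ''hd'' ! i = head i) \<and> (\<forall>q<2*e. arr s' ''nx'' ! q = prv src (src q) q))"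
proof -
  note rg' = rg[unfolded regs_def]
  show ?thesis
    unfolding Link_def
  proof (rule run_For[where J = "\<lambda>k t s'. t \<le> k * 11 \<and> same {''nx'', ''hd''} s s' \<and>
     (\<forall>i<n. arr s' ''hd'' ! i = prv src i k) \<and> (\<forall>q<k. arr s' ''nx'' ! q = prv src (src q) q)"], goal_cases)
    case (6 k t s1)
    then have k: "k < 2 * e" "reg s1 ''q'' = k" and t: "t \<le> k * 11" and sm: "same {''nx'', ''hd''} s s1"
      and H: "\<forall>i<n. arr s1 ''hd'' ! i = prv src i k" "\<forall>q<k. arr s1 ''nx'' ! q = prv src (src q) q"
      using rg' by auto
    have dm1: "dims s1" "arr s1 ''src'' = arr s ''src''" using sm by (auto simp: same_def)
    define s2 where "s2 = set_arr ''nx'' ((arr s1 ''nx'')[k := prv src (src k) k]) s1"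
    define s3 where "s3 = set_arr ''hd'' ((arr s2 ''hd'')[src k := Suc k]) s2"
    have "same {''nx'', ''hd''} s s3" unfolding s3_def s2_def using sm by (intro same_write) auto
    moreover have "\<forall>i<n. arr s3 ''hd'' ! i = prv src i (Suc k)"
      using H(1) dm1 by (auto simp: s3_def s2_def nth_list_update dims_def)
    moreover have "\<forall>q<Suc k. arr s3 ''nx'' ! q = prv src (src q) q"
      using H(2) dm1 k by (auto simp: s3_def s2_def nth_list_update dims_def less_Suc_eq)
    ultimately show ?case
      using k t dm1 src[of k] H src_less[of k] prv_le[of src "src k" k] w_bounds
      by (simp add: dims_def s3_def s2_def)
  next
    case (7 t s')
    then show ?case using rg' by (auto simp: head_def)
  qed (use rg' dm w_bounds hd in \<open>auto simp: same_def\<close>)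
qed

text \<open>Values are scanned only at variables without arcs, which is why the dependence on
  \<open>d\<close> is confined to their number.\<close>

lemma run_Isolated:
  assumes A: "doms A" and r: "rep s A W N S F"
  shows "run w Isolated s (\<lambda>t s'. t \<le> 20 + 13 * n + card {i. i < n \<and> out i = {}} * (20 * (d + 1)) \<and>
     rep s' (collapse A) W N S F)"
proof -
  \<comment> \<open>Isolated variables below \<open>k\<close> are finished, and variable
    \<open>k\<close>, if isolated, has lost the positions from 1 up to but excluding
    \<open>y\<close>.\<close>
  define B where "B = (\<lambda>k y i. if out i = {} \<and> i < k then A i \<inter> {0}
    else if out i = {} \<and> i = k then A i - {1..<y} else A i)"
  define u where "u = (\<lambda>k. card {i. i < k \<and> out i = {}})"
  have u: "u (Suc k) = u k + of_bool (out k = {})" for k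
  proof -
    have "{i. i < Suc k \<and> out i = {}} = (if out k = {} then insert k {i. i < k \<and> out i = {}} else {i. i < k \<and> out i = {}})"
      by (auto simp: less_Suc_eq)
    then show ?thesis by (simp add: u_def)
  qed
  have B0: "B 0 0 = A" by (auto simp: B_def fun_eq_iff)
  show ?thesis
    unfolding Isolated_def
  proof (rule run_CondI, goal_cases)
    case 3
    then have "collapse A = A" using rep_D(1)[OF r] by (auto simp: collapse_def split: if_splits)
    then show ?case using r by (simp add: rep_D[OF r])
  next
    case 2
    then have n: "1 < n" using rep_D(1)[OF r] by (auto split: if_splits)
    show ?case
    proof (rule run_For[where J = "\<lambda>k t s'. t \<le> k * 5 + u k * (20 * (d + 1)) \<and> rep s' (B k 0) W N S F"], goal_cases)
      case (6 k t s1)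
      then have k: "k < n" "reg s1 ''i'' = k" and t: "t \<le> k * 5 + u k * (20 * (d + 1))"
        and r1: "rep s1 (B k 0) W N S F" by (auto simp: rep_D[OF r])
      show ?case
      proof (rule run_CondI, goal_cases)
        case 1
        show ?case using k by (simp add: rep_D[OF r1])
      next
        case 2
        then have o: "out k \<noteq> {}" using k by (simp add: rep_D[OF r1] head_pos)
        then have "B (Suc k) 0 = B k 0" by (simp add: B_def less_Suc_eq fun_eq_iff) auto
        then show ?case using t r1 u[of k] o by simp
      next
        case 3
        then have o: "out k = {}" using k head_pos[of k] by (simp add: rep_D[OF r1])
        show ?case
        proof (rule run_For[where J = "\<lambda>y t s'. t \<le> y * 9 \<and> rep s' (B k y) W N S F"], goal_cases)
          case (6 y t2 s2)
          then have y: "y < d" "reg s2 ''y'' = y" "reg s2 ''i'' = k" and t2: "t2 \<le> y * 9"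
            and r2: "rep s2 (B k y) W N S F" using k by (auto simp: rep_D[OF r1])
          show ?case
          proof (cases "y = 0")
            case True
            then have "B k (Suc y) = B k y" by (simp add: B_def fun_eq_iff)
            then show ?thesis using r2 t2 y True by auto
          next
            case False
            have "B k (Suc y) = (B k y)(k := B k y k - {y})" using False o by (auto simp: B_def fun_eq_iff)
            then have "rep (set_arr ''alive'' ((arr s2 ''alive'')[ix2 d k y := 0]) s2) (B k (Suc y)) W N S F"
              using rep_write_alive[OF r2, of k y] k y by simp
            then show ?thesis using False t2 y k by (simp add: rep_D[OF r2])
          qed
        next
          case (7 t2 s2)
          have "B k d = B (Suc k) 0" using A o by (auto simp: B_def doms_def fun_eq_iff less_Suc_eq subset_eq)
          moreover have "t2 \<le> 9 * d" using 7 by (auto simp: rep_D[OF r1])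
          ultimately show ?case using 7 t u[of k] o by (auto simp: rep_D[OF r1])
        qed (use r1 w_bounds in \<open>auto simp: rep_D[OF r1]\<close>)
      qed
    next
      case (7 t s')
      have "B n 0 = collapse A" using n by (auto simp: B_def collapse_def fun_eq_iff)
      then show ?case using 7 by (auto simp: rep_D[OF r] u_def)
    qed (use r w_bounds B0 in \<open>auto simp: rep_D[OF r] u_def\<close>)
  qed simp
qed

text \<open>Counting by brute force over arcs, pairs and witnesses is affordable: there are
  \<open>2 * e * d * d * d\<close> combinations.\<close>

lemma run_Count:
  assumes A: "doms A" and r: "rep s A (\<lambda>_ _ _. 0) (\<lambda>_ _ _. 0) S F" and d: "0 < e \<Longrightarrow> 0 < d"
  shows "run w Count s (\<lambda>t s'. t \<le> 6 + e * (400 * (d * d * d)) \<and> rep s' A (Wf A) (Nf (Wf A)) S F)"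
proof -
  define V where "V = (\<lambda>P q b a. if P q b a then Wf A q b a else (0::nat))"
  have Nf_0: "Nf (\<lambda>_ _ _. 0) = (\<lambda>_ _ _. 0)" by (simp add: Nf_def fun_eq_iff)
  show ?thesis
    unfolding Count_def
  proof (rule run_For[where J = "\<lambda>k t s'. t \<le> k * (150 * (d * d * d)) \<and>
      rep s' A (V (\<lambda>q b a. q < k)) (Nf (V (\<lambda>q b a. q < k))) S F"], goal_cases)
    case (6 k t s1)
    then have k: "k < 2 * e" "reg s1 ''q'' = k" and t: "t \<le> k * (150 * (d * d * d))"
      and r1: "rep s1 A (V (\<lambda>q b a. q < k)) (Nf (V (\<lambda>q b a. q < k))) S F" by (auto simp: rep_D[OF r])
    have d0: "1 \<le> d" "d \<le> d * d" "d * d \<le> d * d * d" using k d by auto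
    have out: "out (src k) \<noteq> {}" "k \<in> out (src k)" using k by (auto simp: out_def)
    show ?case
    proof (rule run_For[where J = "\<lambda>y t s'. t \<le> y * (129 * (d * d)) \<and>
      rep s' A (V (\<lambda>q b a. q < k \<or> q = k \<and> b < y)) (Nf (V (\<lambda>q b a. q < k \<or> q = k \<and> b < y))) S F"], goal_cases)
      case (6 y t2 s2)
      then have y: "y < d" "reg s2 ''y'' = y" "reg s2 ''q'' = k" and t2: "t2 \<le> y * (129 * (d * d))"
        and r2: "rep s2 A (V (\<lambda>q b a. q < k \<or> q = k \<and> b < y)) (Nf (V (\<lambda>q b a. q < k \<or> q = k \<and> b < y))) S F"
        using k by (auto simp: rep_D[OF r1])
      let ?P = "\<lambda>z q b a. q < k \<or> q = k \<and> (b < y \<or> b = y \<and> a < z)"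
      show ?case
      proof (rule run_For[where J = "\<lambda>z t s'. t \<le> z * (107 * d) \<and> rep s' A (V (?P z)) (Nf (V (?P z))) S F"], goal_cases)
        case (6 z t3 s3)
        then have z: "z < d" "reg s3 ''z'' = z" "reg s3 ''y'' = y" "reg s3 ''q'' = k" and t3: "t3 \<le> z * (107 * d)"
          and r3: "rep s3 A (V (?P z)) (Nf (V (?P z))) S F" using y by (auto simp: rep_D[OF r2])
        \<comment> \<open>The entry under construction has seen the candidates below
          \<open>j\<close>; all other entries are as before the loop.\<close>
        define U where "U = (\<lambda>j q b a. if q = k \<and> b = y \<and> a = z
          then card {c \<in> A (dst k). c < j \<and> R k y c \<and> \<not> R k z c} else V (?P z) q b a)"
        have Ule: "U j k y z \<le> d" for j
        proof -
          have "U j k y z \<le> card (A (dst k))" unfolding U_def by (simp add: card_mono doms_finite[OF A])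
          then show ?thesis using doms_card[OF A, of "dst k"] by simp
        qed
        have U: "U (Suc j) k y z = U j k y z + of_bool (j \<in> A (dst k)) * (of_bool (R k y j) * (1 - of_bool (R k z j)))" for j
        proof (cases "j \<in> A (dst k) \<and> R k y j \<and> \<not> R k z j")
          case True
          then have "{c \<in> A (dst k). c < Suc j \<and> R k y c \<and> \<not> R k z c} = insert j {c \<in> A (dst k). c < j \<and> R k y c \<and> \<not> R k z c}"
            by (auto simp: less_Suc_eq)
          then show ?thesis using True by (simp add: U_def)
        next
          case False
          then have "{c \<in> A (dst k). c < Suc j \<and> R k y c \<and> \<not> R k z c} = {c \<in> A (dst k). c < j \<and> R k y c \<and> \<not> R k z c}"
            by (auto simp: less_Suc_eq)
          then show ?thesis using False by (auto simp: U_def)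
        qed
        have "U 0 = V (?P z)" by (auto simp: U_def V_def intro!: ext)
        have "c < d" if "c \<in> A (dst k)" for c using that A by (auto simp: doms_def)
        then have eq: "{c \<in> A (dst k). c < d \<and> R k y c \<and> \<not> R k z c} = {c \<in> A (dst k). R k y c \<and> \<not> R k z c}" by auto
        have Ud: "U d = V (?P (Suc z))"
        proof (intro ext)
          fix q b a
          show "U d q b a = V (?P (Suc z)) q b a"
          proof (cases "q = k \<and> b = y \<and> a = z")
            case True
            then show ?thesis by (simp add: U_def V_def Wf_def eq)
          next
            case False
            then have *: "?P (Suc z) q b a \<longleftrightarrow> ?P z q b a" by (auto simp: less_Suc_eq)
            from False show ?thesis unfolding U_def V_def by (simp only: * if_False)
          qed
        qed
        have loop: "run w Witnesses s3
          (\<lambda>t s'. t \<le> 6 + 60 * d \<and> rep s' A (V (?P (Suc z))) (Nf (V (?P z))) S F)"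
          unfolding Witnesses_def
        proof (rule run_For[where J = "\<lambda>j t s'. t \<le> j * 52 \<and> rep s' A (U j) (Nf (V (?P z))) S F"], goal_cases)
          case (6 j t4 s4)
          then have j: "j < d" "reg s4 ''c'' = j" "reg s4 ''z'' = z" "reg s4 ''y'' = y" "reg s4 ''q'' = k"
            and t4: "t4 \<le> j * 52" and r4: "rep s4 A (U j) (Nf (V (?P z))) S F"
            using z by (auto simp: rep_D[OF r3])
          have "rep (set_arr ''W'' ((arr s4 ''W'')[ix3 d k y z := U (Suc j) k y z]) s4) A (U (Suc j)) (Nf (V (?P z))) S F"
            by (rule rep_write_W[OF r4]) (use k y z in \<open>auto simp: U_def\<close>)
          then show ?case using j k y z t4 Ule[of "Suc j"] w_bounds(3) dst_less[OF k(1)]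
            by (simp add: rep_D[OF r4] U)
        next
          case (7 t4 s4)
          then show ?case by (auto simp: rep_D[OF r3] Ud)
        qed (use r3 w_bounds \<open>U 0 = _\<close> in \<open>auto simp: rep_D[OF r3]\<close>)
        show ?case
        proof (rule run_Seq_mono[OF loop], goal_cases)
          case (1 t4 s4)
          then have r4: "rep s4 A (V (?P (Suc z))) (Nf (V (?P z))) S F" and t4: "t4 \<le> 6 + 60 * d"
            and j: "reg s4 ''z'' = z" "reg s4 ''y'' = y" "reg s4 ''q'' = k" using z by auto
          \<comment> \<open>A finished positive entry adds its arc to the count at its source; until
            then the entry was zero and the arc did not count.\<close>
          have N: "Nf (V (?P (Suc z))) i b a = Nf (V (?P z)) i b a + of_bool (i = src k \<and> b = y \<and> a = z) * of_bool (0 < Wf A k y z)"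
            for i b a
          proof -
            have "V (?P (Suc z)) q b a = (if q = k \<and> b = y \<and> a = z then Wf A k y z else V (?P z) q b a)" for q
              by (auto simp: V_def less_Suc_eq)
            moreover have "V (?P z) k y z = 0" by (simp add: V_def)
            ultimately have "{q \<in> out i. 0 < V (?P (Suc z)) q b a} =
              {q \<in> out i. 0 < V (?P z) q b a} \<union> (if i = src k \<and> b = y \<and> a = z \<and> 0 < Wf A k y z then {k} else {})"
              "i = src k \<and> b = y \<and> a = z \<longrightarrow> k \<notin> {q \<in> out i. 0 < V (?P z) q b a}"
              using out by (auto simp: out_def split: if_splits)
            then show ?thesis unfolding Nf_def by auto
          qed
          have "rep (set_arr ''N'' ((arr s4 ''N'')[ix3 d (head (src k) - Suc 0) y z := Nf (V (?P (Suc z))) (src k) y z]) s4)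
            A (V (?P (Suc z))) (Nf (V (?P (Suc z)))) S F"
            by (rule rep_write_N[OF r4]) (use k y z out src_less[OF k(1)] N in auto)
          moreover have "V (?P (Suc z)) k y z = Wf A k y z" by (simp add: V_def)
          ultimately show ?case
            using j k y z t3 t4 d0 src_less[OF k(1)] out src_head[OF out(1)] w_bounds
              Nf_le[of "V (?P (Suc z))" "src k" y z] card_out_le[of "src k"]
            by (simp add: rep_D[OF r4] Nix_def N)
        qed
      next
        case (7 t3 s3)
        have eq: "V (?P d) q b a = V (\<lambda>q b a. q < k \<or> q = k \<and> b < Suc y) q b a" if "a < d" for q b a
          using that by (auto simp: V_def less_Suc_eq)
        have N: "Nf (V (?P d)) i b a = Nf (V (\<lambda>q b a. q < k \<or> q = k \<and> b < Suc y)) i b a" if "a < d" for i b a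
          using eq that by (intro Nf_cong)
        have r3: "rep s3 A (V (?P d)) (Nf (V (?P d))) S F" and "t3 \<le> d * (107 * d)" using 7 by (auto simp: rep_D[OF r2])
        then have t3: "t3 \<le> 107 * (d * d)" by (simp add: algebra_simps)
        have "rep s3 A (V (\<lambda>q b a. q < k \<or> q = k \<and> b < Suc y)) (Nf (V (\<lambda>q b a. q < k \<or> q = k \<and> b < Suc y))) S F"
          by (rule rep_cong[OF r3]) (auto simp: eq N)
        moreover have "t2 + (t3 + 6 + 8 * d) \<le> Suc y * (129 * (d * d))"
          using t2 t3 d0 unfolding mult_Suc by linarith
        ultimately show ?case by (simp add: rep_D[OF r2])
      qed (use r2 w_bounds in \<open>auto simp: rep_D[OF r2]\<close>)
    next
      case (7 t2 s2)
      have eq: "V (\<lambda>q b a. q < k \<or> q = k \<and> b < d) q b a = V (\<lambda>q b a. q < Suc k) q b a" if "b < d" for q b a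
        using that by (auto simp: V_def less_Suc_eq)
      have N: "Nf (V (\<lambda>q b a. q < k \<or> q = k \<and> b < d)) i b a = Nf (V (\<lambda>q b a. q < Suc k)) i b a" if "b < d" for i b a
        using eq that by (intro Nf_cong)
      have r2: "rep s2 A (V (\<lambda>q b a. q < k \<or> q = k \<and> b < d)) (Nf (V (\<lambda>q b a. q < k \<or> q = k \<and> b < d))) S F"
        and "t2 \<le> d * (129 * (d * d))" using 7 by (auto simp: rep_D[OF r1])
      then have t2: "t2 \<le> 129 * (d * d * d)" by (simp add: algebra_simps)
      have "rep s2 A (V (\<lambda>q b a. q < Suc k)) (Nf (V (\<lambda>q b a. q < Suc k))) S F"
        by (rule rep_cong[OF r2]) (auto simp: eq N)
      moreover have "t + (t2 + 6 + 8 * d) \<le> Suc k * (150 * (d * d * d))"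
        using t t2 d0 unfolding mult_Suc by linarith
      ultimately show ?case by (simp add: rep_D[OF r1])
    qed (use r1 w_bounds in \<open>auto simp: rep_D[OF r1]\<close>)
  next
    case (7 t s')
    have r': "rep s' A (V (\<lambda>q b a. q < 2 * e)) (Nf (V (\<lambda>q b a. q < 2 * e))) S F"
      and t: "t \<le> 2 * e * (150 * (d * d * d))" using 7 by (auto simp: rep_D[OF r])
    have "Nf (V (\<lambda>q b a. q < 2 * e)) = Nf (Wf A)" by (auto simp: V_def intro!: ext Nf_cong)
    then have "rep s' A (Wf A) (Nf (Wf A)) S F" by (intro rep_cong[OF r']) (auto simp: V_def)
    moreover have e: "16 * e \<le> e * (100 * (d * d * d))"
    proof (cases "e = 0")
      case False
      then have "16 \<le> 100 * (d * d * d)" using d by (cases d) auto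
      then show ?thesis using mult_le_mono2[of 16 "100 * (d * d * d)" e] by (simp add: mult.commute)
    qed simp
    moreover have "e * (400 * (d * d * d)) = 2 * e * (150 * (d * d * d)) + e * (100 * (d * d * d))"
      by (simp add: algebra_simps)
    then have "t + 6 + 8 * reg s ''E'' \<le> 6 + e * (400 * (d * d * d))"
      using t e unfolding rep_D(4)[OF r] by linarith
    ultimately show ?case by blast
  qed (use r w_bounds in \<open>auto simp: rep_D[OF r] V_def Nf_0\<close>)
qed

lemma run_Support:
  assumes A: "doms A" and r: "rep s A W (Nf W) (\<lambda>_ _ _. 0) {}" and d: "0 < e \<Longrightarrow> 0 < d"
  shows "run w Support s (\<lambda>t s'. t \<le> 6 + e * (400 * (d * d * d)) \<and>
     (\<exists>F. rep s' A W (Nf W) (Sf A W) F \<and> pend F A (Sf A W)))"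
proof -
  \<comment> \<open>The predicate \<open>P\<close> selects the candidates \<open>a\<close> that have
    been counted so far.\<close>
  define T where "T = (\<lambda>P q b c. card {a \<in> A (src q). P q b a \<and> a \<noteq> b \<and> R q a c \<and> good W q b a})"
  have T_less: "T P q b c < d" if "b < d" for P q b c
  proof -
    have "T P q b c \<le> card ({..<d} - {b})"
      unfolding T_def using A by (intro card_mono) (auto simp: doms_def)
    with that show ?thesis by simp
  qed
  have T_cong: "T P q b c = T P' q b c" if "\<And>a. a < d \<Longrightarrow> P q b a \<longleftrightarrow> P' q b a" for P P' q b c
    unfolding T_def using that A by (intro arg_cong[where f = card]) (auto simp: doms_def)
  show ?thesis
    unfolding Support_def
  proof (rule run_For[where J = "\<lambda>k t s'. t \<le> k * (150 * (d * d * d)) \<and>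
      (\<exists>F. rep s' A W (Nf W) (T (\<lambda>q b a. q < k)) F \<and> {..<k} \<times> {..<d} \<subseteq> F)"], goal_cases)
    case (6 k t s1)
    then obtain F1 where k: "k < 2 * e" "reg s1 ''g'' = k" and t: "t \<le> k * (150 * (d * d * d))"
      and r1: "rep s1 A W (Nf W) (T (\<lambda>q b a. q < k)) F1" and F1: "{..<k} \<times> {..<d} \<subseteq> F1" by (auto simp: rep_D[OF r])
    have d0: "1 \<le> d" "d \<le> d * d" "d * d \<le> d * d * d" using k d by auto
    show ?case
    proof (rule run_For[where J = "\<lambda>y t s'. t \<le> y * (135 * (d * d)) \<and>
      (\<exists>F. rep s' A W (Nf W) (T (\<lambda>q b a. q < k \<or> q = k \<and> b < y)) F \<and> F1 \<subseteq> F \<and> {k} \<times> {..<y} \<subseteq> F)"], goal_cases)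
      case (6 y t2 s2)
      then obtain F2 where y: "y < d" "reg s2 ''y'' = y" "reg s2 ''g'' = k" and t2: "t2 \<le> y * (135 * (d * d))"
        and r2: "rep s2 A W (Nf W) (T (\<lambda>q b a. q < k \<or> q = k \<and> b < y)) F2"
        and F2: "F1 \<subseteq> F2" "{k} \<times> {..<y} \<subseteq> F2"
        using k by (auto simp: rep_D[OF r1])
      let ?P = "\<lambda>z q b a. q < k \<or> q = k \<and> (b < y \<or> b = y \<and> a < z)"
      have push: "run w (Push (Reg ''g'') (Reg ''y'')) s2
        (\<lambda>t s'. t \<le> 18 + 3 * (cost (Reg ''g'') + cost (Reg ''y'')) \<and>
          rep s' A W (Nf W) (T (\<lambda>q b a. q < k \<or> q = k \<and> b < y)) (insert (k, y) F2))"
        by (rule run_Push[OF r2]) (use k y in auto)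
      show ?case
      proof (rule run_Seq_mono[OF push], elim conjE, goal_cases)
        case (1 t3 s3)
        note r3 = 1(3)
        have y3: "reg s3 ''y'' = y" "reg s3 ''g'' = k" using 1 y by auto
        have t3: "t3 \<le> 24" using 1 by simp
        show ?case
        proof (rule run_For[where J = "\<lambda>z t s'. t \<le> z * (89 * d) \<and> rep s' A W (Nf W) (T (?P z)) (insert (k, y) F2)"], goal_cases)
          case (6 z t4 s4)
          then have z: "z < d" "reg s4 ''z'' = z" "reg s4 ''y'' = y" "reg s4 ''g'' = k" and t4: "t4 \<le> z * (89 * d)"
            and r4: "rep s4 A W (Nf W) (T (?P z)) (insert (k, y) F2)" using y3 by (auto simp: rep_D[OF r3])
          have T: "T (?P (Suc z)) q b c = T (?P z) q b c +
            of_bool (q = k \<and> b = y \<and> R k z c) * of_bool (z \<in> A (src k) \<and> z \<noteq> y \<and> good W k y z)" for q b c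
          proof (cases "q = k \<and> b = y \<and> R k z c \<and> z \<in> A (src k) \<and> z \<noteq> y \<and> good W k y z")
            case True
            then have "{a \<in> A (src q). ?P (Suc z) q b a \<and> a \<noteq> b \<and> R q a c \<and> good W q b a} =
              insert z {a \<in> A (src q). ?P z q b a \<and> a \<noteq> b \<and> R q a c \<and> good W q b a}"
              by (auto simp: less_Suc_eq)
            then show ?thesis using True doms_finite[OF A] by (simp add: T_def)
          next
            case False
            then have "{a \<in> A (src q). ?P (Suc z) q b a \<and> a \<noteq> b \<and> R q a c \<and> good W q b a} =
              {a \<in> A (src q). ?P z q b a \<and> a \<noteq> b \<and> R q a c \<and> good W q b a}"
              by (auto simp: less_Suc_eq)
            then have "T (?P (Suc z)) q b c = T (?P z) q b c" by (simp only: T_def)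
            then show ?thesis using False by auto
          qed
          show ?case
          proof (rule run_CondI, goal_cases)
            case 1
            show ?case using k y z src_less[OF k(1)] by (simp add: rep_D[OF r4] safe_Good[OF r4])
          next
            case 2
            then have c: "z \<in> A (src k) \<and> z \<noteq> y \<and> good W k y z"
              using k y z src_less[OF k(1)] by (auto simp: rep_D[OF r4] ev_Good[OF r4] of_bool_def split: if_splits)
            have eq: "T (?P (Suc z)) = (\<lambda>q b c. T (?P z) q b c + of_bool (q = k \<and> b = y \<and> R k z c))"
              using c by (simp add: T fun_eq_iff)
            have "run w Gain s4 (\<lambda>t s'. t \<le> 6 + 39 * d \<and>
              rep s' A W (Nf W) (\<lambda>q b c. T (?P z) q b c + of_bool (q = k \<and> b = y \<and> R k z c)) (insert (k, y) F2))"
              by (rule run_Gain[OF r4]) (use k y z T_less in auto)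
            then show ?case by (rule run_mono) (use t4 d0 in \<open>auto simp: eq\<close>)
          next
            case 3
            then have c: "\<not> (z \<in> A (src k) \<and> z \<noteq> y \<and> good W k y z)"
              using k y z src_less[OF k(1)] by (auto simp: rep_D[OF r4] ev_Good[OF r4] of_bool_def split: if_splits)
            have eq: "T (?P (Suc z)) = T (?P z)" using c by (auto simp: T fun_eq_iff)
            show ?case unfolding run_skip eq using t4 d0 r4 by simp
          qed
        next
          case (7 t4 s4)
          have r4: "rep s4 A W (Nf W) (T (?P d)) (insert (k, y) F2)" and "t4 \<le> d * (89 * d)" using 7 by (auto simp: rep_D[OF r3])
          then have t4: "t4 \<le> 89 * (d * d)" by (simp add: algebra_simps)
          have "T (?P d) q b c = T (\<lambda>q b a. q < k \<or> q = k \<and> b < Suc y) q b c" for q b c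
            by (rule T_cong) (auto simp: less_Suc_eq)
          then have "rep s4 A W (Nf W) (T (\<lambda>q b a. q < k \<or> q = k \<and> b < Suc y)) (insert (k, y) F2)"
            by (intro rep_cong[OF r4]) auto
          moreover have "t2 + (t3 + (t4 + 6 + 8 * d)) \<le> Suc y * (135 * (d * d))"
            using t2 t3 t4 d0 unfolding mult_Suc by linarith
          moreover have "F1 \<subseteq> insert (k, y) F2" "{k} \<times> {..<Suc y} \<subseteq> insert (k, y) F2"
            using F2 by (auto simp: less_Suc_eq subset_eq)
          ultimately show ?case
            unfolding rep_D(2)[OF r3] rep_set_reg by (intro conjI exI[of _ "insert (k, y) F2"]) auto
        next
          case 5
          have "T (\<lambda>q b a. q < k \<or> q = k \<and> b < y) q b c = T (?P 0) q b c" for q b c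
            by (rule T_cong) auto
          then have "rep s3 A W (Nf W) (T (?P 0)) (insert (k, y) F2)"
            by (intro rep_cong[OF r3]) auto
          then show ?case by simp
        qed (use r3 w_bounds in \<open>auto simp: rep_D[OF r3]\<close>)
      qed
    next
      case (7 t2 s2)
      then obtain F2 where r2: "rep s2 A W (Nf W) (T (\<lambda>q b a. q < k \<or> q = k \<and> b < d)) F2"
        and F2: "F1 \<subseteq> F2" "{k} \<times> {..<d} \<subseteq> F2" and "t2 \<le> d * (135 * (d * d))" by (auto simp: rep_D[OF r1])
      then have t2: "t2 \<le> 135 * (d * d * d)" by (simp add: algebra_simps)
      have "T (\<lambda>q b a. q < k \<or> q = k \<and> b < d) q b c = T (\<lambda>q b a. q < Suc k) q b c" if "b < d" for q b c
        by (rule T_cong) (use that in \<open>auto simp: less_Suc_eq\<close>)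
      then have "rep s2 A W (Nf W) (T (\<lambda>q b a. q < Suc k)) F2"
        by (intro rep_cong[OF r2]) auto
      moreover have "t + (t2 + 6 + 8 * d) \<le> Suc k * (150 * (d * d * d))"
        using t t2 d0 unfolding mult_Suc by linarith
      moreover have "{..<Suc k} \<times> {..<d} \<subseteq> F2" using F1 F2 by (auto simp: less_Suc_eq subset_eq)
      ultimately show ?case by (auto simp: rep_D[OF r1])
    next
      case 5
      have "T (\<lambda>q b a. q < k) q b c = T (\<lambda>q b a. q < k \<or> q = k \<and> b < 0) q b c" for q b c
        by (rule T_cong) auto
      then have "rep s1 A W (Nf W) (T (\<lambda>q b a. q < k \<or> q = k \<and> b < 0)) F1"
        by (intro rep_cong[OF r1]) auto
      then show ?case by auto
    qed (use r1 w_bounds in \<open>auto simp: rep_D[OF r1]\<close>)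
  next
    case (7 t s')
    then obtain F where r': "rep s' A W (Nf W) (T (\<lambda>q b a. q < 2 * e)) F" and F: "{..<2*e} \<times> {..<d} \<subseteq> F"
      and t: "t \<le> 2 * e * (150 * (d * d * d))" by (auto simp: rep_D[OF r])
    have "T (\<lambda>q b a. q < 2 * e) q b c = Sf A W q b c" if "q < 2 * e" for q b c
      using that by (simp add: T_def Sf_def)
    then have "rep s' A W (Nf W) (Sf A W) F" by (intro rep_cong[OF r']) auto
    moreover have "pend F A (Sf A W)" using F A by (auto simp: pend_def doms_def subset_eq)
    moreover have e: "16 * e \<le> e * (100 * (d * d * d))"
    proof (cases "e = 0")
      case False
      then have "16 \<le> 100 * (d * d * d)" using d by (cases d) auto
      then show ?thesis using mult_le_mono2[of 16 "100 * (d * d * d)" e] by (simp add: mult.commute)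
    qed simp
    moreover have "e * (400 * (d * d * d)) = 2 * e * (150 * (d * d * d)) + e * (100 * (d * d * d))"
      by (simp add: algebra_simps)
    then have "t + 6 + 8 * reg s ''E'' \<le> 6 + e * (400 * (d * d * d))"
      using t e unfolding rep_D(4)[OF r] by linarith
    ultimately show ?case by blast
  next
    case 5
    have "rep s A W (Nf W) (T (\<lambda>q b a. q < 0)) {}"
      by (intro rep_cong[OF r]) (auto simp: T_def)
    then show ?case by auto
  qed (use r w_bounds in \<open>auto simp: rep_D[OF r]\<close>)
qed

end

section \<open>Instances in terms of positions\<close>

locale presented =
  fixes I :: "'v csp" and val :: "nat \<Rightarrow> nat \<Rightarrow> 'v" and es :: "(nat \<times> nat) list"
  assumes csp: "binary_csp I" and pres: "presentation I val es"
begin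

abbreviation n :: nat where "n \<equiv> nvars I"
abbreviation d :: nat where "d \<equiv> max_dom_size I"
abbreviation e :: nat where "e \<equiv> length es"

definition dsize :: "nat \<Rightarrow> nat" where "dsize i = card (vdom I i)"

definition src :: "nat \<Rightarrow> nat" where "src q = (if q < e then fst (es ! q) else snd (es ! (q - e)))"
definition dst :: "nat \<Rightarrow> nat" where "dst q = (if q < e then snd (es ! q) else fst (es ! (q - e)))"

definition X :: "nat \<Rightarrow> nat \<Rightarrow> nat \<Rightarrow> nat \<Rightarrow> bool" where
  "X i j b c \<longleftrightarrow> (val i b, val j c) \<in> crel I i j"

text \<open>Beyond the domain size \<open>val\<close> is arbitrary. The guards make such positions
  incompatible with everything, matching the zero padding of the input.\<close>

definition R :: "nat \<Rightarrow> nat \<Rightarrow> nat \<Rightarrow> bool" where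
  "R q b c \<longleftrightarrow> b < dsize (src q) \<and> c < dsize (dst q) \<and> X (src q) (dst q) b c"

lemma dsize_le: "i < n \<Longrightarrow> dsize i \<le> d"
  unfolding dsize_def max_dom_size_def by (rule Max_ge) auto

lemma bij_val: "i < n \<Longrightarrow> bij_betw (val i) {..<dsize i} (vdom I i)"
  using pres by (simp add: presentation_def dsize_def)

lemma val_inj: "i < n \<Longrightarrow> p < dsize i \<Longrightarrow> q < dsize i \<Longrightarrow> val i p = val i q \<longleftrightarrow> p = q"
  using bij_val[of i] by (auto simp: bij_betw_def inj_on_def)

lemma vdom_eq: "i < n \<Longrightarrow> vdom I i = val i ` {..<dsize i}"
  using bij_val[of i] by (auto simp: bij_betw_def)

lemma X_sym: "i < n \<Longrightarrow> j < n \<Longrightarrow> i \<noteq> j \<Longrightarrow> X i j b c \<longleftrightarrow> X j i c b"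
  using csp unfolding X_def binary_csp_def by blast

lemma constrain_sym: "constrain I i j \<Longrightarrow> constrain I j i"
  using csp unfolding constrain_def binary_csp_def by (metis converse_Times converse_converse)

lemma es_constrain: "q < e \<Longrightarrow> constrain I (fst (es ! q)) (snd (es ! q))"
proof -
  assume "q < e"
  then have "{fst (es ! q), snd (es ! q)} \<in> set (map (\<lambda>(i, j). {i, j}) es)"
    by (force simp: case_prod_beta)
  then obtain i j where "{fst (es ! q), snd (es ! q)} = {i, j}" "constrain I i j"
    using pres by (auto simp: presentation_def constraint_edges_def)
  then show ?thesis using constrain_sym by (auto simp: doubleton_eq_iff)
qed

lemma src_dst_constrain: "q < 2 * e \<Longrightarrow> constrain I (src q) (dst q)"
  using es_constrain constrain_sym by (auto simp: src_def dst_def)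

lemma constrain_edge:
  assumes "constrain I i j"
  shows "\<exists>q<2*e. src q = i \<and> dst q = j"
proof -
  have "{i, j} \<in> constraint_edges I" using assms by (auto simp: constraint_edges_def)
  then have "{i, j} \<in> set (map (\<lambda>(i, j). {i, j}) es)" using pres by (simp add: presentation_def)
  then obtain q where q: "q < e" "{fst (es ! q), snd (es ! q)} = {i, j}"
    by (auto simp: in_set_conv_nth case_prod_beta)
  then consider "fst (es ! q) = i" "snd (es ! q) = j" | "fst (es ! q) = j" "snd (es ! q) = i"
    by (auto simp: doubleton_eq_iff)
  then show ?thesis
  proof cases
    case 1
    with q show ?thesis by (intro exI[of _ q]) (auto simp: src_def dst_def)
  next
    case 2
    with q show ?thesis by (intro exI[of _ "q + e"]) (auto simp: src_def dst_def)
  qed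
qed

lemma ends_inj: "q < e \<Longrightarrow> q' < e \<Longrightarrow> {fst (es ! q), snd (es ! q)} = {fst (es ! q'), snd (es ! q')} \<Longrightarrow> q = q'"
proof -
  assume *: "q < e" "q' < e" "{fst (es ! q), snd (es ! q)} = {fst (es ! q'), snd (es ! q')}"
  let ?l = "map (\<lambda>(i, j). {i, j}) es"
  have "distinct ?l" using pres by (simp add: presentation_def)
  moreover have "?l ! q = ?l ! q'" using * by (simp add: case_prod_beta)
  ultimately show "q = q'" using * nth_eq_iff_index_eq[of ?l q q'] by (simp only: length_map simp_thms)
qed

sublocale net n d e src dst R
proof
  fix q assume "q < 2 * e"
  from src_dst_constrain[OF this] show "src q < n" "dst q < n" "src q \<noteq> dst q" by (auto simp: constrain_def)
next
  fix q q' assume *: "q < 2 * e" "q' < 2 * e" "src q = src q'" "dst q = dst q'"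
  \<comment> \<open>\<open>h\<close> gives the underlying edge. Equal ends mean equal edges, which
    leaves only the two orientations, and these differ in their source.\<close>
  define h where "h = (\<lambda>q. if q < e then q else q - e)"
  have h: "{src q, dst q} = {fst (es ! h q), snd (es ! h q)}" for q
    by (auto simp: src_def dst_def h_def)
  have "h q = h q'" using * h[of q] h[of q'] by (intro ends_inj) (auto simp: h_def)
  moreover have "src q \<noteq> dst q" using src_dst_constrain[OF *(1)] by (simp add: constrain_def)
  ultimately show "q = q'" using * by (auto simp: h_def src_def dst_def split: if_splits)
next
  fix q assume "q < e"
  then show "src (q + e) = dst q" "dst (q + e) = src q" by (auto simp: src_def dst_def)
next
  fix q c b assume q: "q < e"
  then have "constrain I (src q) (dst q)" using src_dst_constrain[of q] by simp
  then show "R (q + e) c b \<longleftrightarrow> R q b c"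
    using q X_sym[of "src q" "dst q" b c] by (auto simp: R_def src_def dst_def constrain_def)
qed

definition A0 :: "nat \<Rightarrow> nat set" where "A0 i = (if i < n then {..<dsize i} else {})"

lemma doms_A0: "doms A0"
  using dsize_le by (auto simp: doms_def A0_def)

lemma nonedge_full:
  assumes "i < n" "j < n" "i \<noteq> j" "\<And>q. q < 2 * e \<Longrightarrow> src q = i \<Longrightarrow> dst q \<noteq> j" "b < dsize i" "c < dsize j"
  shows "X i j b c"
proof -
  have "\<not> constrain I i j" using constrain_edge assms by blast
  then have "crel I i j = vdom I i \<times> vdom I j" using assms by (simp add: constrain_def)
  then show ?thesis using assms by (auto simp: X_def vdom_eq)
qed

text \<open>A relation and not a function of \<open>A\<close>: \<open>crel\<close> on the diagonal
  and components at indices beyond \<open>nvars\<close> are left open, and removals may change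
  \<open>crel\<close> there.\<close>

definition restr :: "(nat \<Rightarrow> nat set) \<Rightarrow> 'v csp \<Rightarrow> bool" where
  "restr A I' \<longleftrightarrow> nvars I' = n \<and> (\<forall>i. A i \<subseteq> A0 i) \<and> (\<forall>i<n. vdom I' i = val i ` A i) \<and>
     (\<forall>i<n. \<forall>j<n. i \<noteq> j \<longrightarrow> crel I' i j = crel I i j \<inter> vdom I' i \<times> vdom I' j)"

definition cnsA :: "(nat \<Rightarrow> nat set) \<Rightarrow> nat \<Rightarrow> nat \<Rightarrow> bool" where
  "cnsA A i b \<longleftrightarrow> (\<exists>j<n. j \<noteq> i \<and> (\<forall>c\<in>A j. X i j b c \<longrightarrow>
     (\<exists>a\<in>A i - {b}. X i j a c \<and> (\<forall>k<n. k \<notin> {i, j} \<longrightarrow> (\<forall>c\<in>A k. X i k b c \<longrightarrow> X i k a c)))))"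

lemma restr_A0: "restr A0 I"
proof -
  have "crel I i j \<subseteq> vdom I i \<times> vdom I j" if "i < n" "j < n" "i \<noteq> j" for i j
    using csp that unfolding binary_csp_def by blast
  then have "crel I i j = crel I i j \<inter> vdom I i \<times> vdom I j" if "i < n" "j < n" "i \<noteq> j" for i j
    using that by blast
  then show ?thesis using vdom_eq unfolding restr_def A0_def by simp
qed

lemma restr_crel:
  assumes "restr A I'" "i < n" "j < n" "i \<noteq> j" "b \<in> A i" "c \<in> A j"
  shows "(val i b, val j c) \<in> crel I' i j \<longleftrightarrow> X i j b c"
  using assms by (auto simp: restr_def X_def)

lemma cns_iff:
  assumes r: "restr A I'" and i: "i < n" "b \<in> A i"
  shows "cns I' i (val i b) \<longleftrightarrow> cnsA A i b"
proof -
  have sub: "A k \<subseteq> A0 k" for k using r by (simp add: restr_def)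
  have nv: "nvars I' = n" and vd: "\<And>k. k < n \<Longrightarrow> vdom I' k = val k ` A k" using r by (auto simp: restr_def)
  have inj: "val i a = val i b \<longleftrightarrow> a = b" if "a \<in> A i" for a
    using val_inj[OF i(1)] sub[of i] i that by (auto simp: A0_def)
  have diff: "vdom I' i - {val i b} = val i ` (A i - {b})" using inj i by (auto simp: vd)
  have arr: "arrow I' i k (val i b) (val i a) \<longleftrightarrow> (\<forall>c\<in>A k. X i k b c \<longrightarrow> X i k a c)"
    if "k < n" "k \<noteq> i" "a \<in> A i" for k a
    using that i restr_crel[OF r] by (auto simp: arrow_def vd)
  have inner: "(\<forall>c\<in>vdom I' j. (val i b, c) \<in> crel I' i j \<longrightarrow> (\<exists>a\<in>val i ` (A i - {b}). (a, c) \<in> crel I' i j \<and>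
      (\<forall>k<n. k \<notin> {i, j} \<longrightarrow> arrow I' i k (val i b) a))) \<longleftrightarrow>
    (\<forall>c\<in>A j. X i j b c \<longrightarrow>
      (\<exists>a\<in>A i - {b}. X i j a c \<and> (\<forall>k<n. k \<notin> {i, j} \<longrightarrow> (\<forall>c\<in>A k. X i k b c \<longrightarrow> X i k a c))))"
    if j: "j < n" "j \<noteq> i" for j
  proof -
    have "(\<forall>k<n. k \<notin> {i, j} \<longrightarrow> arrow I' i k (val i b) (val i a)) \<longleftrightarrow>
      (\<forall>k<n. k \<notin> {i, j} \<longrightarrow> (\<forall>c\<in>A k. X i k b c \<longrightarrow> X i k a c))" if "a \<in> A i" for a
      using arr that by blast
    then show ?thesis using j i restr_crel[OF r i(1) j(1)] by (simp add: vd)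
  qed
  have "val i b \<in> vdom I' i" using vd i by simp
  then have "cns I' i (val i b) \<longleftrightarrow> (\<exists>j<n. j \<noteq> i \<and>
    (\<forall>c\<in>vdom I' j. (val i b, c) \<in> crel I' i j \<longrightarrow> (\<exists>a\<in>val i ` (A i - {b}). (a, c) \<in> crel I' i j \<and>
      (\<forall>k<n. k \<notin> {i, j} \<longrightarrow> arrow I' i k (val i b) a))))"
    unfolding cns_def nv diff using i(1) by blast
  then show ?thesis unfolding cnsA_def using inner by blast
qed

lemma restr_remove:
  assumes r: "restr A I'" and i: "i < n" "b \<in> A i"
  shows "restr (A(i := A i - {b})) (remove_value I' i (val i b))"
proof -
  have sub: "A k \<subseteq> A0 k" for k using r by (simp add: restr_def)
  have "val i a = val i b \<longleftrightarrow> a = b" if "a \<in> A i" for a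
    using val_inj[OF i(1)] sub[of i] i that by (auto simp: A0_def)
  then have "val i ` A i - {val i b} = val i ` (A i - {b})" by auto
  then show ?thesis using r i sub unfolding restr_def remove_value_def Let_def by auto
qed

section \<open>Eliminations preserve arc consistency\<close>

definition ac :: "(nat \<Rightarrow> nat set) \<Rightarrow> bool" where
  "ac A \<longleftrightarrow> (\<forall>i<n. \<forall>j<n. i \<noteq> j \<longrightarrow> (\<forall>b\<in>A i. \<exists>c\<in>A j. X i j b c))"

text \<open>Besides reachability from \<open>I\<close>, this bundles what the treatment of trivial
  constraints needs, arc consistency and nonempty domains; both survive CNS eliminations.\<close>

definition reach :: "(nat \<Rightarrow> nat set) \<Rightarrow> bool" where
  "reach A \<longleftrightarrow> ac A \<and> (\<forall>i<n. A i \<noteq> {}) \<and> (\<exists>I'. cns_elim\<^sup>*\<^sup>* I I' \<and> restr A I')"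

lemma reach_sub: "reach A \<Longrightarrow> A i \<subseteq> A0 i"
  by (auto simp: reach_def restr_def)

text \<open>Only a neighbouring value \<open>c\<close> supported by \<open>b\<close> is in danger.
  At the conditioning variable \<open>j\<close> the condition itself supplies a substitute
  compatible with \<open>c\<close>; elsewhere the \<open>a0\<close> obtained from a support
  \<open>c0\<close> of \<open>b\<close> at \<open>j\<close> inherits all neighbours of
  \<open>b\<close>. The same \<open>a0\<close> keeps the domain nonempty.\<close>

lemma reach_remove:
  assumes re: "reach A" and i: "i < n" "b \<in> A i" and c: "cnsA A i b"
  shows "reach (A(i := A i - {b}))"
proof -
  from c obtain j where j: "j < n" "j \<noteq> i"
    and sub: "\<And>c. c \<in> A j \<Longrightarrow> X i j b c \<Longrightarrow>
       \<exists>a\<in>A i - {b}. X i j a c \<and> (\<forall>k<n. k \<notin> {i, j} \<longrightarrow> (\<forall>c\<in>A k. X i k b c \<longrightarrow> X i k a c))"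
    unfolding cnsA_def by blast
  have ac: "ac A" using re by (simp add: reach_def)
  then obtain c0 where c0: "c0 \<in> A j" "X i j b c0" using i j unfolding ac_def by metis
  from sub[OF c0] obtain a0 where a0: "a0 \<in> A i - {b}"
    "\<And>k c. k < n \<Longrightarrow> k \<notin> {i, j} \<Longrightarrow> c \<in> A k \<Longrightarrow> X i k b c \<Longrightarrow> X i k a0 c" by blast
  have "\<exists>a\<in>A i - {b}. X k i c a" if k: "k < n" "k \<noteq> i" "c \<in> A k" for k c
  proof -
    from ac k i obtain a where a: "a \<in> A i" "X k i c a" unfolding ac_def by metis
    show ?thesis
    proof (cases "a = b")
      case True
      with a k i have b: "X i k b c" using X_sym by metis
      show ?thesis
      proof (cases "k = j")
        case True
        with sub[of c] k b obtain a' where "a' \<in> A i - {b}" "X i k a' c" by blast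
        then show ?thesis using X_sym[of i k] k i by blast
      next
        case False
        then have "X i k a0 c" using a0 k b by blast
        then show ?thesis using X_sym[of i k] k i a0 by blast
      qed
    qed (use a in auto)
  qed
  then have "ac (A(i := A i - {b}))" using ac unfolding ac_def by auto
  moreover have "\<forall>k<n. (A(i := A i - {b})) k \<noteq> {}" using re a0 by (auto simp: reach_def)
  moreover from re obtain I' where I': "cns_elim\<^sup>*\<^sup>* I I'" "restr A I'" by (auto simp: reach_def)
  have "cns_elim I' (remove_value I' i (val i b))"
    unfolding cns_elim_def using cns_iff[OF I'(2) i] c by blast
  with I' restr_remove[OF I'(2) i] have "\<exists>I'. cns_elim\<^sup>*\<^sup>* I I' \<and> restr (A(i := A i - {b})) I'"
    by (meson rtranclp.rtrancl_into_rtrancl)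
  ultimately show ?thesis by (simp add: reach_def)
qed

text \<open>Neighbours joined by an arc are covered by the counters, and at all other variables the
  relation is full. As parallel arcs are excluded, the arcs other than \<open>q\<close> are those to
  variables other than \<open>dst q\<close>.\<close>

lemma good_Wf_iff:
  assumes re: "reach A" and q: "q < 2 * e" and b: "b \<in> A (src q)" and a: "a \<in> A (src q)"
  shows "good (Wf A) q b a \<longleftrightarrow>
    (\<forall>k<n. k \<notin> {src q, dst q} \<longrightarrow> (\<forall>c\<in>A k. X (src q) k b c \<longrightarrow> X (src q) k a c))"
proof -
  have sub: "A k \<subseteq> A0 k" for k using re by (rule reach_sub)
  have fin: "finite (A k)" for k using sub[of k] by (auto simp: A0_def intro: finite_subset split: if_splits)
  have W: "Wf A p b a = 0 \<longleftrightarrow> (\<forall>c\<in>A (dst p). X (src q) (dst p) b c \<longrightarrow> X (src q) (dst p) a c)"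
    if "p \<in> out (src q)" for p
  proof -
    have p: "p < 2 * e" "src p = src q" using that by (auto simp: out_def)
    have R: "R p b c \<longleftrightarrow> X (src q) (dst p) b c" "R p a c \<longleftrightarrow> X (src q) (dst p) a c" if "c \<in> A (dst p)" for c
      using that sub[of "dst p"] sub[of "src q"] a b p src_less[OF p(1)] dst_less[OF p(1)]
      by (auto simp: R_def A0_def)
    have "Wf A p b a = 0 \<longleftrightarrow> {c \<in> A (dst p). R p b c \<and> \<not> R p a c} = {}"
      unfolding Wf_def using fin by simp
    then show ?thesis using R by auto
  qed
  show ?thesis
  proof
    assume g: "good (Wf A) q b a"
    show "\<forall>k<n. k \<notin> {src q, dst q} \<longrightarrow> (\<forall>c\<in>A k. X (src q) k b c \<longrightarrow> X (src q) k a c)"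
    proof (intro allI impI ballI)
      fix k c assume k: "k < n" "k \<notin> {src q, dst q}" "c \<in> A k" "X (src q) k b c"
      show "X (src q) k a c"
      proof (cases "\<exists>p<2*e. src p = src q \<and> dst p = k")
        case True
        then obtain p where p: "p < 2 * e" "src p = src q" "dst p = k" by blast
        then have "p \<in> out (src q)" "p \<noteq> q" using k by (auto simp: out_def)
        then show ?thesis using g W p k by (auto simp: good_def)
      next
        case False
        then show ?thesis using nonedge_full[of "src q" k a c] k src_less[OF q] sub[of "src q"] sub[of k] a
          by (auto simp: A0_def)
      qed
    qed
  next
    assume *: "\<forall>k<n. k \<notin> {src q, dst q} \<longrightarrow> (\<forall>c\<in>A k. X (src q) k b c \<longrightarrow> X (src q) k a c)"
    have "Wf A p b a = 0" if p: "p \<in> out (src q)" "p \<noteq> q" for p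
    proof -
      have p': "p < 2 * e" "src p = src q" using p by (auto simp: out_def)
      then have "dst p \<notin> {src q, dst q}" using src_neq_dst[of p] edge_inj[of p q] p q by auto
      then show ?thesis using * dst_less[OF p'(1)] W[OF p(1)] by blast
    qed
    then show "good (Wf A) q b a" by (simp add: good_def)
  qed
qed

lemma cnse_imp_cnsA:
  assumes re: "reach A" and q: "q < 2 * e" and b: "b \<in> A (src q)" and c: "cnse A q b"
  shows "cnsA A (src q) b"
proof -
  have sub: "A k \<subseteq> A0 k" for k using re by (rule reach_sub)
  note lt = src_less[OF q] dst_less[OF q] src_neq_dst[OF q]
  have "\<exists>a\<in>A (src q) - {b}. X (src q) (dst q) a c \<and>
      (\<forall>k<n. k \<notin> {src q, dst q} \<longrightarrow> (\<forall>c\<in>A k. X (src q) k b c \<longrightarrow> X (src q) k a c))"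
    if cc: "c \<in> A (dst q)" "X (src q) (dst q) b c" for c
  proof -
    have "R q b c" using cc b lt sub[of "src q"] sub[of "dst q"] by (auto simp: R_def A0_def)
    then obtain a where a: "a \<in> A (src q)" "a \<noteq> b" "R q a c" "good (Wf A) q b a"
      using c cc unfolding cnse_def by blast
    then show ?thesis using good_Wf_iff[OF re q b a(1)] by (intro bexI[of _ a]) (auto simp: R_def)
  qed
  then show ?thesis unfolding cnsA_def using lt by (intro exI[of _ "dst q"]) auto
qed

text \<open>If the conditioning constraint is trivial, any \<open>c0\<close> in the nonempty domain
  of \<open>j\<close> yields one \<open>a\<close> that dominates \<open>b\<close> at every variable,
  and this \<open>a\<close> serves for all \<open>c\<close> along any arc out of \<open>i\<close>.
  Without arcs, only the existence of \<open>a\<close> is kept.\<close>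

lemma cnsA_imp_cnse:
  assumes re: "reach A" and i: "i < n" "b \<in> A i" and c: "cnsA A i b"
  shows "(\<exists>q\<in>out i. cnse A q b) \<or> (out i = {} \<and> (\<exists>a\<in>A i. a \<noteq> b))"
proof -
  have sub: "A k \<subseteq> A0 k" for k using re by (rule reach_sub)
  from c obtain j where j: "j < n" "j \<noteq> i"
    and supp: "\<And>c. c \<in> A j \<Longrightarrow> X i j b c \<Longrightarrow>
       \<exists>a\<in>A i - {b}. X i j a c \<and> (\<forall>k<n. k \<notin> {i, j} \<longrightarrow> (\<forall>c\<in>A k. X i k b c \<longrightarrow> X i k a c))"
    unfolding cnsA_def by blast
  show ?thesis
  proof (cases "\<exists>q<2*e. src q = i \<and> dst q = j")
    case True
    then obtain q where q: "q < 2 * e" "src q = i" "dst q = j" by blast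
    have "cnse A q b"
      unfolding cnse_def
    proof (intro ballI impI)
      fix c assume "c \<in> A (dst q)" "R q b c"
      then obtain a where a: "a \<in> A i - {b}" "X i j a c"
        "\<forall>k<n. k \<notin> {i, j} \<longrightarrow> (\<forall>c\<in>A k. X i k b c \<longrightarrow> X i k a c)"
        using supp[of c] q by (auto simp: R_def)
      then have "good (Wf A) q b a" using good_Wf_iff[OF re q(1), of b a] q i by auto
      moreover have "R q a c" using a q i sub[of i] sub[of j] j \<open>c \<in> A (dst q)\<close> by (auto simp: R_def A0_def)
      ultimately show "\<exists>a\<in>A (src q). a \<noteq> b \<and> R q a c \<and> good (Wf A) q b a" using a q by auto
    qed
    then show ?thesis using q by (auto simp: out_def)
  next
    case nonedge: False
    obtain c0 where c0: "c0 \<in> A j" using re j by (auto simp: reach_def)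
    have "X i j b c0" using nonedge c0 i j sub[of i] sub[of j] by (intro nonedge_full) (auto simp: A0_def)
    from supp[OF c0 this] obtain a where a: "a \<in> A i" "a \<noteq> b"
        "\<forall>k<n. k \<notin> {i, j} \<longrightarrow> (\<forall>c\<in>A k. X i k b c \<longrightarrow> X i k a c)" by blast
    show ?thesis
    proof (cases "out i = {}")
      case False
      then obtain q where q: "q < 2 * e" "src q = i" by (auto simp: out_def)
      have qj: "dst q \<noteq> j" "dst q \<noteq> i" using nonedge q src_neq_dst[OF q(1)] by auto
      have "\<forall>k<n. k \<notin> {src q, dst q} \<longrightarrow> (\<forall>c\<in>A k. X (src q) k b c \<longrightarrow> X (src q) k a c)"
      proof (intro allI impI ballI)
        fix k c assume k: "k < n" "k \<notin> {src q, dst q}" "c \<in> A k" "X (src q) k b c"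
        show "X (src q) k a c"
        proof (cases "k = j")
          case True
          then show ?thesis using nonedge k q i j a sub[of i] sub[of j]
            by (intro nonedge_full) (auto simp: A0_def)
        next
          case False
          then show ?thesis using a k q by auto
        qed
      qed
      then have g: "good (Wf A) q b a" using good_Wf_iff[OF re q(1), of b a] q i a by auto
      have "cnse A q b"
        unfolding cnse_def
      proof (intro ballI impI)
        fix c assume c: "c \<in> A (dst q)" "R q b c"
        then have "X i (dst q) a c" using a q qj dst_less[OF q(1)] by (auto simp: R_def)
        then have "R q a c" using c a q i sub[of i] by (auto simp: R_def A0_def)
        then show "\<exists>a\<in>A (src q). a \<noteq> b \<and> R q a c \<and> good (Wf A) q b a" using a q g by auto
      qed
      then show ?thesis using q by (auto simp: out_def)
    qed (use a in auto)
  qed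
qed

text \<open>All constraints of \<open>i\<close> are trivial, so any other value replaces
  \<open>b\<close>; \<open>1 < n\<close> provides a conditioning variable.\<close>

lemma isolated_cnsA:
  assumes re: "reach A" and i: "i < n" "1 < n" "out i = {}" and ab: "a \<in> A i" "b \<in> A i" "a \<noteq> b"
  shows "cnsA A i b"
proof -
  have sub: "A k \<subseteq> A0 k" for k using re by (rule reach_sub)
  define j where "j = (if i = 0 then 1 else 0 :: nat)"
  have j: "j < n" "j \<noteq> i" using i by (auto simp: j_def)
  have X: "X i k a c" if "k < n" "k \<noteq> i" "c \<in> A k" for k c
    using that i ab sub[of i] sub[of k] by (intro nonedge_full) (auto simp: A0_def out_def)
  show ?thesis unfolding cnsA_def
    using j ab X by (intro exI[of _ j]) auto
qed

lemma reach_isolated: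
  assumes "reach A" "i < n" "1 < n" "out i = {}" "p \<in> A i"
  shows "reach (A(i := {p}))"
  using assms
proof (induction "card (A i)" arbitrary: A rule: less_induct)
  case less
  have fin: "finite (A i)" using reach_sub[OF less.prems(1), of i]
    by (auto simp: A0_def intro: finite_subset split: if_splits)
  show ?case
  proof (cases "\<exists>b\<in>A i. b \<noteq> p")
    case True
    then obtain b where b: "b \<in> A i" "b \<noteq> p" by blast
    have "reach (A(i := A i - {b}))"
      using less.prems b by (intro reach_remove isolated_cnsA) auto
    moreover have "card ((A(i := A i - {b})) i) < card (A i)"
      unfolding fun_upd_same using fin b(1) by (rule card_Diff1_less)
    ultimately have "reach ((A(i := A i - {b}))(i := {p}))"
      using less.prems b by (intro less.hyps) auto
    then show ?thesis by (simp only: fun_upd_upd)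
  next
    case False
    then have "A i = {p}" using less.prems(5) by blast
    then have "A(i := {p}) = A" by (rule fun_upd_idem)
    with less.prems(1) show ?thesis by (simp only:)
  qed
qed

lemma reach_collapse:
  assumes "reach A0" "1 < n"
  shows "reach (collapse A0)"
proof -
  have "reach (\<lambda>i. if i < k \<and> i < n \<and> out i = {} then A0 i \<inter> {0} else A0 i)" for k
  proof (induction k)
    case 0
    then show ?case using assms by simp
  next
    case (Suc k)
    let ?B = "\<lambda>k i. if i < k \<and> i < n \<and> out i = {} then A0 i \<inter> {0} else A0 i"
    show ?case
    proof (cases "k < n \<and> out k = {}")
      case True
      have "A0 k \<noteq> {}" using assms True by (auto simp: reach_def)
      then have z: "0 \<in> A0 k" using True by (auto simp: A0_def)
      have "reach ((?B k)(k := {0}))" by (rule reach_isolated) (use Suc z True assms in auto)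
      moreover have "(?B k)(k := {0}) = ?B (Suc k)" using z True by (auto simp: fun_eq_iff less_Suc_eq)
      ultimately show ?thesis by simp
    next
      case False
      then have "?B (Suc k) = ?B k" by (auto simp: fun_eq_iff less_Suc_eq)
      then show ?thesis using Suc by simp
    qed
  qed
  from this[of n] show ?thesis using assms by (simp add: collapse_def)
qed

lemma elim_reach:
  assumes "elim\<^sup>*\<^sup>* A A'" "reach A"
  shows "reach A'"
  using assms
proof (induction rule: rtranclp_induct)
  case (step A1 A2)
  then obtain q v where q: "q < 2 * e" "v \<in> A1 (src q)" "cnse A1 q v" and A2: "A2 = A1(src q := A1 (src q) - {v})"
    unfolding elim_def by blast
  have "reach A1" using step by blast
  with q show ?case unfolding A2 by (intro reach_remove src_less cnse_imp_cnsA)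
qed simp

lemma elim_sub: "elim\<^sup>*\<^sup>* A A' \<Longrightarrow> A' i \<subseteq> A i"
  by (induction rule: rtranclp_induct) (auto simp: elim_def split: if_splits)

text \<open>The generic case has two variables and some nonempty domain. Otherwise there are no arcs
  and nothing is CNS, so \<open>I\<close> itself is the result.\<close>

lemma converged:
  assumes AC: "arc_consistent I" and el: "elim\<^sup>*\<^sup>* (collapse A0) A'"
    and fin: "\<And>q v. q < 2 * e \<Longrightarrow> v \<in> A' (src q) \<Longrightarrow> \<not> cnse A' q v"
  shows "\<exists>I'. cns_elim\<^sup>*\<^sup>* I I' \<and> cns_converged I' \<and> (\<forall>i<n. vdom I' i = val i ` A' i)"
proof (cases "1 < n \<and> (\<exists>i<n. dsize i \<noteq> 0)")
  case True
  have ac0: "ac A0"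
    unfolding ac_def
  proof (intro allI impI ballI)
    fix i j b assume ij: "i < n" "j < n" "i \<noteq> j" "b \<in> A0 i"
    then have "val i b \<in> vdom I i" by (auto simp: A0_def vdom_eq)
    then obtain w where "w \<in> vdom I j" "(val i b, w) \<in> crel I i j"
      using AC ij unfolding arc_consistent_def by blast
    then show "\<exists>c\<in>A0 j. X i j b c" using ij by (auto simp: vdom_eq X_def A0_def)
  qed
  \<comment> \<open>Arc consistency spreads nonemptiness from one domain to all of them.\<close>
  have "A0 j \<noteq> {}" if "j < n" for j
  proof -
    from True obtain i where i: "i < n" "0 \<in> A0 i" by (auto simp: A0_def)
    show ?thesis
    proof (cases "i = j")
      case False
      then show ?thesis using ac0 i that unfolding ac_def by blast
    qed (use i in auto)
  qed
  then have "reach A0" using ac0 restr_A0 by (auto simp: reach_def)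
  then have "reach (collapse A0)" using True by (intro reach_collapse) auto
  with el have re: "reach A'" by (rule elim_reach)
  then obtain I' where I': "cns_elim\<^sup>*\<^sup>* I I'" "restr A' I'" by (auto simp: reach_def)
  have "\<not> cns I' i v" for i v
  proof
    assume c: "cns I' i v"
    then have i: "i < n" "v \<in> vdom I' i" using I' by (auto simp: cns_def restr_def)
    then obtain b where b: "b \<in> A' i" "v = val i b" using I'(2) by (auto simp: restr_def)
    then have "cnsA A' i b" using cns_iff[OF I'(2) i(1)] c by simp
    from cnsA_imp_cnse[OF re i(1) b(1) this] show False
    proof
      assume "\<exists>q\<in>out i. cnse A' q b"
      then show False using fin b by (auto simp: out_def)
    next
      assume *: "out i = {} \<and> (\<exists>a\<in>A' i. a \<noteq> b)"
      \<comment> \<open>The collapse left at most position 0, and eliminations only shrink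
        domains.\<close>
      have "A' i \<subseteq> {0}" using elim_sub[OF el, of i] i True * by (auto simp: collapse_def split: if_splits)
      then show False using * b by auto
    qed
  qed
  then show ?thesis using I' by (auto simp: cns_converged_def restr_def)
next
  case False
  \<comment> \<open>A relation between empty domains equals their product, so it is trivial and
    gives no edge.\<close>
  have e0: "e = 0"
  proof (rule ccontr)
    assume "e \<noteq> 0"
    then have c: "constrain I (src 0) (dst 0)" by (intro src_dst_constrain) auto
    then have "1 < n" by (auto simp: constrain_def)
    with False have "vdom I i = {}" if "i < n" for i using that by (auto simp: vdom_eq)
    then show False using c csp unfolding constrain_def binary_csp_def by (metis Sigma_empty1 subset_empty)
  qed
  have collapse: "collapse A0 = A0" using False by (auto simp: collapse_def A0_def fun_eq_iff)
  have "\<not> elim A B" for A B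
  proof
    assume "elim A B"
    then obtain q where "q < 2 * e" by (auto simp only: elim_def)
    with e0 show False by simp
  qed
  then have "A' = collapse A0" using el by (metis converse_rtranclpE)
  moreover have "\<not> cns I i v" for i v
  proof (cases "1 < n")
    case True
    with False show ?thesis by (auto simp: cns_def vdom_eq)
  next
    case False
    then show ?thesis by (auto simp: cns_def)
  qed
  ultimately show ?thesis using collapse vdom_eq
    by (intro exI[of _ I]) (auto simp: cns_converged_def A0_def)
qed

end

section \<open>The complete program\<close>

fun read_free :: "expr \<Rightarrow> bool" where
  "read_free (Const k) = True"
| "read_free (Reg x) = True"
| "read_free (Read a f) = False"
| "read_free (Op b f g) = (read_free f \<and> read_free g)"

lemma safe_read_free: "read_free f \<Longrightarrow> safe s f"
  by (induction f) auto

lemma ev_read_free: "read_free f \<Longrightarrow> reg s' = reg s \<Longrightarrow> ev s' f = ev s f"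
  by (induction f) auto

text \<open>All arrays are allocated before the computation. Their sizes will depend on registers
  only, so each can be evaluated in the initial store.\<close>

primrec allocs :: "(string \<times> expr) list \<Rightarrow> com \<Rightarrow> com" where
  "allocs [] c = c"
| "allocs (x # xs) c = Seq (New (fst x) (snd x)) (allocs xs c)"

text \<open>Finiteness keeps \<open>store_size\<close> meaningful: a sum over an infinite set would
  be 0.\<close>

lemma store_size_set_arr:
  assumes "finite {a. arr s a \<noteq> []}"
  shows "store_size (set_arr x l s) \<le> store_size s + length l"
    and "finite {a. arr (set_arr x l s) a \<noteq> []}"
proof -
  let ?X = "insert x {a. arr s a \<noteq> []}"
  have fin: "finite ?X" using assms by simp
  have sub: "{a. arr (set_arr x l s) a \<noteq> []} \<subseteq> ?X" by auto
  then show "finite {a. arr (set_arr x l s) a \<noteq> []}" using fin by (rule finite_subset)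
  have "store_size (set_arr x l s) \<le> (\<Sum>a\<in>?X. length (arr (set_arr x l s) a))"
    unfolding store_size_def using sub fin by (intro sum_mono2) auto
  also have "\<dots> = length l + (\<Sum>a\<in>?X - {x}. length (arr s a))"
    using fin by (subst sum.remove[of _ x]) auto
  also have "(\<Sum>a\<in>?X - {x}. length (arr s a)) \<le> store_size s"
    unfolding store_size_def using assms by (intro sum_mono2) auto
  finally show "store_size (set_arr x l s) \<le> store_size s + length l" by simp
qed

text \<open>Space and time part ways here: the body is analysed by \<open>run\<close> in the store
  with all arrays in place, and the initial store plus the allocations account for the whole
  space.\<close>

lemma exec_allocs:
  assumes "alloc_free c" "finite {a. arr s a \<noteq> []}" "\<forall>x\<in>set xs. read_free (snd x)"
    and "run w c (foldl (\<lambda>s' x. set_arr (fst x) (replicate (ev s (snd x)) 0) s') s xs) Q"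
  shows "\<exists>t m s'. exec w (allocs xs c) s (t + (\<Sum>x\<leftarrow>xs. 1 + cost (snd x) + ev s (snd x))) m s' \<and>
     m \<le> store_size s + (\<Sum>x\<leftarrow>xs. ev s (snd x)) \<and> Q t s'"
  using assms(2-)
proof (induction xs arbitrary: s)
  case Nil
  then obtain t m s' where "exec w c s t m s'" "Q t s'" by (auto simp: run_def)
  then show ?case using exec_alloc_free[OF _ assms(1)] by fastforce
next
  case (Cons x xs)
  define s1 where "s1 = set_arr (fst x) (replicate (ev s (snd x)) 0) s"
  have ev: "ev s1 (snd y) = ev s (snd y)" if "y \<in> set xs" for y
    using Cons.prems(2) that by (intro ev_read_free) (auto simp: s1_def)
  have "foldl (\<lambda>s' x. set_arr (fst x) (replicate (ev s (snd x)) 0) s') s1 xs =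
    foldl (\<lambda>s' x. set_arr (fst x) (replicate (ev s1 (snd x)) 0) s') s1 xs"
    using ev by (intro foldl_cong) auto
  then have run: "run w c (foldl (\<lambda>s' x. set_arr (fst x) (replicate (ev s1 (snd x)) 0) s') s1 xs) Q"
    using Cons.prems(3) by (simp add: s1_def)
  have size1: "store_size s1 \<le> store_size s + ev s (snd x)" "finite {a. arr s1 a \<noteq> []}"
    using store_size_set_arr[OF Cons.prems(1), of "fst x" "replicate (ev s (snd x)) 0"] unfolding s1_def by simp_all
  obtain t m s' where 1: "exec w (allocs xs c) s1 (t + (\<Sum>x\<leftarrow>xs. 1 + cost (snd x) + ev s1 (snd x))) m s'"
     "m \<le> store_size s1 + (\<Sum>x\<leftarrow>xs. ev s1 (snd x))" "Q t s'"
    using Cons.IH[OF size1(2) _ run] Cons.prems(2) by auto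
  have sums: "(\<Sum>x\<leftarrow>xs. 1 + cost (snd x) + ev s1 (snd x)) = (\<Sum>x\<leftarrow>xs. 1 + cost (snd x) + ev s (snd x))"
    "(\<Sum>x\<leftarrow>xs. ev s1 (snd x)) = (\<Sum>x\<leftarrow>xs. ev s (snd x))"
    using ev by (auto intro!: arg_cong[where f = sum_list] map_cong)
  have "eval s (snd x) = Some (ev s (snd x))" using Cons.prems(2) by (simp add: eval_eq safe_read_free)
  then have "exec w (New (fst x) (snd x)) s (1 + cost (snd x) + ev s (snd x)) (max (store_size s) (store_size s1)) s1"
    by (rule exec.New) (simp add: s1_def)
  from exec.Seq[OF this 1(1)] show ?case
    using 1(2,3) size1(1) unfolding sums
    by (intro exI[of _ t] exI[of _ "max (max (store_size s) (store_size s1)) m"] exI[of _ s'])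
       (auto simp: add_ac)
qed

definition Body :: com where
  "Body = Seq Ends (Seq Matrices (Seq Link (Seq Isolated (Seq Count (Seq Support Propagate)))))"

lemma alloc_free_Body: "alloc_free Body"
  by (simp add: Body_def)

context net begin

text \<open>Every variable with an arc is a source. This converts costs linear in \<open>n\<close>,
  and the input size \<open>n * d\<close>, into the number of edges and of isolated
  variables.\<close>

lemma n_le_edges: "n \<le> 2 * e + card {i. i < n \<and> out i = {}}"
proof -
  have "{..<n} \<subseteq> src ` {..<2*e} \<union> {i. i < n \<and> out i = {}}" by (auto simp: out_def)
  then have "card {..<n} \<le> card (src ` {..<2*e} \<union> {i. i < n \<and> out i = {}})" by (intro card_mono) auto
  also have "\<dots> \<le> card (src ` {..<2*e}) + card {i. i < n \<and> out i = {}}" by (rule card_Un_le)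
  also have "card (src ` {..<2*e}) \<le> 2 * e" using card_image_le[of "{..<2*e}" src] by simp
  finally show ?thesis by simp
qed

end

context prog begin

lemma run_Body:
  assumes dm: "dims s" and rg: "regs s" and A: "doms A" and d: "0 < e \<Longrightarrow> 0 < d"
    and fst: "\<And>q. q < e \<Longrightarrow> arr s ''fst'' ! q = src q"
    and snd: "\<And>q. q < e \<Longrightarrow> arr s ''snd'' ! q = dst q"
    and rel: "\<And>q b c. q < e \<Longrightarrow> b < d \<Longrightarrow> c < d \<Longrightarrow> arr s ''rel'' ! ix3 d q b c = of_bool (R q b c)"
    and alive: "\<And>i p. i < n \<Longrightarrow> p < d \<Longrightarrow> arr s ''alive'' ! ix2 d i p = of_bool (p \<in> A i)"
    and zero: "\<And>a k. a \<in> {''W'', ''N'', ''S'', ''fl'', ''hd''} \<Longrightarrow> k < length (arr s a) \<Longrightarrow> arr s a ! k = 0"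
  shows "run w Body s (\<lambda>t s'. t \<le> 60 + 3600 * (e * (d * d * d)) + 40 * (card {i. i < n \<and> out i = {}} * (d + 1)) \<and>
     (\<exists>A'. elim\<^sup>*\<^sup>* (collapse A) A' \<and> Inv A' {} s' \<and> (\<forall>q<2*e. \<forall>v\<in>A' (src q). \<not> cnse A' q v)))"
proof -
  let ?u = "card {i. i < n \<and> out i = {}}"
  note rgs = regs_def
  show ?thesis
    unfolding Body_def
  proof (rule run_Seq_mono[OF run_Ends[OF dm rg fst snd]], assumption, assumption, elim conjE, goal_cases)
    case (1 t1 s1)
    have dm1: "dims s1" using 1 by (simp add: same_def)
    have rg1: "regs s1" using 1 rg by (simp add: regs_def)
    have a1: "arr s1 a = arr s a" if "a \<notin> {''src'', ''dst''}" for a using 1 that by (simp add: same_def)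
    have ends: "\<forall>q<2*e. arr s1 ''src'' ! q = src q \<and> arr s1 ''dst'' ! q = dst q" and t1: "t1 \<le> 6 + e * 50"
      using 1 by auto
    have rel1: "arr s1 ''rel'' ! ix3 d q b c = of_bool (R q b c)" if "q < e" "b < d" "c < d" for q b c
      using rel that a1 by simp
    show ?case
    proof (rule run_Seq_mono[OF run_Matrices[OF dm1 rg1 d rel1]], assumption, assumption, assumption, assumption,
        elim conjE, goal_cases)
      case (1 t2 s2)
      have dm2: "dims s2" using 1 by (simp add: same_def)
      have rg2: "regs s2" using 1 rg1 by (simp add: regs_def)
      have a2: "arr s2 a = arr s1 a" if "a \<notin> {''R''}" for a using 1 that by (simp add: same_def)
      have R2: "\<forall>q<2*e. \<forall>b<d. \<forall>c<d. arr s2 ''R'' ! ix3 d q b c = of_bool (R q b c)"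
        and t2: "t2 \<le> 6 + e * (100 * (d * d))" using 1 by auto
      have src2: "arr s2 ''src'' ! q = src q" if "q < 2 * e" for q using ends a2 that by simp
      have hd2: "arr s2 ''hd'' ! i = 0" if "i < n" for i using zero[of "''hd''" i] a1 a2 dm that by (simp add: dims_def)
      show ?case
      proof (rule run_Seq_mono[OF run_Link[OF dm2 rg2 src2 hd2]], assumption, assumption, elim conjE, goal_cases)
        case (1 t3 s3)
        have dm3: "dims s3" using 1 by (simp add: same_def)
        have rg3: "regs s3" using 1 rg2 by (simp add: regs_def)
        have a3: "arr s3 a = arr s2 a" if "a \<notin> {''nx'', ''hd''}" for a using 1 that by (simp add: same_def)
        have t3: "t3 \<le> 6 + e * 50" using 1 by simp
        have zero3: "arr s3 a ! k = 0" if "a \<in> {''W'', ''N'', ''S'', ''fl''}" "k < length (arr s a)" for a k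
          using zero[of a k] that a1[of a] a2[of a] a3[of a] by auto
        have "static s3"
          using 1 R2 ends dm3 rg3 a2 a3 by (simp add: static_def dims_def regs_def)
        have "stack s3 {}"
          using dm3 rg3 dm zero3[of "''fl''"] by (auto simp: stack_def dims_def regs_def bij_betw_def)
        have r3: "rep s3 A (\<lambda>_ _ _. 0) (\<lambda>_ _ _. 0) (\<lambda>_ _ _. 0) {}"
        proof -
          have "arr s ''W'' ! k = 0" "arr s ''N'' ! k = 0" "arr s ''S'' ! k = 0" if "k < 2 * e * d * d" for k
            using that zero[of _ k] dm by (simp_all add: dims_def)
          then show ?thesis
            using \<open>static s3\<close> \<open>stack s3 {}\<close> dm3 dm alive a1 a2 a3 src_head unfolding rep_def dims_def by simp
        qed
        show ?case
        proof (rule run_Seq_mono[OF run_Isolated[OF A r3]], elim conjE, goal_cases)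
          case (1 t4 s4)
          have t4: "t4 \<le> 20 + 13 * n + ?u * (20 * (d + 1))" using 1 by simp
          show ?case
          proof (rule run_Seq_mono[OF run_Count[OF doms_collapse[OF A] 1(3) d]], assumption, elim conjE, goal_cases)
            case (1 t5 s5)
            note t5 = 1(2)
            show ?case
            proof (rule run_Seq_mono[OF run_Support[OF doms_collapse[OF A] 1(3) d]], assumption, elim conjE exE, goal_cases)
              case (1 t6 s6 F)
              note t6 = 1(2)
              have I: "Inv (collapse A) F s6" using 1 doms_collapse[OF A] by (simp add: Inv_def)
              show ?case
              proof (rule run_mono[OF run_Propagate[OF I]], elim exE conjE, goal_cases)
                case (1 t7 s7 A')
                have dd: "e \<le> e * (d * d * d)" "e * (d * d) \<le> e * (d * d * d)"
                  using d by (cases "e = 0"; simp)+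
                \<comment> \<open>The initial potential: at most \<open>2 * e * d\<close> pairs at
                  \<open>100 * d\<close> each, \<open>phi\<close> at most
                  \<open>4 * e * d * d\<close> at \<open>220 * d\<close>, and mass at most
                  \<open>2 * e * d\<close> at \<open>700 * (d * d)\<close>.\<close>
                have "card F \<le> 2 * e * d"
                  using rep_sp rep_D(28) I unfolding Inv_def by metis
                then have "100 * (d * card F) \<le> 200 * (e * (d * d))"
                  using mult_le_mono2[of "card F" "2 * e * d" "100 * d"] by (simp add: algebra_simps)
                moreover have "220 * (d * phi (Wf (collapse A))) \<le> 880 * (e * (d * d * d))"
                  using mult_le_mono2[OF phi_le[of "Wf (collapse A)"], of "220 * d"] by (simp add: algebra_simps)
                moreover have "700 * (d * d * mass (collapse A)) \<le> 1400 * (e * (d * d * d))"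
                  using mult_le_mono2[OF mass_le[OF doms_collapse[OF A]], of "700 * (d * d)"] by (simp add: algebra_simps)
                moreover have "e * 50 + e * 50 + e * (100 * (d * d)) + 2 * (e * (400 * (d * d * d))) \<le>
                   1000 * (e * (d * d * d))"
                proof -
                  have "e * (100 * (d * d)) = 100 * (e * (d * d))" "e * (400 * (d * d * d)) = 400 * (e * (d * d * d))"
                    by simp_all
                  with dd show ?thesis by linarith
                qed
                moreover have "?u * (20 * (d + 1)) + 13 * ?u \<le> 40 * (?u * (d + 1))" by (simp add: algebra_simps)
                ultimately have "t1 + (t2 + (t3 + (t4 + (t5 + (t6 + t7))))) \<le>
                   60 + 3600 * (e * (d * d * d)) + 40 * (?u * (d + 1))"
                  using t1 t2 t3 t4 t5 t6 1(4) n_le_edges dd unfolding pot_def by linarith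
                then show ?case using 1 by blast
              qed
            qed
          qed
        qed
      qed
    qed
  qed
qed

end

lemma length_concat_map:
  "(\<And>x. x \<in> set xs \<Longrightarrow> length (f x) = m) \<Longrightarrow> length (concat (map f xs)) = length xs * m"
  by (induction xs) auto

lemma nth_concat_map:
  "(\<And>x. x \<in> set xs \<Longrightarrow> length (f x) = m) \<Longrightarrow> i < length xs \<Longrightarrow> j < m \<Longrightarrow>
     concat (map f xs) ! (i * m + j) = f (xs ! i) ! j"
proof (induction xs arbitrary: i)
  case (Cons x xs)
  then show ?case by (cases i) (auto simp: nth_append add.assoc)
qed simp

definition Program :: com where
  "Program = Seq (Assign ''E'' (Op Add (Reg ''e'') (Reg ''e'')))
    (let Ed = Op Mul (Reg ''E'') (Reg ''d''); Edd = Op Mul Ed (Reg ''d'') in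
     allocs [(''W'', Edd), (''N'', Edd), (''S'', Edd), (''R'', Edd), (''fl'', Ed), (''stq'', Ed), (''stb'', Ed),
       (''src'', Reg ''E''), (''dst'', Reg ''E''), (''nx'', Reg ''E''), (''hd'', Reg ''n'')] Body)"

context presented begin

lemma input_alive: "length (input_alive I) = n * d"
  "i < n \<Longrightarrow> p < d \<Longrightarrow> input_alive I ! ix2 d i p = of_bool (p \<in> A0 i)"
proof -
  let ?f = "\<lambda>i. map (\<lambda>p. of_bool (p < card (vdom I i)) :: nat) [0..<d]"
  show "length (input_alive I) = n * d"
    unfolding input_alive_def using length_concat_map[of "[0..<n]" ?f d] by simp
  assume "i < n" "p < d"
  then show "input_alive I ! ix2 d i p = of_bool (p \<in> A0 i)"
    unfolding input_alive_def ix2_def using nth_concat_map[of "[0..<n]" ?f d i p]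
    by (simp add: A0_def dsize_def)
qed

lemma input_matrix: "length (input_matrix I val i j) = d * d"
  "b < d \<Longrightarrow> c < d \<Longrightarrow> input_matrix I val i j ! (b * d + c) = of_bool (b < dsize i \<and> c < dsize j \<and> X i j b c)"
proof -
  let ?f = "\<lambda>p. map (\<lambda>q. of_bool (p < card (vdom I i) \<and> q < card (vdom I j) \<and> (val i p, val j q) \<in> crel I i j) :: nat) [0..<d]"
  show "length (input_matrix I val i j) = d * d"
    unfolding input_matrix_def using length_concat_map[of "[0..<d]" ?f d] by simp
  assume "b < d" "c < d"
  then show "input_matrix I val i j ! (b * d + c) = of_bool (b < dsize i \<and> c < dsize j \<and> X i j b c)"
    unfolding input_matrix_def using nth_concat_map[of "[0..<d]" ?f d b c]
    by (simp add: dsize_def X_def)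
qed

lemma input_rel:
  defines "rel \<equiv> concat (map (\<lambda>(i, j). input_matrix I val i j) es)"
  shows "length rel = e * d * d"
    and "q < e \<Longrightarrow> b < d \<Longrightarrow> c < d \<Longrightarrow> rel ! ix3 d q b c = of_bool (R q b c)"
proof -
  have len: "length ((\<lambda>(i, j). input_matrix I val i j) x) = d * d" for x
    by (cases x) (simp add: input_matrix)
  show "length rel = e * d * d"
    unfolding rel_def using length_concat_map[of es "\<lambda>(i, j). input_matrix I val i j" "d * d"] len by simp
  assume *: "q < e" "b < d" "c < d"
  then have "b * d + c < d * d" using ix2_less[of b d c d] by (simp add: ix2_def)
  with * have "rel ! (q * (d * d) + (b * d + c)) = input_matrix I val (src q) (dst q) ! (b * d + c)"
    unfolding rel_def using nth_concat_map[of es "\<lambda>(i, j). input_matrix I val i j" "d * d" q "b * d + c"] len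
    by (simp add: case_prod_beta src_def dst_def)
  moreover have "ix3 d q b c = q * (d * d) + (b * d + c)" by (simp add: ix3_def algebra_simps)
  ultimately show "rel ! ix3 d q b c = of_bool (R q b c)" using * by (simp add: input_matrix R_def)
qed

text \<open>An edge needs a relation different from the product of its domains, which is impossible
  when these are empty.\<close>

lemma dom_size_pos: "0 < e \<Longrightarrow> 0 < d"
proof (rule ccontr)
  assume "0 < e" "\<not> 0 < d"
  then have c: "constrain I (src 0) (dst 0)" by (intro src_dst_constrain) auto
  then have "dsize (src 0) = 0" using dsize_le[of "src 0"] \<open>\<not> 0 < d\<close> by (auto simp: constrain_def)
  then have "vdom I (src 0) = {}" using vdom_eq[of "src 0"] c by (auto simp: constrain_def)
  then show False using c csp unfolding constrain_def binary_csp_def by (metis Sigma_empty1 subset_empty)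
qed

lemma num_constraints: "num_constraints I = e"
  using pres distinct_card[of "map (\<lambda>(i, j). {i, j}) es"] by (simp add: presentation_def num_constraints_def)

lemma num_unconstrained: "num_unconstrained I = card {i. i < n \<and> out i = {}}"
proof -
  have "(\<forall>j. \<not> constrain I i j) \<longleftrightarrow> out i = {}" for i
    using constrain_edge src_dst_constrain by (auto simp: out_def)
  then show ?thesis by (simp add: num_unconstrained_def)
qed

lemma exec_Program:
  assumes n: "1 \<le> n" and AC: "arc_consistent I"
  defines "u \<equiv> card {i. i < n \<and> out i = {}}"
  defines "B \<equiv> e * d ^ 2 + u * (d + 1)"
  shows "\<exists>t m s I'. exec (10000 * B) Program (input_store I val es) t m s \<and>
     t \<le> 10000 * (e * d ^ 3 + u * (d + 1)) \<and> m \<le> 10000 * B \<and>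
     cns_elim\<^sup>*\<^sup>* I I' \<and> cns_converged I' \<and> (\<forall>i<n. vdom I' i = output_dom I val s i)"
proof -
  have nu: "n \<le> 2 * e + u" unfolding u_def by (rule n_le_edges)
  have pos: "1 \<le> e \<longrightarrow> 1 \<le> d" using dom_size_pos by (metis One_nat_def Suc_le_eq)
  have ed: "e \<le> e * d" "e * d \<le> e * d * d" "e * d * d \<le> e * d * d * d"
    using pos by (cases "e = 0"; simp)+
  have B: "B = e * d * d + u * d + u" by (simp add: B_def power2_eq_square)
  \<comment> \<open>The bounds have to absorb additive constants, so \<open>B\<close> must be
    positive; without edges, the variable that exists by \<open>n\<close> is isolated.\<close>
  have "1 \<le> B"
  proof (cases "e = 0")
    case True
    then show ?thesis using nu n B by simp
  next
    case False
    then have "1 \<le> e" by linarith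
    then show ?thesis using ed B by linarith
  qed
  have "d \<le> B"
  proof (cases "e = 0")
    case True
    then have "1 \<le> u" using nu n by simp
    then have "1 * d \<le> u * d" by (rule mult_le_mono1)
    then show ?thesis using B by linarith
  next
    case False
    then have "1 * d \<le> e * d" by (intro mult_le_mono1) linarith
    then show ?thesis using ed B by linarith
  qed
  \<comment> \<open>The space bound itself serves as the word bound.\<close>
  interpret prog n d e src dst R "10000 * B"
  proof
    show "1 \<le> 10000 * B" using \<open>1 \<le> B\<close> by linarith
    show "n \<le> 10000 * B" using nu ed B by linarith
    show "d \<le> 10000 * B" using \<open>d \<le> B\<close> by linarith
    show "2 * e \<le> 10000 * B" using ed B by linarith
    show "2 * e * d \<le> 10000 * B" using ed B by linarith
  qed
  define s0 where "s0 = set_reg ''E'' (2 * e) (input_store I val es)"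
  define Ed where "Ed = Op Mul (Reg ''E'') (Reg ''d'')"
  define Edd where "Edd = Op Mul Ed (Reg ''d'')"
  define xs where "xs = [(''W'', Edd), (''N'', Edd), (''S'', Edd), (''R'', Edd), (''fl'', Ed), (''stq'', Ed), (''stb'', Ed),
       (''src'', Reg ''E''), (''dst'', Reg ''E''), (''nx'', Reg ''E''), (''hd'', Reg ''n'')]"
  define s1 where "s1 = foldl (\<lambda>s' x. set_arr (fst x) (replicate (ev s0 (snd x)) 0) s') s0 xs"
  have Program: "Program = Seq (Assign ''E'' (Op Add (Reg ''e'') (Reg ''e''))) (allocs xs Body)"
    by (simp add: Program_def Let_def xs_def Ed_def Edd_def)
  have reg0: "reg s0 ''n'' = n" "reg s0 ''d'' = d" "reg s0 ''e'' = e" "reg s0 ''E'' = 2 * e" "reg s0 ''sp'' = 0"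
    by (simp_all add: s0_def input_store_def)
  have evs: "ev s0 Ed = 2 * e * d" "ev s0 Edd = 2 * e * d * d" by (simp_all add: Ed_def Edd_def reg0)
  let ?Z = "replicate (2 * e * d * d) 0" and ?Y = "replicate (2 * e * d) 0" and ?X = "replicate (2 * e) 0"
  have s1: "arr s1 = (arr s0)(''W'' := ?Z, ''N'' := ?Z, ''S'' := ?Z, ''R'' := ?Z, ''fl'' := ?Y, ''stq'' := ?Y,
      ''stb'' := ?Y, ''src'' := ?X, ''dst'' := ?X, ''nx'' := ?X, ''hd'' := replicate n 0)"
    "reg s1 = reg s0"
    unfolding s1_def xs_def foldl.simps fst_conv snd_conv evs ev.simps reg0 arr_set_arr reg_set_arr by (rule refl)+
  have arr0: "arr s0 ''alive'' = input_alive I" "arr s0 ''fst'' = map fst es" "arr s0 ''snd'' = map snd es"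
    "arr s0 ''rel'' = concat (map (\<lambda>(i, j). input_matrix I val i j) es)"
    by (simp_all add: s0_def input_store_def)
  have "dims s1" unfolding dims_def s1 by (simp add: arr0 input_alive(1) input_rel(1))
  moreover have "regs s1" by (simp add: regs_def s1 reg0)
  ultimately have body: "run (10000 * B) Body s1 (\<lambda>t s'. t \<le> 60 + 3600 * (e * (d * d * d)) + 40 * (u * (d + 1)) \<and>
     (\<exists>A'. elim\<^sup>*\<^sup>* (collapse A0) A' \<and> Inv A' {} s' \<and> (\<forall>q<2*e. \<forall>v\<in>A' (src q). \<not> cnse A' q v)))"
    unfolding u_def
  proof (rule run_Body[OF _ _ doms_A0 dom_size_pos])
    show "arr s1 a ! k = 0" if "a \<in> {''W'', ''N'', ''S'', ''fl'', ''hd''}" "k < length (arr s1 a)" for a k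
    proof -
      have "\<forall>k<length (arr s1 ''W''). arr s1 ''W'' ! k = 0" "\<forall>k<length (arr s1 ''N''). arr s1 ''N'' ! k = 0"
        "\<forall>k<length (arr s1 ''S''). arr s1 ''S'' ! k = 0" "\<forall>k<length (arr s1 ''fl''). arr s1 ''fl'' ! k = 0"
        "\<forall>k<length (arr s1 ''hd''). arr s1 ''hd'' ! k = 0"
        by (simp_all add: s1)
      with that(2) show ?thesis using that(1) by (elim insertE emptyE) (simp_all only: simp_thms)
    qed
  next
    show "arr s1 ''fst'' ! q = src q" if "q < e" for q using that by (simp add: s1 arr0 src_def)
    show "arr s1 ''snd'' ! q = dst q" if "q < e" for q using that by (simp add: s1 arr0 dst_def)
    show "arr s1 ''rel'' ! ix3 d q b c = of_bool (R q b c)" if "q < e" "b < d" "c < d" for q b c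
    proof -
      have "arr s1 ''rel'' = arr s0 ''rel''" by (simp add: s1)
      then show ?thesis using input_rel(2)[OF that] unfolding arr0 by (simp only:)
    qed
    show "arr s1 ''alive'' ! ix2 d i p = of_bool (p \<in> A0 i)" if "i < n" "p < d" for i p
    proof -
      have "arr s1 ''alive'' = arr s0 ''alive''" by (simp add: s1)
      then show ?thesis using input_alive(2)[OF that] unfolding arr0 by (simp only:)
    qed
  qed
  have size_is: "store_size (input_store I val es) \<le> n * d + e + e + e * d * d \<and>
    finite {a. arr (input_store I val es) a \<noteq> []}"
  proof -
    \<comment> \<open>The input store arises from the empty one by four array updates, each covered
      by the size lemma.\<close>
    define z where "z = \<lparr>reg = reg (input_store I val es), arr = (\<lambda>_. [])\<rparr>"
    define z1 where "z1 = set_arr ''alive'' (input_alive I) z"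
    define z2 where "z2 = set_arr ''fst'' (map fst es) z1"
    define z3 where "z3 = set_arr ''snd'' (map snd es) z2"
    have z: "input_store I val es = set_arr ''rel'' (concat (map (\<lambda>(i, j). input_matrix I val i j) es)) z3"
      by (simp add: z_def z1_def z2_def z3_def input_store_def set_arr_def)
    have f0: "store_size z = 0" "finite {a. arr z a \<noteq> []}" by (simp_all add: z_def store_size_def)
    have f1: "store_size z1 \<le> n * d" "finite {a. arr z1 a \<noteq> []}"
      using store_size_set_arr[OF f0(2), of "''alive''" "input_alive I"] f0(1)
      unfolding z1_def[symmetric] input_alive(1) by simp_all
    have f2: "store_size z2 \<le> n * d + e" "finite {a. arr z2 a \<noteq> []}"
      using store_size_set_arr[OF f1(2), of "''fst''" "map fst es"] f1(1)
      unfolding z2_def[symmetric] length_map by simp_all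
    have f3: "store_size z3 \<le> n * d + e + e" "finite {a. arr z3 a \<noteq> []}"
      using store_size_set_arr[OF f2(2), of "''snd''" "map snd es"] f2(1)
      unfolding z3_def[symmetric] length_map by simp_all
    show ?thesis
      using store_size_set_arr[OF f3(2), of "''rel''" "concat (map (\<lambda>(i, j). input_matrix I val i j) es)"] f3(1)
      unfolding z[symmetric] input_rel(1) by simp
  qed
  have size0: "store_size s0 = store_size (input_store I val es)"
    by (rule store_size_cong) (simp add: s0_def)
  have fin0: "finite {a. arr s0 a \<noteq> []}" using size_is by (simp add: s0_def)
  have rf: "\<forall>x\<in>set xs. read_free (snd x)" by (simp add: xs_def Ed_def Edd_def)
  obtain t m s' where ex: "exec (10000 * B) (allocs xs Body) s0 (t + (\<Sum>x\<leftarrow>xs. 1 + cost (snd x) + ev s0 (snd x))) m s'"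
    and m: "m \<le> store_size s0 + (\<Sum>x\<leftarrow>xs. ev s0 (snd x))"
    and t: "t \<le> 60 + 3600 * (e * (d * d * d)) + 40 * (u * (d + 1))"
    and post: "\<exists>A'. elim\<^sup>*\<^sup>* (collapse A0) A' \<and> Inv A' {} s' \<and> (\<forall>q<2*e. \<forall>v\<in>A' (src q). \<not> cnse A' q v)"
    using exec_allocs[OF alloc_free_Body fin0 rf body[unfolded s1_def]] by blast
  \<comment> \<open>Four tables of size \<open>2 * e * d * d\<close>, three arrays of size
    \<open>2 * e * d\<close>, three of size \<open>2 * e\<close>, and the list heads.\<close>
  have sum1: "(\<Sum>x\<leftarrow>xs. ev s0 (snd x)) = 8 * (e * d * d) + 6 * (e * d) + 6 * e + n"
    by (simp add: xs_def evs reg0)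
  have sum2: "(\<Sum>x\<leftarrow>xs. 1 + cost (snd x) + ev s0 (snd x)) = 44 + 8 * (e * d * d) + 6 * (e * d) + 6 * e + n"
    by (simp add: xs_def evs reg0) (simp add: Ed_def Edd_def)
  have "exec (10000 * B) (Assign ''E'' (Op Add (Reg ''e'') (Reg ''e''))) (input_store I val es)
     (1 + cost (Op Add (Reg ''e'') (Reg ''e''))) (store_size (input_store I val es)) (set_reg ''E'' (2 * e) (input_store I val es))"
    by (rule exec.Assign) (use w_bounds in \<open>simp_all add: input_store_def\<close>)
  from exec.Seq[OF this[folded s0_def] ex]
  have ex: "exec (10000 * B) Program (input_store I val es) (4 + (t + (44 + 8 * (e * d * d) + 6 * (e * d) + 6 * e + n)))
      (max (store_size (input_store I val es)) m) s'"
    unfolding Program sum2 by simp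
  have nd: "n * d \<le> 2 * (e * d) + u * d" using mult_le_mono1[OF nu, of d] by (simp add: algebra_simps)
  have space: "max (store_size (input_store I val es)) m \<le> 10000 * B"
  proof -
    have "m \<le> n * d + e + e + e * d * d + (8 * (e * d * d) + 6 * (e * d) + 6 * e + n)"
      using m size_is unfolding sum1 size0 by linarith
    moreover have "store_size (input_store I val es) \<le> n * d + e + e + e * d * d" using size_is by simp
    ultimately show ?thesis using nd nu ed B unfolding max.bounded_iff by (intro conjI; linarith)
  qed
  have time: "4 + (t + (44 + 8 * (e * d * d) + 6 * (e * d) + 6 * e + n)) \<le> 10000 * (e * d ^ 3 + u * (d + 1))"
  proof -
    \<comment> \<open>Replacing the products by variables makes the claim linear;
      \<open>1 \<le> p + U + u\<close> swallows the additive constants.\<close>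
    have "4 + (t + (44 + 8 * p + 6 * q + 6 * r + n)) \<le> 10000 * (P + (U + u))"
      if "1 \<le> p + U + u" "t \<le> 60 + 3600 * P + 40 * (U + u)" "r \<le> q" "q \<le> p" "p \<le> P" "n \<le> 2 * r + u"
      for p q r P U :: nat
      using that by simp
    moreover have "1 \<le> e * d * d + u * d + u" using \<open>1 \<le> B\<close> B by simp
    moreover have "t \<le> 60 + 3600 * (e * d * d * d) + 40 * (u * d + u)" using t by (simp add: algebra_simps)
    moreover have "e * d ^ 3 = e * d * d * d" "u * (d + 1) = u * d + u" by (simp_all add: power3_eq_cube)
    ultimately show ?thesis using ed nu by (simp only:)
  qed
  from post obtain A' where el: "elim\<^sup>*\<^sup>* (collapse A0) A'" and I: "Inv A' {} s'"
    and fin: "\<And>q v. q < 2 * e \<Longrightarrow> v \<in> A' (src q) \<Longrightarrow> \<not> cnse A' q v" by blast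
  obtain I' where I': "cns_elim\<^sup>*\<^sup>* I I'" "cns_converged I'" "\<And>i. i < n \<Longrightarrow> vdom I' i = val i ` A' i"
    using converged[OF AC el fin] by blast
  have "output_dom I val s' i = val i ` A' i" if i: "i < n" for i
  proof -
    have r: "rep s' A' (Wf A') (Nf (Wf A')) (Sf A' (Wf A')) {}" using I by (simp add: Inv_def)
    have sub: "A' i \<subseteq> {..<dsize i}" using elim_sub[OF el, of i] by (auto simp: collapse_def A0_def split: if_splits)
    have "p < dsize i \<and> i * d + p < length (arr s' ''alive'') \<and> arr s' ''alive'' ! (i * d + p) \<noteq> 0 \<longleftrightarrow> p \<in> A' i" for p
    proof (cases "p < dsize i")
      case True
      then have "p < d" using dsize_le[OF i] by simp
      then show ?thesis using True rep_D(22)[OF r i, of p] rep_D(10)[OF r] ix2_less[OF i, of p d]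
        by (simp add: ix2_def)
    next
      case False
      then show ?thesis using sub by auto
    qed
    then show ?thesis unfolding output_dom_def dsize_def[symmetric] by auto
  qed
  with I' have "\<forall>i<n. vdom I' i = output_dom I val s' i" by simp
  with ex time space I'(1,2) show ?thesis by blast
qed

end

theorem theorem3:
  "\<exists>(P :: com) (C :: nat). \<forall>(I :: 'v csp) val es.
     binary_csp I \<and> nvars I \<ge> 1 \<and> arc_consistent I \<and> presentation I val es \<longrightarrow>
     (let e = num_constraints I; d = max_dom_size I; u = num_unconstrained I in
      \<exists>t m s I'.
        exec (C * (e * d ^ 2 + u * (d + 1))) P (input_store I val es) t m s \<and>
        t \<le> C * (e * d ^ 3 + u * (d + 1)) \<and>
        m \<le> C * (e * d ^ 2 + u * (d + 1)) \<and>
        cns_elim\<^sup>*\<^sup>* I I' \<and> cns_converged I' \<and>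
        (\<forall>i<nvars I. vdom I' i = output_dom I val s i))"
proof (intro exI[of _ Program] exI[of _ 10000] allI impI)
  fix I :: "'v csp" and val es
  assume *: "binary_csp I \<and> nvars I \<ge> 1 \<and> arc_consistent I \<and> presentation I val es"
  interpret presented I val es by unfold_locales (use * in auto)
  show "let e = num_constraints I; d = max_dom_size I; u = num_unconstrained I in
      \<exists>t m s I'.
        exec (10000 * (e * d ^ 2 + u * (d + 1))) Program (input_store I val es) t m s \<and>
        t \<le> 10000 * (e * d ^ 3 + u * (d + 1)) \<and>
        m \<le> 10000 * (e * d ^ 2 + u * (d + 1)) \<and>
        cns_elim\<^sup>*\<^sup>* I I' \<and> cns_converged I' \<and>
        (\<forall>i<nvars I. vdom I' i = output_dom I val s i)"
    unfolding Let_def num_constraints num_unconstrained using * by (intro exec_Program) auto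
qed

end
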